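(* For every $n\ge 1$ there exists a constant $c_n>0$, depending only on $n$, such that for any $\mathbb C$-convex domain $D\subset\mathbb C^n$ containing no complex lines one has $$B_D(z;X)\,d_D(z,X)\le c_n,\qquad z\in D,\ X\in\mathbb C^n\setminus\{0\}.$$ In particular, $$\tfrac14\,\kappa_D(z;X)\le B_D(z;X)\le 4c_n\,\gamma_D(z;X),\qquad z\in D,\ X\in\mathbb C^n.$$
   Context: A domain $D\subset\mathbb C^n$ is $\mathbb C$-convex if every non-empty intersection of $D$ with a complex (affine) line is a simply connected domain (in particular connected). "Containing no complex lines" means $D$ contains no complex affine line. For $z\in D$ and $X\ne0$, $d_D(z,X)=\sup\{r>0: z+\lambda X\in D \text{ for all }\lambda\in\mathbb C,\ |\lambda|<r\}$. Let $\mathbb D\subset\mathbb C$ be the unit disc and $\mathcal O(A,B)$ the set of holomorphic maps $A\to B$. The Carathéodory metric is $\gamma_D(z;X)=\sup\{|f'(z)X|: f\in\mathcal O(D,\mathbb D),\ f(z)=0\}$; the Kobayashi metric is $\kappa_D(z;X)=\inf\{\alpha\ge0:\exists\varphi\in\mathcal O(\mathbb D,D):\varphi(0)=z,\ \alpha\varphi'(0)=X\}$. Let $L^2_h(D)$ be the Hilbert space of square-integrable holomorphic functions on $D$ with $L^2$-norm $\|\cdot\|_D$. Put $K_D(z)=\sup\{|f(z)|^2: f\in L^2_h(D),\ \|f\|_D\le1\}$ (Bergman kernel on the diagonal), $M_D(z;X)=\sup\{|f'(z)X|: f\in L^2_h(D),\ \|f\|_D=1,\ f(z)=0\}$, and,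 when $K_D(z)>0$, the Bergman metric $B_D(z;X)=M_D(z;X)/\sqrt{K_D(z)}$. (A $\mathbb C$-convex domain containing no complex lines is biholomorphic to a bounded domain, so $B_D$ is well-defined.) *)

theory Defs
  imports "HOL-Analysis.Analysis"
begin

text \<open>
  The space $C^n$ is \<^typ>\<open>complex ^ 'n\<close> with \<open>n = CARD('n)\<close>. Complex scalars act by \<^term>\<open>(*s)\<close>, and
  \<^term>\<open>lborel\<close> on it is the usual Lebesgue measure of $R^{2n}$.
\<close>

definition complex_line :: "(complex ^ 'n::finite) set \<Rightarrow> bool" where
  "complex_line L \<longleftrightarrow> (\<exists>a v. v \<noteq> 0 \<and> L = range (\<lambda>\<zeta>. a + \<zeta> *s v))"

definition domain_Cn :: "(complex ^ 'n::finite) set \<Rightarrow> bool" where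
  "domain_Cn D \<longleftrightarrow> open D \<and> connected D \<and> D \<noteq> {}"

text \<open>
  A non-empty slice \<open>D \<inter> L\<close> is automatically open in \<open>L\<close>, and \<^const>\<open>simply_connected\<close> includes
  path-connectedness, so this says that each non-empty slice is a simply connected domain in \<open>L\<close>.
\<close>

definition C_convex_domain :: "(complex ^ 'n::finite) set \<Rightarrow> bool" where
  "C_convex_domain D \<longleftrightarrow>
     domain_Cn D \<and>
     (\<forall>L. complex_line L \<and> D \<inter> L \<noteq> {} \<longrightarrow> simply_connected (D \<inter> L))"

definition contains_complex_line :: "(complex ^ 'n::finite) set \<Rightarrow> bool" where
  "contains_complex_line D \<longleftrightarrow> (\<exists>L. complex_line L \<and> L \<subseteq> D)"

text \<open>
  Holomorphy in several variables: real (Frechet) differentiability with complex-linear differential.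
  On an open set the differential at \<open>z\<close> is \<^term>\<open>frechet_derivative f (at z)\<close>.
\<close>

definition holomorphic_Cn_on :: "(complex ^ 'n::finite \<Rightarrow> complex) \<Rightarrow> (complex ^ 'n) set \<Rightarrow> bool" where
  "holomorphic_Cn_on f D \<longleftrightarrow>
     (\<forall>z\<in>D. \<exists>f'. (f has_derivative f') (at z within D) \<and> (\<forall>\<zeta> X. f' (\<zeta> *s X) = \<zeta> * f' X))"

text \<open>
  The suprema and infima below are taken in \<^typ>\<open>real\<close>. For a \<open>C\<close>-convex domain \<open>D\<close> without complex
  lines, \<open>z \<in> D\<close> and arbitrary \<open>X\<close> (\<open>X \<noteq> 0\<close> for \<open>line_dist\<close>), the sets involved are non-empty and bounded
  on the relevant side, so no default values occur.
\<close>

definition line_dist :: "(complex ^ 'n::finite) set \<Rightarrow> complex ^ 'n \<Rightarrow> complex ^ 'n \<Rightarrow> real" where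
  "line_dist D z X = Sup {r. r > 0 \<and> (\<forall>\<zeta>. cmod \<zeta> < r \<longrightarrow> z + \<zeta> *s X \<in> D)}"

definition caratheodory_metric :: "(complex ^ 'n::finite) set \<Rightarrow> complex ^ 'n \<Rightarrow> complex ^ 'n \<Rightarrow> real" where
  "caratheodory_metric D z X =
     Sup {cmod (frechet_derivative f (at z) X) | f.
            holomorphic_Cn_on f D \<and> f ` D \<subseteq> ball 0 1 \<and> f z = 0}"

definition kobayashi_metric :: "(complex ^ 'n::finite) set \<Rightarrow> complex ^ 'n \<Rightarrow> complex ^ 'n \<Rightarrow> real" where
  "kobayashi_metric D z X =
     Inf {\<alpha>. \<alpha> \<ge> 0 \<and>
            (\<exists>\<phi> :: complex \<Rightarrow> complex ^ 'n.
               (\<forall>i. (\<lambda>\<zeta>. \<phi> \<zeta> $ i) holomorphic_on ball 0 1) \<and> \<phi> ` ball 0 1 \<subseteq> D \<and>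
               \<phi> 0 = z \<and> \<alpha> *\<^sub>R (\<chi> i. deriv (\<lambda>\<zeta>. \<phi> \<zeta> $ i) 0) = X)}"

definition L2h :: "(complex ^ 'n::finite) set \<Rightarrow> (complex ^ 'n \<Rightarrow> complex) set" where
  "L2h D = {f. holomorphic_Cn_on f D \<and> set_integrable lborel D (\<lambda>w. (cmod (f w))\<^sup>2)}"

definition L2h_norm :: "(complex ^ 'n::finite) set \<Rightarrow> (complex ^ 'n \<Rightarrow> complex) \<Rightarrow> real" where
  "L2h_norm D f = sqrt (set_lebesgue_integral lborel D (\<lambda>w. (cmod (f w))\<^sup>2))"

definition bergman_kernel_diag :: "(complex ^ 'n::finite) set \<Rightarrow> complex ^ 'n \<Rightarrow> real" where
  "bergman_kernel_diag D z = Sup {(cmod (f z))\<^sup>2 | f. f \<in> L2h D \<and> L2h_norm D f \<le> 1}"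

definition bergman_M :: "(complex ^ 'n::finite) set \<Rightarrow> complex ^ 'n \<Rightarrow> complex ^ 'n \<Rightarrow> real" where
  "bergman_M D z X =
     Sup {cmod (frechet_derivative f (at z) X) | f. f \<in> L2h D \<and> L2h_norm D f = 1 \<and> f z = 0}"

text \<open>
  Only meaningful if \<^term>\<open>bergman_kernel_diag D z > 0\<close>, which holds for \<open>C\<close>-convex domains without
  complex lines since these are biholomorphic to bounded domains.
\<close>

definition bergman_metric :: "(complex ^ 'n::finite) set \<Rightarrow> complex ^ 'n \<Rightarrow> complex ^ 'n \<Rightarrow> real" where
  "bergman_metric D z X = bergman_M D z X / sqrt (bergman_kernel_diag D z)"

end

theory Submission
  imports Defs "HOL-Complex_Analysis.Complex_Analysis"
begin

text \<open>
  A \<open>C\<close>-convex domain is linearly convex, and its images under linear functionals are simply connected.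
  Fix \<open>z\<close> and consider the compact set \<open>Q\<close> of functionals \<open>b\<close> with \<open>b (w - z) \<noteq> 1\<close> on \<open>D\<close>. For
  \<open>l_1, ..., l_n\<close> in \<open>Q\<close> with maximal determinant, every element of \<open>Q\<close> is a combination of the \<open>l_i\<close> with
  coefficients of modulus at most one, so \<open>D\<close> contains \<open>{\<Sum> |l_i (w - z)| < 1}\<close>, while every \<open>l_i (D - z)\<close> is
  a simply connected planar domain omitting \<open>1\<close>. The Riemann maps of these planar domains, whose
  derivatives at \<open>0\<close> are at least \<open>1/4\<close> by Koebe's theorem, give a lower bound for the Bergman kernel: one
  uses the product of their derivatives. The mean value property on the inner set gives an upper
  bound for \<open>M_D\<close>. Both bounds scale with the same Jacobian, which cancels in \<open>B_D\<close>.

  The remaining inequalities follow from \<open>\<kappa>_D \<le> 1 / d_D\<close>, from \<open>\<gamma>_D \<ge> 1 / (4 d_D)\<close> (Koebe's theorem applied to a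
  functional whose kernel is parallel to a hyperplane missing \<open>D\<close>) and from \<open>\<gamma>_D \<le> B_D\<close>.
\<close>

subsection \<open>Translation invariance and rotation averages\<close>

text \<open>C-convexity only constrains one-dimensional slices, so no boundary regularity is at
  hand, and both consequences used, linear convexity and simply connected images, have to come from
  topology. The common tool is a branch of the logarithm on each slice: on a connected slice two
  branches differ by a constant, so increments are canonical and can be followed from slice to
  slice. A plane domain is recognised as simply connected by having a logarithm of
  \<open>l - q\<close> for every omitted \<open>q\<close>. Maximality of the determinant is what
  removes the shape of \<open>D\<close> from the estimates: one matrix yields both an inner l1 ball
  and \<open>n\<close> projections with a common omitted value. Absence of complex lines enters
  through the determinant being nonzero. The constant is
  \<open>2 * n * 4 ^ n * sqrt (\<omega> ^ n / \<beta>)\<close>: 2 from Cauchy's inequality on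
  circles of radius 1/2, \<open>n\<close> from summing over the functionals, each of modulus at most
  \<open>1 / d_D\<close> on \<open>X\<close>, \<open>4 ^ n\<close> from Koebe's theorem once per
  functional, \<open>\<omega>\<close> the area of the unit disc and \<open>\<beta>\<close> the
  volume of the l1 ball of radius 1/2.\<close>

lemma nn_integral_translate:
  fixes f :: "'a::euclidean_space \<Rightarrow> ennreal"
  assumes sets: "sets M = sets borel" and inv: "distr M borel ((+) a) = M" and f: "f \<in> borel_measurable borel"
  shows "(\<integral>\<^sup>+x. f (a + x) \<partial>M) = (\<integral>\<^sup>+x. f x \<partial>M)"
proof -
  have "(+) a \<in> measurable M borel" by (simp add: measurable_cong_sets[OF sets refl])
  then have "(\<integral>\<^sup>+x. f x \<partial>distr M borel ((+) a)) = (\<integral>\<^sup>+x. f (a + x) \<partial>M)"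
    using f by (intro nn_integral_distr) simp_all
  then show ?thesis by (simp add: inv)
qed

text \<open>Uniqueness of Haar measure: the double integral of
  \<open>indicator A y * indicator B (y + x)\<close> is computed in both orders. The symmetry of
  \<open>A\<close> turns \<open>y - x\<close> into \<open>x - y\<close>, to which the invariance of
  \<open>\<mu>\<close> applies. The cross-multiplied form stays meaningful for infinite
  measures.\<close>

lemma translation_invariant_unique:
  fixes \<mu> :: "'a::euclidean_space measure"
  assumes sets: "sets \<mu> = sets borel" and sf: "sigma_finite_measure \<mu>"
    and inv: "\<And>a. distr \<mu> borel ((+) a) = \<mu>"
    and A: "A \<in> sets borel" "\<And>x. - x \<in> A \<longleftrightarrow> x \<in> A" and B: "B \<in> sets borel"
  shows "emeasure lborel A * emeasure \<mu> B = emeasure lborel B * emeasure \<mu> A"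
proof -
  interpret P: pair_sigma_finite lborel \<mu>
    using sf by (simp add: pair_sigma_finite_def sigma_finite_lborel)
  note [measurable_cong] = sets
  have [measurable]: "A \<in> sets borel" "B \<in> sets borel" by fact+
  have inv': "(\<integral>\<^sup>+x. f (a + x) \<partial>\<mu>) = (\<integral>\<^sup>+x. f x \<partial>\<mu>)"
    if "f \<in> borel_measurable borel" for f a
    by (rule nn_integral_translate[OF sets inv that])
  have invl: "(\<integral>\<^sup>+x. f (a + x) \<partial>lborel) = (\<integral>\<^sup>+x. f x \<partial>lborel)"
    if "f \<in> borel_measurable borel" for f and a :: 'a
    by (rule nn_integral_translate[OF sets_lborel lborel_distr_plus that])
  have "emeasure lborel A * emeasure \<mu> B = (\<integral>\<^sup>+y. indicator A y * emeasure \<mu> B \<partial>lborel)"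
    by (simp add: nn_integral_multc)
  also have "\<dots> = (\<integral>\<^sup>+y. (\<integral>\<^sup>+x. indicator A y * indicator B (y + x) \<partial>\<mu>) \<partial>lborel)"
  proof (intro nn_integral_cong)
    fix y
    have "emeasure \<mu> B = (\<integral>\<^sup>+x. indicator B x \<partial>\<mu>)" by (simp add: sets)
    also have "\<dots> = (\<integral>\<^sup>+x. indicator B (y + x) \<partial>\<mu>)" by (rule inv'[symmetric]) simp
    finally show "indicator A y * emeasure \<mu> B = (\<integral>\<^sup>+x. indicator A y * indicator B (y + x) \<partial>\<mu>)"
      by (subst nn_integral_cmult) auto
  qed
  also have "\<dots> = (\<integral>\<^sup>+x. (\<integral>\<^sup>+y. indicator A y * indicator B (y + x) \<partial>lborel) \<partial>\<mu>)"
    by (rule P.Fubini'[symmetric]) measurable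
  also have "\<dots> = (\<integral>\<^sup>+x. (\<integral>\<^sup>+y. indicator A (y - x) * indicator B y \<partial>lborel) \<partial>\<mu>)"
  proof (rule nn_integral_cong)
    fix x
    show "(\<integral>\<^sup>+y. indicator A y * indicator B (y + x) \<partial>lborel) = (\<integral>\<^sup>+y. (indicator A (y - x) * indicator B y :: ennreal) \<partial>lborel)"
      by (subst invl[of _ "x", symmetric]) (auto simp: add.commute)
  qed
  also have "\<dots> = (\<integral>\<^sup>+y. (\<integral>\<^sup>+x. indicator A (y - x) * indicator B y \<partial>\<mu>) \<partial>lborel)"
    by (rule P.Fubini') measurable
  also have "\<dots> = (\<integral>\<^sup>+y. indicator B y * emeasure \<mu> A \<partial>lborel)"
  proof (intro nn_integral_cong)
    fix y
    have "(\<integral>\<^sup>+x. indicator A (y - x) \<partial>\<mu>) = (\<integral>\<^sup>+x. indicator A (-y + x) \<partial>\<mu>)"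
      by (intro nn_integral_cong) (simp add: indicator_def A(2)[of "y - x" for x, symmetric])
    also have "\<dots> = (\<integral>\<^sup>+x. indicator A x \<partial>\<mu>)" by (rule inv') simp
    also have "\<dots> = emeasure \<mu> A" by (simp add: sets)
    finally show "(\<integral>\<^sup>+x. indicator A (y - x) * indicator B y \<partial>\<mu>) = indicator B y * emeasure \<mu> A"
      by (subst nn_integral_multc) (auto simp: mult.commute)
  qed
  also have "\<dots> = emeasure lborel B * emeasure \<mu> A"
    by (simp add: nn_integral_multc)
  finally show ?thesis .
qed

text \<open>The first two claims are hypotheses of \<open>translation_invariant_unique\<close> for
  an image of Lebesgue measure; translating by \<open>a\<close> after \<open>T\<close> is
  translating by the preimage of \<open>a\<close> before it.\<close>

lemma distr_linear_lborel:
  fixes T :: "'a::euclidean_space \<Rightarrow> 'a"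
  assumes T: "linear T" "bij T"
  shows "sigma_finite_measure (distr lborel borel T)"
    and "distr (distr lborel borel T) borel ((+) a) = distr lborel borel T"
    and "emeasure (distr lborel borel T) (ball 0 1) = emeasure lborel (T -` ball 0 1)"
proof -
  have Tm [measurable]: "T \<in> borel_measurable borel"
    using T(1) by (intro borel_measurable_continuous_onI linear_continuous_on) (simp add: linear_conv_bounded_linear)
  obtain T' where T': "linear T'" "\<And>x. T' (T x) = x" "\<And>x. T (T' x) = x"
  proof
    show "linear (inv T)"
      using T linear_injective_left_inverse[OF T(1)] bij_is_inj[OF T(2)]
      by (metis inj_imp_inv_eq pointfree_idE bij_is_surj[OF T(2)] inv_f_f linear_injective_left_inverse surj_f_inv_f ext)
    show "inv T (T x) = x" "T (inv T x) = x" for x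
      using T(2) by (simp_all add: bij_is_inj bij_is_surj surj_f_inv_f)
  qed
  show "emeasure (distr lborel borel T) (ball 0 1) = emeasure lborel (T -` ball 0 1)"
    by (subst emeasure_distr) auto
  have fin: "emeasure (distr lborel borel T) (ball 0 r) \<noteq> \<infinity>" for r
  proof -
    have "T -` ball 0 r = T' ` ball 0 r" using T'(2,3) by (auto simp: image_iff intro!: bexI[of _ "T x" for x])
    also have "bounded \<dots>"
      using T'(1) by (intro bounded_linear_image) (auto simp: linear_conv_bounded_linear)
    finally show ?thesis
      using emeasure_bounded_finite[of "T -` ball 0 r"] by (subst emeasure_distr) (auto simp: less_top[symmetric])
  qed
  show "sigma_finite_measure (distr lborel borel T)"
  proof
    show "\<exists>A. countable A \<and> A \<subseteq> sets (distr lborel borel T) \<and> \<Union> A = space (distr lborel borel T) \<and>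
        (\<forall>a\<in>A. emeasure (distr lborel borel T) a \<noteq> \<infinity>)"
    proof (intro exI[of _ "range (\<lambda>n::nat. ball 0 (real n))"] conjI ballI)
      show "\<Union> (range (\<lambda>n::nat. ball 0 (real n))) = space (distr lborel borel T)"
        using reals_Archimedean2 by auto
    qed (use fin in auto)
  qed
  have "distr (distr lborel borel T) borel ((+) a) = distr lborel borel ((+) a \<circ> T)"
    by (rule distr_distr) auto
  also have "(+) a \<circ> T = T \<circ> (+) (T' a)"
    using T'(3) T(1) by (auto simp: fun_eq_iff linear_add)
  also have "distr lborel borel (T \<circ> (+) (T' a)) = distr (distr lborel borel ((+) (T' a))) borel T"
    by (rule distr_distr[symmetric]) auto
  also have "\<dots> = distr lborel borel T" by (simp add: lborel_distr_plus)
  finally show "distr (distr lborel borel T) borel ((+) a) = distr lborel borel T" .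
qed

text \<open>The unit ball is its own preimage, which forces the proportionality factor to be
  1.\<close>

lemma distr_linear_isometry:
  fixes T :: "'a::euclidean_space \<Rightarrow> 'a"
  assumes T: "linear T" "bij T" "\<And>x. norm (T x) = norm x"
  shows "distr lborel borel T = lborel"
proof (rule measure_eqI)
  fix B assume "B \<in> sets (distr lborel borel T)"
  then have B: "B \<in> sets borel" by simp
  have "T -` ball 0 1 = ball 0 1" using T(3) by auto
  then have "emeasure lborel (ball (0::'a) 1) * emeasure (distr lborel borel T) B = emeasure lborel B * emeasure lborel (ball (0::'a) 1)"
    using translation_invariant_unique[OF _ distr_linear_lborel(1,2)[OF T(1,2)] _ _ B, of "ball 0 1"]
      distr_linear_lborel(3)[OF T(1,2)] by simp
  moreover have "emeasure lborel (ball (0::'a) 1) \<noteq> 0" "emeasure lborel (ball (0::'a) 1) \<noteq> \<infinity>"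
    using emeasure_lborel_ball_finite[of "0::'a" 1] using unit_ball_vol_pos[of "real DIM('a)"] by (auto simp: emeasure_ball simp del: unit_ball_vol_pos)
  ultimately show "emeasure (distr lborel borel T) B = emeasure lborel B"
    by (metis ennreal_mult_cancel_left infinity_ennreal_def mult.commute)
qed simp

text \<open>The image measure is proportional to Lebesgue measure; the factor is the volume of the
  preimage of the unit ball divided by that of the unit ball. It is kept as an abstract Jacobian
  because it cancels in the final quotient.\<close>

lemma nn_integral_linear_lborel:
  fixes T :: "'a::euclidean_space \<Rightarrow> 'a"
  assumes T: "linear T" "bij T"
  obtains \<kappa> :: real where "\<kappa> > 0"
    "\<And>h. h \<in> borel_measurable borel \<Longrightarrow> (\<integral>\<^sup>+x. h (T x) \<partial>lborel) = ennreal \<kappa> * (\<integral>\<^sup>+x. h x \<partial>lborel)"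
proof -
  have Tm [measurable]: "T \<in> borel_measurable borel"
    using T(1) by (intro borel_measurable_continuous_onI linear_continuous_on) (simp add: linear_conv_bounded_linear)
  let ?\<mu> = "distr lborel borel T"
  let ?b = "emeasure lborel (ball (0::'a) 1)"
  have bb: "?b \<noteq> 0" "?b \<noteq> \<infinity>"
    using emeasure_lborel_ball_finite[of "0::'a" 1] using unit_ball_vol_pos[of "real DIM('a)"] by (auto simp: emeasure_ball simp del: unit_ball_vol_pos)
  have key: "?b * emeasure ?\<mu> B = emeasure lborel B * emeasure ?\<mu> (ball 0 1)" if "B \<in> sets borel" for B
    using translation_invariant_unique[OF _ distr_linear_lborel(1,2)[OF T] _ _ that, of "ball 0 1"]
    by simp
  have "emeasure ?\<mu> (ball 0 1) \<noteq> \<infinity>"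
  proof -
    have "emeasure ?\<mu> (ball 0 1) = emeasure lborel (T -` ball 0 1)"
      by (rule distr_linear_lborel(3)[OF T])
    moreover have "bounded (T -` ball 0 1)"
    proof -
      obtain B where "B > 0" "\<And>x. B * norm x \<le> norm (T x)"
        using linear_inj_bounded_below_pos[OF T(1)] T(2) bij_is_inj by blast
      then have "norm x \<le> 1 / B" if "x \<in> T -` ball 0 1" for x
        using that by (simp add: pos_le_divide_eq mult.commute) (meson less_imp_le order_trans)
      then show ?thesis by (rule boundedI)
    qed
    ultimately show ?thesis using emeasure_bounded_finite[of "T -` ball 0 1"] by (simp add: less_top)
  qed
  \<comment> \<open>Apply \<open>key\<close> to the whole space: a null ball would give the image
    measure total mass zero.\<close>
  moreover have "emeasure ?\<mu> (ball 0 1) \<noteq> 0"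
    using key[of UNIV] bb by (auto simp: emeasure_distr)
  ultimately obtain m where m: "emeasure ?\<mu> (ball 0 1) = ennreal m" "m > 0"
    by (metis ennreal_cases ennreal_0 infinity_ennreal_def less_eq_real_def)
  obtain b where b: "?b = ennreal b" "b > 0"
    using bb by (metis ennreal_cases ennreal_0 infinity_ennreal_def less_eq_real_def)
  have em: "emeasure ?\<mu> B = ennreal (m / b) * emeasure lborel B" if "B \<in> sets borel" for B
  proof -
    have "ennreal b * emeasure ?\<mu> B = ennreal b * (ennreal (m / b) * emeasure lborel B)"
      using key[OF that] b m by (simp add: mult.assoc[symmetric] ennreal_mult[symmetric] mult.commute)
    then show ?thesis
      using b by (simp add: ennreal_mult_cancel_left)
  qed
  have dens: "?\<mu> = density lborel (\<lambda>_. ennreal (m / b))"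
    by (rule measure_eqI) (simp_all add: em emeasure_density_const)
  show thesis
  proof (rule that[of "m / b"])
    show "m / b > 0" using m b by simp
    fix h :: "'a \<Rightarrow> ennreal" assume [measurable]: "h \<in> borel_measurable borel"
    have "(\<integral>\<^sup>+x. h (T x) \<partial>lborel) = (\<integral>\<^sup>+x. h x \<partial>?\<mu>)" by (subst nn_integral_distr) auto
    also have "\<dots> = ennreal (m / b) * (\<integral>\<^sup>+x. h x \<partial>lborel)"
      unfolding dens by (subst nn_integral_density) (auto simp: nn_integral_cmult)
    finally show "(\<integral>\<^sup>+x. h (T x) \<partial>lborel) = ennreal (m / b) * (\<integral>\<^sup>+x. h x \<partial>lborel)" .
  qed
qed

text \<open>Integrate the hypothesis over \<open>A\<close> and exchange the order: for each
  \<open>t\<close> there remains the integral of \<open>u\<close> composed with \<open>rot t\<close>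
  over the invariant set \<open>A\<close>, which a linear isometry does not change. This lifts
  inequalities on single circles to volume integrals, in the plane and in several variables.\<close>

lemma nn_integral_rotation_average:
  fixes rot :: "real \<Rightarrow> 'a::euclidean_space \<Rightarrow> 'a" and u v :: "'a \<Rightarrow> ennreal"
  assumes rot: "\<And>t. linear (rot t)" "\<And>t. bij (rot t)" "\<And>t x. norm (rot t x) = norm x"
    and meas [measurable]: "case_prod rot \<in> borel_measurable borel"
    and A [measurable]: "A \<in> sets borel" and inv: "\<And>t x. rot t x \<in> A \<longleftrightarrow> x \<in> A"
    and u [measurable]: "u \<in> borel_measurable borel"
    and le: "\<And>x. x \<in> A \<Longrightarrow> v x \<le> (\<integral>\<^sup>+t. u (rot t x) * indicator {0..1} t \<partial>lborel)"
  shows "(\<integral>\<^sup>+x. v x * indicator A x \<partial>lborel) \<le> (\<integral>\<^sup>+x. u x * indicator A x \<partial>lborel)"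
proof -
  have [measurable]: "(\<lambda>x. rot (f x) (g x)) \<in> borel_measurable M"
    if [measurable]: "f \<in> borel_measurable M" "g \<in> borel_measurable M" for f g and M :: "'c measure"
    using measurable_compose[OF _ meas, of "\<lambda>x. (f x, g x)" M] by simp
  have "(\<integral>\<^sup>+x. v x * indicator A x \<partial>lborel)
      \<le> (\<integral>\<^sup>+x. (\<integral>\<^sup>+t. u (rot t x) * indicator A x * indicator {0..1} t \<partial>lborel) \<partial>lborel)"
    using le by (intro nn_integral_mono) (auto split: split_indicator)
  also have "\<dots> = (\<integral>\<^sup>+t. (\<integral>\<^sup>+x. u (rot t x) * indicator A x * indicator {0..1} t \<partial>lborel) \<partial>lborel)"
    by (rule lborel_pair.Fubini') measurable
  also have "\<dots> = (\<integral>\<^sup>+t. (\<integral>\<^sup>+x. u x * indicator A x \<partial>lborel) * indicator {0..1::real} t \<partial>lborel)"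
  proof (intro nn_integral_cong)
    fix t :: real
    have "(\<integral>\<^sup>+x. u x * indicator A x \<partial>lborel) = (\<integral>\<^sup>+x. u x * indicator A x \<partial>distr lborel borel (rot t))"
      by (simp add: distr_linear_isometry rot)
    also have "\<dots> = (\<integral>\<^sup>+x. u (rot t x) * indicator A (rot t x) \<partial>lborel)"
      by (subst nn_integral_distr) auto
    also have "\<dots> = (\<integral>\<^sup>+x. u (rot t x) * indicator A x \<partial>lborel)"
      by (intro nn_integral_cong) (auto simp: inv split: split_indicator)
    finally show "(\<integral>\<^sup>+x. u (rot t x) * indicator A x * indicator {0..1} t \<partial>lborel)
        = (\<integral>\<^sup>+x. u x * indicator A x \<partial>lborel) * indicator {0..1} t"
      by (subst nn_integral_multc) auto
  qed
  also have "\<dots> = (\<integral>\<^sup>+x. u x * indicator A x \<partial>lborel)"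
    by (subst nn_integral_cmult) auto
  finally show ?thesis .
qed

abbreviation circ :: "real \<Rightarrow> complex" where
  "circ t \<equiv> exp (2 * of_real pi * \<i> * of_real t)"

text \<open>Expand the nonnegative \<open>|f (circ t) - f 0|^2\<close> and integrate over
  \<open>t\<close>; Cauchy's formula evaluates the mixed term as \<open>2 * |f 0|^2\<close>.\<close>

lemma circle_mean_sq:
  assumes holf: "f holomorphic_on S" and S: "open S" "cball 0 1 \<subseteq> S"
  shows "ennreal ((cmod (f 0))\<^sup>2) \<le> (\<integral>\<^sup>+t. ennreal ((cmod (f (circ t)))\<^sup>2) * indicator {0..1} t \<partial>lborel)"
proof -
  let ?e = "\<lambda>t::real. circ t"
  have "((\<lambda>u. f u / (u - 0)) has_contour_integral (2 * of_real pi * \<i> * f 0)) (circlepath 0 1)"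
    using holf S by (intro Cauchy_integral_circlepath_simple) (auto intro: holomorphic_on_subset)
  then have "((\<lambda>t. f (?e t) / ?e t * (2 * of_real pi * \<i> * ?e t)) has_integral (2 * of_real pi * \<i> * f 0)) {0..1}"
    unfolding has_contour_integral_def
    by (rule has_integral_eq[rotated])
       (simp only: atLeastAtMost_iff vector_derivative_circlepath01, simp add: circlepath)
  then have "((\<lambda>t. (2 * of_real pi * \<i>) * f (?e t)) has_integral (2 * of_real pi * \<i> * f 0)) {0..1}"
    by (rule has_integral_eq[rotated]) auto
  from has_integral_mult_right[OF this, of "inverse (2 * of_real pi * \<i>)"]
  have I: "((\<lambda>t. f (?e t)) has_integral f 0) {0..1}" by (simp add: field_simps)
  have "((\<lambda>t. Re (cnj (f 0) * f (?e t))) has_integral Re (cnj (f 0) * f 0)) {0..1}"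
    by (intro has_integral_linear[OF has_integral_mult_right[OF I] bounded_linear_Re, unfolded o_def])
  then have I2: "((\<lambda>t. 2 * Re (cnj (f 0) * f (?e t)) - (cmod (f 0))\<^sup>2) has_integral 2 * Re (cnj (f 0) * f 0) - (cmod (f 0))\<^sup>2) {0..1}"
    by (intro has_integral_diff has_integral_mult_right) (use has_integral_const_real[of "(cmod (f 0))\<^sup>2" 0 1] in auto)
  have "continuous_on {0..1} (\<lambda>t. (cmod (f (?e t)))\<^sup>2)"
    by (intro continuous_intros continuous_on_compose2[OF holomorphic_on_imp_continuous_on[OF holf]])
       (use S(2) in \<open>auto intro!: subsetD[OF S(2)]\<close>)
  then obtain J where J: "((\<lambda>t. (cmod (f (?e t)))\<^sup>2) has_integral J) {0..1}"
    using integrable_continuous_interval by blast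
  have "2 * Re (cnj (f 0) * f 0) - (cmod (f 0))\<^sup>2 \<le> J"
  proof (rule has_integral_le[OF I2 J])
    fix t :: real
    have "0 \<le> (cmod (f (?e t) - f 0))\<^sup>2" by simp
    also have "\<dots> = (cmod (f (?e t)))\<^sup>2 + (cmod (f 0))\<^sup>2 - 2 * Re (cnj (f 0) * f (?e t))"
      by (simp only: cmod_power2) (simp add: algebra_simps power2_eq_square)
    finally show "2 * Re (cnj (f 0) * f (?e t)) - (cmod (f 0))\<^sup>2 \<le> (cmod (f (?e t)))\<^sup>2" by simp
  qed
  moreover have "Re (cnj (f 0) * f 0) = (cmod (f 0))\<^sup>2"
    by (simp only: cmod_power2) (simp add: power2_eq_square)
  moreover have "(\<integral>\<^sup>+t. ennreal ((cmod (f (?e t)))\<^sup>2) * indicator {0..1} t \<partial>lborel) = ennreal J"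
    using J by (intro nn_integral_has_integral_lebesgue') auto
  ultimately show ?thesis by (simp add: ennreal_leI)
qed

subsection \<open>Change of variables for injective holomorphic functions\<close>

text \<open>The transformation formula is phrased with \<open>det (matrix _)\<close>, hence on
  \<open>real ^ 2\<close>; \<open>cplx2\<close> and \<open>vec2\<close> carry planar measure back
  and forth.\<close>

definition cplx2 :: "real ^ 2 \<Rightarrow> complex" where "cplx2 v = Complex (v $ 1) (v $ 2)"
definition vec2 :: "complex \<Rightarrow> real ^ 2" where "vec2 z = vector [Re z, Im z]"

lemma cplx2_vec2 [simp]: "cplx2 (vec2 z) = z"
  by (simp add: cplx2_def vec2_def complex_eq_iff)

lemma vec2_cplx2 [simp]: "vec2 (cplx2 v) = v"
  by (simp add: cplx2_def vec2_def vec_eq_iff forall_2)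

lemma bounded_linear_cplx2: "bounded_linear cplx2"
  unfolding linear_conv_bounded_linear [symmetric]
  by (rule linearI) (simp_all add: cplx2_def complex_eq_iff)

lemma bounded_linear_vec2: "bounded_linear vec2"
  unfolding linear_conv_bounded_linear [symmetric]
  by (rule linearI) (simp_all add: vec2_def vec_eq_iff forall_2)

lemma measurable_cplx2 [measurable]: "cplx2 \<in> borel_measurable borel"
  by (intro borel_measurable_continuous_onI linear_continuous_on bounded_linear_cplx2)

lemma distr_cplx2: "distr lborel borel cplx2 = lborel"
proof (rule sym, rule lborel_eqI)
  fix l u :: complex
  assume "\<And>b. b \<in> Basis \<Longrightarrow> l \<bullet> b \<le> u \<bullet> b"
  from this[of 1] this[of \<i>] have le: "Re l \<le> Re u" "Im l \<le> Im u"
    by (auto simp: Basis_complex_def)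
  have Basis2: "(Basis :: (real ^ 2) set) = {axis 1 1, axis 2 1}"
    by (auto simp: Basis_vec_def UNIV_2)
  have eq: "cplx2 -` box l u = box (vec2 l) (vec2 u)"
    by (auto simp: box_def cplx2_def vec2_def Basis_complex_def Basis_vec_def inner_axis
        forall_2 axis_eq_axis)
  have "emeasure (distr lborel borel cplx2) (box l u) = emeasure lborel (box (vec2 l) (vec2 u))"
    by (subst emeasure_distr) (auto simp: eq)
  also have "\<dots> = (\<Prod>b\<in>Basis. (vec2 u - vec2 l) \<bullet> b)"
    using le by (intro emeasure_lborel_box) (auto simp: Basis2 inner_axis vec2_def)
  also have "(\<Prod>b\<in>Basis. (vec2 u - vec2 l) \<bullet> b) = (Re u - Re l) * (Im u - Im l)"
    by (simp add: Basis2 inner_axis vec2_def axis_eq_axis)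
  also have "\<dots> = (\<Prod>b\<in>Basis. (u - l) \<bullet> b)"
    by (simp add: Basis_complex_def)
  finally show "emeasure (distr lborel borel cplx2) (box l u) = (\<Prod>b\<in>Basis. (u - l) \<bullet> b)" .
qed simp

lemma nn_integral_cplx2:
  assumes "h \<in> borel_measurable borel"
  shows "(\<integral>\<^sup>+z. h z \<partial>lborel) = (\<integral>\<^sup>+v. h (cplx2 v) \<partial>lborel)"
proof -
  have "(\<integral>\<^sup>+z. h z \<partial>lborel) = (\<integral>\<^sup>+z. h z \<partial>distr lborel borel cplx2)"
    by (simp add: distr_cplx2)
  also have "\<dots> = (\<integral>\<^sup>+v. h (cplx2 v) \<partial>lborel)"
    using assms by (intro nn_integral_distr) auto
  finally show ?thesis .
qed

text \<open>The image is the preimage of \<open>T\<close> under the holomorphic inverse, extended by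
  0 off the open image of \<open>S\<close>.\<close>

lemma borel_image_injective_holomorphic:
  assumes "f holomorphic_on S" "open S" "inj_on f S" "T \<in> sets borel" "T \<subseteq> S"
  shows "f ` T \<in> sets borel"
proof -
  obtain g where g: "g holomorphic_on f ` S" "\<And>z. z \<in> S \<Longrightarrow> deriv f z * deriv g (f z) = 1 \<and> g (f z) = z"
    using holomorphic_has_inverse[OF assms(1-3)] by metis
  have op: "open (f ` S)"
    using open_mapping_thm3 assms by blast
  have "(\<lambda>w. if w \<in> f ` S then g w else 0) \<in> borel_measurable borel"
    using borel_measurable_continuous_on_indicator[of "f ` S" g] op
      holomorphic_on_imp_continuous_on[OF g(1)]
    by (simp add: indicator_scaleR_eq_if)
  from measurable_sets[OF this assms(4)] op
  have "f ` S \<inter> (\<lambda>w. if w \<in> f ` S then g w else 0) -` T \<in> sets borel"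
    by (intro sets.Int) auto
  also have "f ` S \<inter> (\<lambda>w. if w \<in> f ` S then g w else 0) -` T = f ` T"
    using g(2) assms(5) by force
  finally show ?thesis .
qed

lemma borel_measurable_deriv_sq_indicator:
  assumes holf: "f holomorphic_on S" and S: "open S" and T: "T \<in> sets borel" "T \<subseteq> S"
  shows "(\<lambda>z. ennreal ((cmod (deriv f z))\<^sup>2) * indicator T z) \<in> borel_measurable borel"
proof -
  have "continuous_on T (deriv f)"
    using holf S T(2) by (meson continuous_on_subset holomorphic_deriv holomorphic_on_imp_continuous_on)
  then have "(\<lambda>z. indicator T z *\<^sub>R (cmod (deriv f z))\<^sup>2) \<in> borel_measurable borel"
    by (intro borel_measurable_continuous_on_indicator T continuous_intros)
  then have "(\<lambda>z. ennreal (indicator T z *\<^sub>R (cmod (deriv f z))\<^sup>2)) \<in> borel_measurable borel"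
    by measurable
  also have "(\<lambda>z. ennreal (indicator T z *\<^sub>R (cmod (deriv f z))\<^sup>2))
      = (\<lambda>z. ennreal ((cmod (deriv f z))\<^sup>2) * indicator T z)"
    by (auto simp: fun_eq_iff split: split_indicator)
  finally show ?thesis .
qed

text \<open>By the Cauchy-Riemann equations the real Jacobian determinant is the squared modulus of
  the derivative. Boundedness makes the measure of the image finite, as the real-valued
  transformation formula requires.\<close>

lemma emeasure_injective_holomorphic_image:
  assumes holf: "f holomorphic_on S" and S: "open S" and inj: "inj_on f S"
    and T: "T \<in> sets borel" "T \<subseteq> S" and bd: "bounded (f ` T)"
  shows "emeasure lborel (f ` T) = (\<integral>\<^sup>+z. ennreal ((cmod (deriv f z))\<^sup>2) * indicator T z \<partial>lborel)"
proof -
  let ?g = "\<lambda>v. vec2 (f (cplx2 v))"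
  let ?g' = "\<lambda>v h. vec2 (deriv f (cplx2 v) * cplx2 h)"
  let ?T = "cplx2 -` T"
  have fT: "f ` T \<in> sets borel"
    by (rule borel_image_injective_holomorphic[OF holf S inj T])
  have img: "?g ` ?T = cplx2 -` (f ` T)"
  proof (intro equalityI subsetI)
    fix v assume "v \<in> cplx2 -` (f ` T)"
    then obtain t where t: "t \<in> T" "cplx2 v = f t" by auto
    then have "v = ?g (vec2 t)" by (metis cplx2_vec2 vec2_cplx2)
    then show "v \<in> ?g ` ?T" using t(1) by (intro image_eqI[of _ _ "vec2 t"]) auto
  qed auto
  have Tm: "?T \<in> sets lebesgue" "cplx2 -` (f ` T) \<in> sets borel"
    using measurable_sets[OF measurable_cplx2 T(1)] measurable_sets[OF measurable_cplx2 fT]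
    by (auto simp: sets_completionI_sets)
  have "cplx2 -` (f ` T) = vec2 ` (f ` T)"
    by (auto simp: image_iff) (metis vec2_cplx2)
  then have "bounded (cplx2 -` (f ` T))"
    using bounded_linear_image[OF bd bounded_linear_vec2] by simp
  then have lm: "?g ` ?T \<in> lmeasurable"
    unfolding img using Tm(2)
    by (intro bounded_set_imp_lmeasurable) (auto simp: sets_completionI_sets)
  have der: "(?g has_derivative ?g' v) (at v within ?T)" if "v \<in> ?T" for v
  proof -
    have "(f has_field_derivative deriv f (cplx2 v)) (at (cplx2 v))"
      using T(2) that by (intro holomorphic_derivI[OF holf S]) auto
    then have 1: "(f has_derivative (*) (deriv f (cplx2 v))) (at (cplx2 v))"
      by (simp add: has_field_derivative_def)
    have "((\<lambda>v. f (cplx2 v)) has_derivative (\<lambda>h. deriv f (cplx2 v) * cplx2 h)) (at v)"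
      by (rule has_derivative_compose[OF bounded_linear_imp_has_derivative[OF bounded_linear_cplx2] 1])
    then have "(?g has_derivative ?g' v) (at v)"
      by (rule bounded_linear.has_derivative[OF bounded_linear_vec2])
    then show ?thesis by (rule has_derivative_at_withinI)
  qed
  have injg: "inj_on ?g ?T"
    using inj T(2) by (auto simp: inj_on_def) (metis cplx2_vec2 subsetD vec2_cplx2)
  have det: "\<bar>det (matrix (?g' v))\<bar> = (cmod (deriv f (cplx2 v)))\<^sup>2" for v
    by (simp add: det_2 matrix_def axis_def vec2_def cplx2_def cmod_power2)
       (simp add: power2_eq_square)
  have "((\<lambda>v. \<bar>det (matrix (?g' v))\<bar>) has_integral measure lebesgue (?g ` ?T)) ?T"
    using has_measure_differentiable_image[OF Tm(1) der injg] lm by blast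
  then have "((\<lambda>v. (cmod (deriv f (cplx2 v)))\<^sup>2) has_integral measure lebesgue (?g ` ?T)) ?T"
    unfolding det .
  then have "(\<integral>\<^sup>+v. ennreal ((cmod (deriv f (cplx2 v)))\<^sup>2) * indicator ?T v \<partial>lborel)
      = ennreal (measure lebesgue (?g ` ?T))"
    by (intro nn_integral_has_integral_lebesgue') auto
  also have "\<dots> = emeasure lebesgue (cplx2 -` (f ` T))"
    using emeasure_eq_measure2[OF lm] unfolding img by (rule sym)
  also have "\<dots> = emeasure lborel (cplx2 -` (f ` T))"
    using Tm(2) by simp
  also have "\<dots> = emeasure (distr lborel borel cplx2) (f ` T)"
    using fT by (subst emeasure_distr) auto
  also have "\<dots> = emeasure lborel (f ` T)" by (simp add: distr_cplx2)
  finally have 2: "(\<integral>\<^sup>+v. ennreal ((cmod (deriv f (cplx2 v)))\<^sup>2) * indicator ?T v \<partial>lborel) = emeasure lborel (f ` T)" .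
  have ind: "indicator ?T v = indicator T (cplx2 v)" for v :: "real ^ 2"
    by (simp add: indicator_def)
  show ?thesis
    using 2 nn_integral_cplx2[OF borel_measurable_deriv_sq_indicator[OF holf S T]] by (simp add: ind)
qed

text \<open>The area formula says that pushing the density \<open>|f'|^2\<close> on \<open>T\<close>
  forward by \<open>f\<close> gives Lebesgue measure restricted to the image; the claim integrates
  \<open>h\<close> against both. \<open>?f\<close> extends \<open>f\<close> by 0 so as to be Borel
  on the whole plane.\<close>

lemma nn_integral_injective_holomorphic:
  assumes holf: "f holomorphic_on S" and S: "open S" and inj: "inj_on f S"
    and bd: "bounded (f ` S)" and h: "h \<in> borel_measurable borel" and T: "T \<in> sets borel" "T \<subseteq> S"
  shows "(\<integral>\<^sup>+z. h (f z) * ennreal ((cmod (deriv f z))\<^sup>2) * indicator T z \<partial>lborel)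
       = (\<integral>\<^sup>+w. h w * indicator (f ` T) w \<partial>lborel)"
proof -
  have fm [measurable]: "(\<lambda>z. if z \<in> T then f z else 0) \<in> borel_measurable borel"
    using borel_measurable_continuous_on_indicator[OF T(1),
        OF continuous_on_subset[OF holomorphic_on_imp_continuous_on[OF holf] T(2)]]
    by (simp add: indicator_scaleR_eq_if)
  let ?f = "\<lambda>z. if z \<in> T then f z else 0"
  note m' = borel_measurable_deriv_sq_indicator[OF holf S T]
  let ?M = "density lborel (\<lambda>z. ennreal ((cmod (deriv f z))\<^sup>2) * indicator T z)"
  have fT: "f ` T \<in> sets borel"
    by (rule borel_image_injective_holomorphic[OF holf S inj T])
  have eq: "distr ?M borel ?f = density lborel (indicator (f ` T))"
  proof (rule measure_eqI)
    fix B assume "B \<in> sets (distr ?M borel ?f)"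
    then have B: "B \<in> sets borel" by simp
    have B2: "?f -` B \<in> sets borel"
      using measurable_sets[OF fm B] by simp
    have TB: "T \<inter> ?f -` B \<in> sets borel" using T(1) B2 by (rule sets.Int)
    have "emeasure (distr ?M borel ?f) B = emeasure ?M (?f -` B)"
      using B by (subst emeasure_distr) auto
    also have "\<dots> = (\<integral>\<^sup>+z. ennreal ((cmod (deriv f z))\<^sup>2) * indicator T z * indicator (?f -` B) z \<partial>lborel)"
      using m' B2 by (intro emeasure_density) auto
    also have "\<dots> = (\<integral>\<^sup>+z. ennreal ((cmod (deriv f z))\<^sup>2) * indicator (T \<inter> ?f -` B) z \<partial>lborel)"
      by (intro nn_integral_cong) (auto split: split_indicator)
    also have "\<dots> = emeasure lborel (f ` (T \<inter> ?f -` B))"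
      using T(2) by (intro emeasure_injective_holomorphic_image[symmetric, OF holf S inj TB])
        (blast intro: bounded_subset[OF bd])+
    also have "f ` (T \<inter> ?f -` B) = f ` T \<inter> B" by auto
    also have "emeasure lborel (f ` T \<inter> B) = (\<integral>\<^sup>+z. indicator (f ` T \<inter> B) z \<partial>lborel)"
      using B fT by simp
    also have "\<dots> = (\<integral>\<^sup>+z. indicator (f ` T) z * indicator B z \<partial>lborel)"
      by (intro nn_integral_cong) (auto split: split_indicator)
    also have "\<dots> = emeasure (density lborel (indicator (f ` T))) B"
      using B fT by (subst emeasure_density) auto
    finally show "emeasure (distr ?M borel ?f) B = emeasure (density lborel (indicator (f ` T))) B" .
  qed simp
  have "(\<integral>\<^sup>+z. h (f z) * ennreal ((cmod (deriv f z))\<^sup>2) * indicator T z \<partial>lborel)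
      = (\<integral>\<^sup>+z. (ennreal ((cmod (deriv f z))\<^sup>2) * indicator T z) * h (?f z) \<partial>lborel)"
    by (intro nn_integral_cong) (auto split: split_indicator simp: mult.commute)
  also have "\<dots> = (\<integral>\<^sup>+z. h (?f z) \<partial>?M)"
    using m' measurable_compose[OF fm h] by (intro nn_integral_density[symmetric]) simp_all
  also have "\<dots> = (\<integral>\<^sup>+w. h w \<partial>distr ?M borel ?f)"
    using h fm by (intro nn_integral_distr[symmetric]) simp_all
  also have "\<dots> = (\<integral>\<^sup>+w. h w * indicator (f ` T) w \<partial>lborel)"
    unfolding eq using h fT by (subst nn_integral_density) (simp_all add: mult.commute)
  finally show ?thesis .
qed

subsection \<open>Koebe's quarter theorem\<close>

text \<open>
  Logarithmic area (density \<open>1 / |w|^2\<close>) is invariant under inversion. If the derivative at \<open>0\<close> had modulus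
  greater than one, then \<open>F\<close> would map an annulus \<open>\<epsilon> \<le> |z| < 1\<close> into \<open>m \<le> |w| \<le> 1 / m\<close> with \<open>m > \<epsilon>\<close>, the image being
  disjoint from its inversion, so its logarithmic area would be at most that of \<open>m \<le> |w| \<le> 1\<close>. But the mean value property
  of \<open>z F' / F\<close> shows that it is at least the logarithmic area of the annulus.
\<close>

lemma injective_holomorphic_disc_no_reciprocal_values:
  assumes holF: "F holomorphic_on ball 0 1" and inj: "inj_on F (ball 0 1)" and F0: "F 0 = 0"
    and ne1: "\<And>z w. z \<in> ball 0 1 \<Longrightarrow> w \<in> ball 0 1 \<Longrightarrow> F z * F w \<noteq> 1"
  shows "cmod (deriv F 0) \<le> 1"
proof (rule ccontr)
  define a where "a = cmod (deriv F 0)"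
  assume "\<not> cmod (deriv F 0) \<le> 1"
  then have a1: "a > 1" by (simp add: a_def)
  \<comment> \<open>Any value strictly between 1 and \<open>a\<close> would do: the inverse
    \<open>G\<close> contracts by \<open>1 / a\<close> to first order at 0, hence satisfies
    \<open>|G w| \<le> |w| / b\<close> near 0, which leaves a gap between
    \<open>\<epsilon> = m / b\<close> and \<open>m\<close>.\<close>
  define b where "b = (1 + a) / 2"
  have b: "1 < b" "b < a" using a1 by (auto simp: b_def)
  obtain G where holG: "G holomorphic_on F ` ball 0 1"
    and G': "\<And>z. z \<in> ball 0 1 \<Longrightarrow> deriv F z * deriv G (F z) = 1"
    and GF: "\<And>z. z \<in> ball 0 1 \<Longrightarrow> G (F z) = z"
    using holomorphic_has_inverse[OF holF open_ball inj] by blast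
  have opF: "open (F ` ball 0 1)" by (rule open_mapping_thm3[OF holF open_ball inj])
  have F0in: "0 \<in> F ` ball 0 1" using F0 by (intro image_eqI[of _ _ 0]) auto
  have G0: "G 0 = 0" using GF[of 0] F0 by simp
  have dG: "cmod (deriv G 0) = 1 / a"
  proof -
    have "deriv F 0 * deriv G 0 = 1" using G'[of 0] F0 by simp
    then have "cmod (deriv F 0) * cmod (deriv G 0) = 1" by (metis norm_mult norm_one)
    moreover have "cmod (deriv F 0) \<noteq> 0" using a1 unfolding a_def by linarith
    ultimately show ?thesis unfolding a_def by (metis eq_divide_imp mult.commute)
  qed
  have "(G has_field_derivative deriv G 0) (at 0)"
    by (rule holomorphic_derivI[OF holG opF F0in])
  then have "(G has_derivative (*) (deriv G 0)) (at 0)" by (simp add: has_field_derivative_def)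
  moreover have "1 / b - 1 / a > 0" using b by (simp add: divide_strict_left_mono)
  ultimately obtain d1 where d1: "d1 > 0" "\<forall>w. cmod (w - 0) < d1 \<longrightarrow>
      cmod (G w - G 0 - deriv G 0 * (w - 0)) \<le> (1 / b - 1 / a) * cmod (w - 0)"
    unfolding has_derivative_at_alt by blast
  obtain d2 where d2: "d2 > 0" "ball 0 d2 \<subseteq> F ` ball 0 1"
    by (rule openE[OF opF F0in])
  define m where "m = min (min d1 d2) 1 / 2"
  define \<epsilon> where "\<epsilon> = m / b"
  have m: "0 < m" "m < d1" "m < d2" "m < 1" using d1(1) d2(1) by (auto simp: m_def)
  have eps: "0 < \<epsilon>" "\<epsilon> < m" using m b by (simp_all add: \<epsilon>_def divide_less_eq)
  have small: "cmod z < \<epsilon>" if "z \<in> ball 0 1" "cmod (F z) < m" for z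
  proof -
    have "cmod (F z) < d1" using that m by simp
    then have "cmod (G (F z) - deriv G 0 * F z) \<le> (1 / b - 1 / a) * cmod (F z)"
      using d1(2) G0 by simp
    moreover have "cmod z \<le> cmod (z - deriv G 0 * F z) + cmod (deriv G 0 * F z)"
      by (metis diff_add_cancel norm_triangle_ineq)
    ultimately have "cmod z \<le> (1 / b) * cmod (F z)"
      using that(1) by (simp add: GF norm_mult dG left_diff_distrib)
    also have "\<dots> < \<epsilon>" using that b by (simp add: \<epsilon>_def divide_strict_right_mono)
    finally show ?thesis .
  qed
  \<comment> \<open>A value of modulus above \<open>1 / m\<close> would have its reciprocal in
    \<open>ball 0 d2\<close>, which consists of values of \<open>F\<close>, against
    \<open>ne1\<close>.\<close>
  have large: "cmod (F z) \<le> 1 / m" if z: "z \<in> ball 0 1" for z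
  proof (rule ccontr)
    assume "\<not> ?thesis"
    then have gt: "1 / m < cmod (F z)" by simp
    then have Fz: "F z \<noteq> 0" using m by auto
    have "inverse (cmod (F z)) < inverse (1 / m)"
      using m(1) by (intro less_imp_inverse_less[OF gt]) simp
    then have "cmod (inverse (F z)) < d2"
      using m by (simp add: norm_inverse)
    then have "inverse (F z) \<in> F ` ball 0 1" using d2(2) by auto
    then obtain w where w: "inverse (F z) = F w" "w \<in> ball 0 1" by (rule imageE)
    then show False using ne1[OF z w(2)] Fz by (simp flip: w(1))
  qed
  have Fnz: "F z \<noteq> 0" if "z \<in> ball 0 1" "z \<noteq> 0" for z
    using inj F0 that by (metis centre_in_ball inj_onD zero_less_one)
  define q where "q = (\<lambda>z. if z = 0 then deriv F 0 else (F z - F 0) / (z - 0))"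
  have holq: "q holomorphic_on ball 0 1"
    unfolding q_def by (rule pole_lemma[OF holF]) simp
  have qnz: "q z \<noteq> 0" if "z \<in> ball 0 1" for z
    using Fnz[OF that] a1 F0 by (auto simp: q_def a_def)
  \<comment> \<open>This is \<open>z F' / F\<close> with the singularity at 0 removed; its value 1
    there is what the circle means are compared with.\<close>
  define k where "k = (\<lambda>z. deriv F z / q z)"
  have holk: "k holomorphic_on ball 0 1"
    unfolding k_def using holF holq qnz by (intro holomorphic_intros) auto
  have k0: "k 0 = 1" using qnz[of 0] by (simp add: k_def q_def)
  define h :: "complex \<Rightarrow> ennreal" where "h = (\<lambda>w. ennreal (1 / (cmod w)\<^sup>2))"
  have hm [measurable]: "h \<in> borel_measurable borel" unfolding h_def by measurable
  define A where "A = {z. \<epsilon> \<le> cmod z \<and> cmod z < 1}"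
  define S where "S = ball (0::complex) 1 - {0}"
  have Am [measurable]: "A \<in> sets borel" unfolding A_def by measurable
  have A: "A \<subseteq> S" using eps by (auto simp: A_def S_def)
  have S: "open S" "F holomorphic_on S" "inj_on F S" "bounded (F ` S)"
    using holF inj large by (auto simp: S_def intro: holomorphic_on_subset inj_on_subset
        intro!: boundedI[of _ "1 / m"])
  have 1: "(\<integral>\<^sup>+z. h (F z) * ennreal ((cmod (deriv F z))\<^sup>2) * indicator A z \<partial>lborel)
       = (\<integral>\<^sup>+w. h w * indicator (F ` A) w \<partial>lborel)"
    by (rule nn_integral_injective_holomorphic[OF S(2,1,3,4) hm Am A])
  let ?u = "\<lambda>z. ennreal ((cmod (k z))\<^sup>2 / (cmod z)\<^sup>2 * indicator A z)"
  have kA: "continuous_on A k" using holk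
    by (intro holomorphic_on_imp_continuous_on[THEN continuous_on_subset]) (auto simp: A_def)
  have "continuous_on A (\<lambda>z. (cmod (k z))\<^sup>2 / (cmod z)\<^sup>2)"
    using eps by (intro continuous_intros kA) (auto simp: A_def)
  from borel_measurable_continuous_on_indicator[OF Am this]
  have um: "?u \<in> borel_measurable borel" by (simp add: mult.commute)
  have 2: "(\<integral>\<^sup>+z. h z * indicator A z \<partial>lborel) \<le> (\<integral>\<^sup>+z. ?u z * indicator A z \<partial>lborel)"
  proof (rule nn_integral_rotation_average[where rot = "\<lambda>t z. circ t * z"])
    fix t :: real
    let ?e = "circ t"
    show "linear ((*) ?e)"
      by (rule linearI) (auto simp: algebra_simps)
    show "bij ((*) ?e)"
      by (rule bijI', auto intro!: exI[of _ "x / ?e" for x])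
    show n: "norm (?e * z) = norm z" for z by (simp add: norm_mult)
    show "?e * z \<in> A \<longleftrightarrow> z \<in> A" for z using n[of z] by (simp add: A_def)
  next
    show "(\<lambda>(t, z). circ t * z) \<in> borel_measurable (borel :: (real \<times> complex) measure)"
      unfolding case_prod_beta by (intro borel_measurable_continuous_onI continuous_intros)
  next
    fix z assume z: "z \<in> A"
    \<comment> \<open>Rescaled so that the unit circle in \<open>x\<close> becomes the circle
      through \<open>z\<close>; the division by \<open>z\<close> accounts for the density
      \<open>1 / |z|^2\<close>.\<close>
    define f where "f = (\<lambda>x. k (x * z) / z)"
    have znz: "z \<noteq> 0" "cmod z < 1" using z eps by (auto simp: A_def)
    have "ennreal ((cmod (f 0))\<^sup>2) \<le> (\<integral>\<^sup>+t. ennreal ((cmod (f (circ t)))\<^sup>2) * indicator {0..1} t \<partial>lborel)"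
    proof (rule circle_mean_sq)
      show "open (ball (0::complex) (1 / cmod z))" by simp
      show "cball 0 1 \<subseteq> ball (0::complex) (1 / cmod z)"
      proof -
        have "1 < 1 / cmod z" using znz by simp
        then show ?thesis by auto
      qed
      show "f holomorphic_on ball 0 (1 / cmod z)"
        unfolding f_def using znz(1)
        by (intro holomorphic_intros holomorphic_on_compose_gen[OF _ holk, unfolded o_def])
           (auto simp: norm_mult field_simps)
    qed
    also have "ennreal ((cmod (f 0))\<^sup>2) = h z"
      by (simp add: f_def k0 h_def norm_divide power_divide)
    also have "(\<integral>\<^sup>+t. ennreal ((cmod (f (circ t)))\<^sup>2) * indicator {0..1} t \<partial>lborel)
        = (\<integral>\<^sup>+t. ?u (circ t * z) * indicator {0..1} t \<partial>lborel)"
      using z by (intro nn_integral_cong) (simp add: f_def A_def norm_mult norm_divide power_divide)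
    finally show "h z \<le> (\<integral>\<^sup>+t. ?u (circ t * z) * indicator {0..1} t \<partial>lborel)" .
  qed (use Am um in auto)
  have 3: "(\<integral>\<^sup>+z. ?u z * indicator A z \<partial>lborel) = (\<integral>\<^sup>+z. h (F z) * ennreal ((cmod (deriv F z))\<^sup>2) * indicator A z \<partial>lborel)"
  proof (intro nn_integral_cong)
    fix z
    show "?u z * indicator A z = h (F z) * ennreal ((cmod (deriv F z))\<^sup>2) * indicator A z"
    proof (cases "z \<in> A")
      case True
      then have "z \<in> ball 0 1" "z \<noteq> 0" using A by (auto simp: S_def)
      then have "z \<noteq> 0" "F z \<noteq> 0" using Fnz by auto
      then show ?thesis
        using True F0 by (simp add: h_def k_def q_def norm_divide norm_mult power_mult_distrib power_divide flip: ennreal_mult)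
    qed simp
  qed
  let ?P = "F ` A"
  have P: "m \<le> cmod w" "cmod w \<le> 1 / m" if "w \<in> ?P" for w
  proof -
    obtain z where z: "z \<in> A" "w = F z" using \<open>w \<in> ?P\<close> by auto
    then have "z \<in> ball 0 1" "\<not> cmod z < \<epsilon>" by (auto simp: A_def)
    then show "m \<le> cmod w" "cmod w \<le> 1 / m" using small[of z] large[of z] z(2) by force+
  qed
  have Pm [measurable]: "?P \<in> sets borel"
    by (rule borel_image_injective_holomorphic[OF S(2,1,3) Am A])
  \<comment> \<open>Inversion is used on an open set away from 0 so that its image is bounded;
    \<open>m / 2\<close> leaves room around the closed annuli.\<close>
  define U where "U = {w. m / 2 < cmod w}"
  have U: "open U" "inverse holomorphic_on U" "inj_on inverse U" "bounded (inverse ` U)"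
  proof -
    show "open U" unfolding U_def by (intro open_Collect_less continuous_intros)
    show "inverse holomorphic_on U" using m(1) by (intro holomorphic_intros) (auto simp: U_def)
    show "bounded (inverse ` U)"
    proof (intro boundedI[of _ "2 / m"])
      fix v assume "v \<in> inverse ` U"
      then obtain w where w: "v = inverse w" "m / 2 < cmod w" by (auto simp: U_def)
      then have "inverse (cmod w) < inverse (m / 2)" using m(1) by (intro less_imp_inverse_less) auto
      then show "cmod v \<le> 2 / m" by (simp add: w norm_inverse)
    qed
  qed (simp add: inj_on_def)
  have inv: "(\<integral>\<^sup>+w. h w * indicator T w \<partial>lborel) = (\<integral>\<^sup>+w. h w * indicator (inverse ` T) w \<partial>lborel)"
    if T: "T \<in> sets borel" "T \<subseteq> U" for T
  proof -
    have "(\<integral>\<^sup>+w. h w * indicator T w \<partial>lborel)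
        = (\<integral>\<^sup>+w. h (inverse w) * ennreal ((cmod (deriv inverse w))\<^sup>2) * indicator T w \<partial>lborel)"
    proof (intro nn_integral_cong)
      fix w
      show "h w * indicator T w = h (inverse w) * ennreal ((cmod (deriv inverse w))\<^sup>2) * indicator T w"
      proof (cases "w \<in> T")
        case True
        then have w: "w \<noteq> 0" using T m(1) by (auto simp: U_def)
        have "deriv inverse w = - (inverse w * inverse w)"
          using DERIV_inverse'[OF DERIV_ident w] by (intro DERIV_imp_deriv) simp
        moreover have "1 / x\<^sup>2 = 1 / (inverse x)\<^sup>2 * (inverse x * inverse x)\<^sup>2" if "x \<noteq> 0" for x :: real
          using that by (simp add: power2_eq_square field_simps)
        from this[of "cmod w"] have "1 / (cmod w)\<^sup>2 = 1 / (cmod (inverse w))\<^sup>2 * (cmod (inverse w * inverse w))\<^sup>2"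
          using w by (simp add: norm_mult norm_inverse)
        ultimately show ?thesis
          using True by (simp add: h_def flip: ennreal_mult)
      qed simp
    qed
    also have "\<dots> = (\<integral>\<^sup>+w. h w * indicator (inverse ` T) w \<partial>lborel)"
      by (rule nn_integral_injective_holomorphic[OF U(2,1,3,4) hm T])
    finally show ?thesis .
  qed
  have PU: "?P \<subseteq> U" using P(1) m(1) by (fastforce simp: U_def)
  have iPm [measurable]: "inverse ` ?P \<in> sets borel"
    by (rule borel_image_injective_holomorphic[OF U(2,1,3) Pm PU])
  define R1 where "R1 = {w. m \<le> cmod w \<and> cmod w \<le> 1}"
  have R1m [measurable]: "R1 \<in> sets borel" unfolding R1_def by measurable
  have R1U: "R1 \<subseteq> U" using m(1) by (auto simp: R1_def U_def)
  have iRm [measurable]: "inverse ` R1 \<in> sets borel"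
    by (rule borel_image_injective_holomorphic[OF U(2,1,3) R1m R1U])
  let ?I = "\<lambda>T. (\<integral>\<^sup>+w. h w * indicator T w \<partial>lborel)"
  \<comment> \<open>\<open>?P\<close> and its inversion are disjoint, have equal logarithmic area
    and lie in \<open>m \<le> |w| \<le> 1 / m\<close>, which \<open>R1\<close> and its inversion
    cover.\<close>
  have "2 * ?I ?P = ?I ?P + ?I (inverse ` ?P)" by (simp add: inv[OF Pm PU, symmetric] mult_2)
  also have "\<dots> = (\<integral>\<^sup>+w. h w * indicator ?P w + h w * indicator (inverse ` ?P) w \<partial>lborel)"
    by (rule nn_integral_add[symmetric]) measurable
  also have "\<dots> \<le> (\<integral>\<^sup>+w. h w * indicator R1 w + h w * indicator (inverse ` R1) w \<partial>lborel)"
  proof (intro nn_integral_mono)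
    fix w
    have disj: "\<not> (w \<in> ?P \<and> w \<in> inverse ` ?P)"
    proof
      assume "w \<in> ?P \<and> w \<in> inverse ` ?P"
      then obtain x y where xy: "x \<in> A" "y \<in> A" "w = F x" "w = inverse (F y)" by auto
      then have in1: "x \<in> ball 0 1" "y \<in> ball 0 1" "y \<noteq> 0" using A by (auto simp: S_def)
      then have "F y \<noteq> 0" by (simp add: Fnz)
      moreover have "F x = inverse (F y)" using xy by simp
      ultimately have "F x * F y = 1" by simp
      then show False using ne1[OF in1(1,2)] by simp
    qed
    have cov: "w \<in> R1 \<or> w \<in> inverse ` R1" if "w \<in> ?P \<or> w \<in> inverse ` ?P"
    proof -
      have "m \<le> cmod w \<and> cmod w \<le> 1 / m"
        using that
      proof
        assume "w \<in> inverse ` ?P"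
        then obtain v where v: "v \<in> ?P" "w = inverse v" by auto
        then have "cmod v > 0" using P(1)[of v] m(1) by linarith
        then show ?thesis
          using le_imp_inverse_le[OF P(1)[OF v(1)] m(1)] le_imp_inverse_le[OF P(2)[OF v(1)]] m(1) v(2)
          by (simp add: norm_inverse divide_inverse)
      qed (use P in auto)
      then have w: "m \<le> cmod w" "cmod w \<le> 1 / m" by auto
      show ?thesis
      proof (cases "cmod w \<le> 1")
        case False
        then have "inverse w \<in> R1"
          using le_imp_inverse_le[OF w(2) less_le_trans[OF m(1) w(1)]] le_imp_inverse_le[of 1 "cmod w"] m(1)
          by (simp add: R1_def norm_inverse divide_inverse)
        then show ?thesis by (metis image_eqI inverse_inverse_eq)
      qed (use w in \<open>auto simp: R1_def\<close>)
    qed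
    show "h w * indicator ?P w + h w * indicator (inverse ` ?P) w
        \<le> h w * indicator R1 w + h w * indicator (inverse ` R1) w"
      using disj cov by (auto split: split_indicator)
  qed
  also have "\<dots> = ?I R1 + ?I (inverse ` R1)"
    by (rule nn_integral_add) measurable
  also have "\<dots> = 2 * ?I R1" by (simp add: inv[OF R1m R1U, symmetric] mult_2)
  finally have PR: "?I ?P \<le> ?I R1"
    by (subst (asm) ennreal_mult_le_mult_iff) auto
  have le: "?I A \<le> ?I R1" using 1 2 3 PR by simp
  \<comment> \<open>\<open>A\<close> splits into \<open>R2\<close> and the collar \<open>R3\<close>
    between \<open>\<epsilon>\<close> and \<open>m\<close>. Since \<open>R1\<close> exceeds
    \<open>R2\<close> only by a circle, a null set, the collar would have to be null; but it
    contains a disc.\<close>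
  define R2 where "R2 = {w. m \<le> cmod w \<and> cmod w < 1}"
  define R3 where "R3 = {w. \<epsilon> \<le> cmod w \<and> cmod w < m}"
  have [measurable]: "R2 \<in> sets borel" "R3 \<in> sets borel" unfolding R2_def R3_def by measurable
  have "?I R1 = ?I R2"
  proof (intro nn_integral_cong_AE)
    have "AE w in lborel. w \<notin> sphere (0::complex) 1"
      using negligible_sphere[of "0::complex" 1]
      by (intro AE_not_in) (simp add: negligible_iff_null_sets null_sets_completion_iff)
    then show "AE w in lborel. h w * indicator R1 w = h w * indicator R2 w"
      by eventually_elim (auto simp: R1_def R2_def split: split_indicator)
  qed
  moreover have "?I A = ?I R2 + ?I R3"
  proof -
    have "?I A = (\<integral>\<^sup>+w. h w * indicator R2 w + h w * indicator R3 w \<partial>lborel)"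
      using eps m by (intro nn_integral_cong) (auto simp: A_def R2_def R3_def split: split_indicator)
    also have "\<dots> = ?I R2 + ?I R3" by (rule nn_integral_add) measurable
    finally show ?thesis .
  qed
  moreover have "?I R2 < \<infinity>"
  proof -
    have "?I R2 \<le> (\<integral>\<^sup>+w. ennreal (1 / m\<^sup>2) * indicator (ball (0::complex) 1) w \<partial>lborel)"
      using m(1) by (intro nn_integral_mono)
        (auto simp: R2_def h_def split: split_indicator intro!: ennreal_leI divide_left_mono power_mono mult_pos_pos zero_less_power)
    also have "\<dots> = ennreal (1 / m\<^sup>2) * emeasure lborel (ball (0::complex) 1)"
      by (subst nn_integral_cmult_indicator) auto
    also have "\<dots> < \<infinity>" using emeasure_lborel_ball_finite[of "0::complex" 1]
      by (simp add: ennreal_mult_less_top)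
    finally show ?thesis .
  qed
  moreover have "?I R3 > 0"
  proof -
    let ?c = "of_real ((\<epsilon> + m) / 2) :: complex" and ?r = "(m - \<epsilon>) / 2"
    have sub: "ball ?c ?r \<subseteq> R3"
    proof
      fix w assume "w \<in> ball ?c ?r"
      then have "cmod (w - ?c) < ?r" by (simp add: dist_norm norm_minus_commute)
      moreover have "cmod ?c = (\<epsilon> + m) / 2" using eps m unfolding norm_of_real by simp
      ultimately show "w \<in> R3"
        using norm_triangle_ineq2[of w ?c] norm_triangle_ineq2[of ?c w]
        unfolding R3_def mem_Collect_eq norm_minus_commute[of ?c w] by (simp add: field_simps)
    qed
    have "0 < emeasure lborel (ball ?c ?r)"
      using eps by (simp add: emeasure_ball ennreal_zero_less_mult_iff)
    also have "\<dots> = (\<integral>\<^sup>+w. indicator (ball ?c ?r) w \<partial>lborel)" by simp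
    also have "\<dots> \<le> ?I R3"
    proof (intro nn_integral_mono)
      fix w
      have "1 \<le> h w" if "w \<in> R3"
      proof -
        have "0 < cmod w" "cmod w \<le> 1" using that eps m by (auto simp: R3_def)
        then have "1 \<le> 1 / (cmod w)\<^sup>2" by (simp add: power_le_one)
        then show ?thesis unfolding h_def by simp
      qed
      then show "indicator (ball ?c ?r) w \<le> h w * indicator R3 w"
        using sub by (auto split: split_indicator)
    qed
    finally show ?thesis .
  qed
  ultimately show False
    using le by (auto simp add: ennreal_add_left_cancel_le[of "?I R2" "?I R3" 0, simplified] not_le less_top)
qed

text \<open>Let \<open>s\<close> be the root of \<open>1 - \<psi>\<close> with
  \<open>s 0 = 1\<close>, for the inverse Riemann map \<open>\<psi>\<close>. Injectivity of
  \<open>\<psi>\<close> and the omitted value 1 exclude \<open>s z = - s w\<close>, which under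
  \<open>F = (s - 1) / (s + 1)\<close> is the same as \<open>F z * F w = 1\<close>. So the bound on
  \<open>F'(0) = - \<psi>'(0) / 4\<close> gives \<open>|\<psi>'(0)| \<le> 4\<close>.\<close>

lemma exists_biholomorphism_to_disc_deriv_ge:
  assumes op: "open \<Omega>" and sc: "simply_connected \<Omega>" and mem: "0 \<in> \<Omega>" "1 \<notin> \<Omega>"
  obtains \<phi> where "\<phi> holomorphic_on \<Omega>" "inj_on \<phi> \<Omega>" "\<phi> ` \<Omega> = ball 0 1" "\<phi> 0 = 0" "1 / 4 \<le> cmod (deriv \<phi> 0)"
proof -
  obtain f g where f: "f holomorphic_on \<Omega>" and g: "g holomorphic_on ball 0 1"
    and fg: "\<And>z. z \<in> \<Omega> \<Longrightarrow> f z \<in> ball 0 1 \<and> g (f z) = z"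
    and gf: "\<And>z. z \<in> ball 0 1 \<Longrightarrow> g z \<in> \<Omega> \<and> f (g z) = z"
    using Riemann_mapping_theorem[of \<Omega>] op sc mem by blast
  obtain p q where p0: "p (f 0) = 0"
    and p: "p holomorphic_on ball 0 1" "p ` ball 0 1 \<subseteq> ball 0 1"
    and q: "q holomorphic_on ball 0 1" "q ` ball 0 1 \<subseteq> ball 0 1"
    and pq: "\<And>z. z \<in> ball 0 1 \<Longrightarrow> p (q z) = z" and qp: "\<And>z. z \<in> ball 0 1 \<Longrightarrow> q (p z) = z"
    using ball_biholomorphism_exists[of "f 0"] fg[OF mem(1)] by metis
  define \<phi> where "\<phi> = p \<circ> f"
  define \<psi> where "\<psi> = g \<circ> q"
  have hol\<phi>: "\<phi> holomorphic_on \<Omega>"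
    unfolding \<phi>_def using fg by (intro holomorphic_on_compose_gen[OF f p(1)]) auto
  have hol\<psi>: "\<psi> holomorphic_on ball 0 1"
    unfolding \<psi>_def by (intro holomorphic_on_compose_gen[OF q(1) g] q(2))
  have im\<phi>: "\<phi> z \<in> ball 0 1" "\<psi> (\<phi> z) = z" if "z \<in> \<Omega>" for z
    using fg[OF that] subsetD[OF p(2), of "p (f z)"] qp[of "f z"] by (auto simp: \<phi>_def \<psi>_def)
  have im\<psi>: "\<psi> z \<in> \<Omega>" "\<phi> (\<psi> z) = z" if "z \<in> ball 0 1" for z
    using gf[of "q z"] subsetD[OF q(2), of "q z"] pq[OF that] that by (auto simp: \<phi>_def \<psi>_def)
  have \<phi>0: "\<phi> 0 = 0" by (simp add: \<phi>_def p0)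
  have \<psi>0: "\<psi> 0 = 0" using im\<phi>(2)[OF mem(1)] \<phi>0 by simp
  have inj\<psi>: "inj_on \<psi> (ball 0 1)" by (metis im\<psi>(2) inj_onI)
  have inj\<phi>: "inj_on \<phi> \<Omega>" by (metis im\<phi>(2) inj_onI)
  have "(\<lambda>z. 1 - \<psi> z) holomorphic_on ball 0 1" by (intro holomorphic_intros hol\<psi>)
  moreover have "1 - \<psi> z \<noteq> 0" if "z \<in> ball 0 1" for z using im\<psi>(1)[OF that] mem(2) by auto
  ultimately obtain s0 where s0: "s0 holomorphic_on ball 0 1" "\<And>z. z \<in> ball 0 1 \<Longrightarrow> 1 - \<psi> z = (s0 z)\<^sup>2"
    using contractible_imp_holomorphic_sqrt[of "\<lambda>z. 1 - \<psi> z" "ball 0 1"]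
    by (metis convex_ball convex_imp_contractible)
  have s00: "(s0 0)\<^sup>2 = 1" using s0(2)[of 0] \<psi>0 by simp
  \<comment> \<open>\<open>s0 0\<close> is 1 or -1; the factor selects the branch with value 1 at
    0.\<close>
  define s where "s = (\<lambda>z. s0 0 * s0 z)"
  have hols: "s holomorphic_on ball 0 1" unfolding s_def by (intro holomorphic_intros s0(1))
  have s2: "(s z)\<^sup>2 = 1 - \<psi> z" if "z \<in> ball 0 1" for z
    using s0(2)[OF that] s00 by (simp add: s_def power_mult_distrib)
  have s_0: "s 0 = 1" using s00 by (simp add: s_def power2_eq_square)
  have snz: "s z + s w \<noteq> 0" if zw: "z \<in> ball 0 1" "w \<in> ball 0 1" for z w
  proof
    assume "s z + s w = 0"
    then have eq: "s z = - s w" by (simp add: eq_neg_iff_add_eq_0)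
    then have "\<psi> z = \<psi> w" using s2[OF zw(1)] s2[OF zw(2)] by simp
    then have "z = w" using inj\<psi> zw by (auto dest: inj_onD)
    with eq have "s z = 0" by simp
    then show False using s2[OF zw(1)] im\<psi>(1)[OF zw(1)] mem(2) by simp
  qed
  have s1: "s z + 1 \<noteq> 0" if "z \<in> ball 0 1" for z
    using snz[OF that, of 0] s_0 by simp
  define F where "F = (\<lambda>z. (s z - 1) / (s z + 1))"
  have holF: "F holomorphic_on ball 0 1"
    unfolding F_def using s1 by (intro holomorphic_intros hols)
  have "cmod (deriv F 0) \<le> 1"
  proof (rule injective_holomorphic_disc_no_reciprocal_values[OF holF])
    show "inj_on F (ball 0 1)"
    proof (rule inj_onI)
      fix z w assume zw: "z \<in> ball 0 1" "w \<in> ball 0 1" and "F z = F w"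
      then have "(s z - 1) * (s w + 1) = (s w - 1) * (s z + 1)"
        using s1 by (simp add: F_def frac_eq_eq)
      then have "s z = s w" by (simp add: algebra_simps)
      then have "\<psi> z = \<psi> w" using s2[OF zw(1)] s2[OF zw(2)] by simp
      then show "z = w" using inj\<psi> zw by (auto dest: inj_onD)
    qed
    show "F 0 = 0" by (simp add: F_def s_0)
    fix z w :: complex assume zw: "z \<in> ball 0 1" "w \<in> ball 0 1"
    show "F z * F w \<noteq> 1"
    proof
      assume "F z * F w = 1"
      then have "(s z - 1) * (s w - 1) = (s z + 1) * (s w + 1)"
        using s1[OF zw(1)] s1[OF zw(2)] by (simp add: F_def)
      then have "2 * (s z + s w) = 0" by (simp add: algebra_simps)
      then have "s z + s w = 0" by (metis mult_eq_0_iff zero_neq_numeral)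
      then show False using snz[OF zw] by simp
    qed
  qed
  moreover have "deriv F 0 = - deriv \<psi> 0 / 4"
  proof -
    have ds: "(s has_field_derivative deriv s 0) (at 0)"
      using hols by (intro holomorphic_derivI[of _ "ball 0 1"]) auto
    have "((\<lambda>z. (s z)\<^sup>2) has_field_derivative 2 * deriv s 0) (at 0)"
      using DERIV_power[OF ds, of 2] s_0 by simp
    moreover have "((\<lambda>z. 1 - \<psi> z) has_field_derivative - deriv \<psi> 0) (at 0)"
      using hol\<psi> by (auto intro!: derivative_eq_intros holomorphic_derivI[of _ "ball 0 1"])
    then have "((\<lambda>z. (s z)\<^sup>2) has_field_derivative - deriv \<psi> 0) (at 0)"
      by (rule DERIV_cong_ev[THEN iffD1, rotated -1])
         (use eventually_nhds_in_open[of "ball 0 1" "0::complex"] s2 in \<open>auto elim: eventually_mono\<close>)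
    ultimately have ds2: "2 * deriv s 0 = - deriv \<psi> 0" by (rule DERIV_unique)
    have dF: "deriv F 0 = deriv s 0 / 2"
      unfolding F_def using ds s_0 by (intro DERIV_imp_deriv) (auto intro!: derivative_eq_intros simp: field_simps)
    have "deriv F 0 = (2 * deriv s 0) / 4" by (simp add: dF)
    then show ?thesis by (simp only: ds2)
  qed
  moreover have "deriv \<phi> 0 * deriv \<psi> 0 = 1"
  proof -
    have "(\<psi> has_field_derivative deriv \<psi> 0) (at (\<phi> 0))"
      using hol\<psi> \<phi>0 by (auto intro!: holomorphic_derivI[of _ "ball 0 1"])
    moreover have "(\<phi> has_field_derivative deriv \<phi> 0) (at 0)"
      using hol\<phi> op mem by (auto intro!: holomorphic_derivI)
    ultimately have "((\<psi> \<circ> \<phi>) has_field_derivative deriv \<psi> 0 * deriv \<phi> 0) (at 0)"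
      by (rule DERIV_chain)
    moreover have "((\<psi> \<circ> \<phi>) has_field_derivative 1) (at 0)"
      using DERIV_ident
      by (rule DERIV_cong_ev[THEN iffD1, rotated -1])
         (use eventually_nhds_in_open[OF op mem(1)] im\<phi>(2) in \<open>auto elim: eventually_mono\<close>)
    ultimately show ?thesis using DERIV_unique by (metis mult.commute)
  qed
  ultimately have "cmod (deriv \<psi> 0) \<le> 4" "cmod (deriv \<phi> 0) * cmod (deriv \<psi> 0) = 1"
    by (auto simp: norm_divide simp flip: norm_mult)
  then have "1 / 4 \<le> cmod (deriv \<phi> 0)"
    by (smt (verit) divide_le_eq_1 mult_left_mono norm_ge_zero le_divide_eq_1 mult.commute divide_le_eq)
  moreover have "\<phi> ` \<Omega> = ball 0 1"
    using im\<phi> im\<psi> by (metis image_eqI subsetI subset_antisym image_subsetI)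
  ultimately show thesis using that hol\<phi> inj\<phi> \<phi>0 by blast
qed

subsection \<open>Logarithms on families of planar slices\<close>

text \<open>The difference takes values in the integer multiples of \<open>2 \<pi> i\<close>, which
  are \<open>2 \<pi>\<close> apart, so continuity makes it constant.\<close>

lemma continuous_log_unique_on_connected:
  assumes "connected S" "continuous_on S g" "continuous_on S h" "\<And>x. x \<in> S \<Longrightarrow> exp (g x :: complex) = exp (h x)"
    and "x \<in> S" "y \<in> S"
  shows "g x - h x = g y - h y"
proof -
  have "(\<lambda>x. g x - h x) constant_on S"
  proof (rule continuous_discrete_range_constant[OF assms(1)])
    show "continuous_on S (\<lambda>x. g x - h x)" by (intro continuous_intros assms)
    fix x assume x: "x \<in> S"
    show "\<exists>e>0. \<forall>y. y \<in> S \<and> g y - h y \<noteq> g x - h x \<longrightarrow> e \<le> cmod (g y - h y - (g x - h x))"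
    proof (intro exI[of _ "2 * pi"] conjI allI impI)
      fix y assume y: "y \<in> S \<and> g y - h y \<noteq> g x - h x"
      have "exp (g y - h y) = exp (g x - h x)" using assms(4) x y by (simp add: exp_diff)
      then obtain n :: int where n: "g y - h y = g x - h x + (of_int (2 * n) * pi) * \<i>"
        by (metis exp_eq)
      with y have "n \<noteq> 0" by auto
      then have "1 \<le> \<bar>real_of_int n\<bar>" by linarith
      have "g y - h y - (g x - h x) = (of_int (2 * n) * pi) * \<i>"
        using n by (simp only: add_diff_cancel_left')
      then have "cmod (g y - h y - (g x - h x)) = 2 * pi * \<bar>real_of_int n\<bar>"
        by (simp add: norm_mult)
      moreover have "2 * pi * 1 \<le> 2 * pi * \<bar>real_of_int n\<bar>"
        using \<open>1 \<le> \<bar>real_of_int n\<bar>\<close> by (intro mult_left_mono) auto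
      ultimately show "2 * pi \<le> cmod (g y - h y - (g x - h x))" by simp
    qed simp
  qed
  then show ?thesis using assms(5,6) by (auto simp: constant_on_def)
qed

text \<open>The increment of a logarithm along a connected slice depends continuously on the slice and on
  the two end points: the relation expressing this is locally trivial and transitive.\<close>

lemma log_increment_tendsto:
  fixes W :: "('a::metric_space \<times> complex) set" and f :: "'a \<Rightarrow> complex \<Rightarrow> complex"
  assumes W: "open W" and T: "t0 \<in> T"
    and contf: "continuous_on (W \<inter> T \<times> UNIV) (\<lambda>(t, l). f t l)"
    and conn: "connected {l. (t0, l) \<in> W}"
    and contG: "\<And>t. t \<in> T \<Longrightarrow> continuous_on {l. (t, l) \<in> W} (G t)"
    and expG: "\<And>t l. t \<in> T \<Longrightarrow> (t, l) \<in> W \<Longrightarrow> exp (G t l) = f t l"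
    and l: "(t0, l0) \<in> W" and m: "(t0, m0) \<in> W"
    and tl: "(\<tau> \<longlongrightarrow> t0) F" "(\<nu> \<longlongrightarrow> l0) F" "(\<mu> \<longlongrightarrow> m0) F" and ev: "eventually (\<lambda>x. \<tau> x \<in> T) F"
  shows "((\<lambda>x. G (\<tau> x) (\<nu> x) - G (\<tau> x) (\<mu> x)) \<longlongrightarrow> G t0 l0 - G t0 m0) F"
proof -
  \<comment> \<open>The approaching families are quantified inside the relation so that transitivity
    can pass through the constant family at an intermediate point.\<close>
  define R where "R = (\<lambda>l0 m0. \<forall>\<nu> \<mu>. (\<nu> \<longlongrightarrow> l0) F \<and> (\<mu> \<longlongrightarrow> m0) F \<longrightarrow>
     ((\<lambda>x. G (\<tau> x) (\<nu> x) - G (\<tau> x) (\<mu> x)) \<longlongrightarrow> G t0 l0 - G t0 m0) F)"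
  let ?S = "{l. (t0, l) \<in> W}"
  have "R l0 m0"
  proof (rule connected_equivalence_relation[OF conn])
    show "l0 \<in> ?S" "m0 \<in> ?S" using l m by auto
  next
    fix x y assume R: "R x y"
    show "R y x"
      unfolding R_def
    proof (intro allI impI)
      fix \<nu> \<mu> assume "(\<nu> \<longlongrightarrow> y) F \<and> (\<mu> \<longlongrightarrow> x) F"
      then have "((\<lambda>z. G (\<tau> z) (\<mu> z) - G (\<tau> z) (\<nu> z)) \<longlongrightarrow> G t0 x - G t0 y) F"
        using R unfolding R_def by blast
      from tendsto_minus[OF this]
      show "((\<lambda>z. G (\<tau> z) (\<nu> z) - G (\<tau> z) (\<mu> z)) \<longlongrightarrow> G t0 y - G t0 x) F" by simp
    qed
  next
    fix x y z assume R: "R x y" "R y z"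
    show "R x z"
      unfolding R_def
    proof (intro allI impI)
      fix \<nu> \<mu> assume lm: "(\<nu> \<longlongrightarrow> x) F \<and> (\<mu> \<longlongrightarrow> z) F"
      have "((\<lambda>u. G (\<tau> u) (\<nu> u) - G (\<tau> u) y) \<longlongrightarrow> G t0 x - G t0 y) F"
        using R(1) lm tendsto_const[of y F] unfolding R_def by blast
      from tendsto_add[OF this, of "\<lambda>u. G (\<tau> u) y - G (\<tau> u) (\<mu> u)" "G t0 y - G t0 z"]
      show "((\<lambda>u. G (\<tau> u) (\<nu> u) - G (\<tau> u) (\<mu> u)) \<longlongrightarrow> G t0 x - G t0 z) F"
        using R(2) lm tendsto_const[of y F] unfolding R_def by simp
    qed
  next
    fix a assume "a \<in> ?S"
    then have a: "(t0, a) \<in> W" by simp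
    have nz: "f t0 a \<noteq> 0" using expG[OF T a] by (metis exp_not_eq_zero)
    have "((\<lambda>p. f (fst p) (snd p)) \<longlongrightarrow> f t0 a) (at (t0, a) within (W \<inter> T \<times> UNIV))"
      using bspec[OF contf[unfolded continuous_on_def], of "(t0, a)"] a T by (simp add: case_prod_beta')
    then have "((\<lambda>p. f (fst p) (snd p) / f t0 a) \<longlongrightarrow> 1) (at (t0, a) within (W \<inter> T \<times> UNIV))"
      using tendsto_divide[OF _ tendsto_const nz, of "\<lambda>p. f (fst p) (snd p)" "f t0 a"] nz by simp
    then have "\<forall>\<^sub>F p in at (t0, a) within (W \<inter> T \<times> UNIV). dist (f (fst p) (snd p) / f t0 a) 1 < 1"
      by (rule tendstoD) simp
    then obtain d1 where d1: "d1 > 0" "\<And>p. p \<in> W \<inter> T \<times> UNIV \<Longrightarrow> p \<noteq> (t0, a) \<Longrightarrow> dist p (t0, a) < d1 \<Longrightarrow>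
        dist (f (fst p) (snd p) / f t0 a) 1 < 1"
      unfolding eventually_at by metis
    obtain d2 where d2: "d2 > 0" "ball (t0, a) d2 \<subseteq> W" by (rule openE[OF W a])
    define d where "d = min d1 d2 / 2"
    have d: "d > 0" using d1(1) d2(1) by (simp add: d_def)
    have near: "(t, x) \<in> ball (t0, a) d2 \<and> dist (t, x) (t0, a) < d1" if "dist t t0 < d" "dist x a < d" for t x
    proof -
      have "dist (t, x) (t0, a) \<le> dist t t0 + dist x a"
        unfolding dist_Pair_Pair by (rule sqrt_sum_squares_le_sum) auto
      also have "\<dots> < min d1 d2" using that by (simp add: d_def)
      finally show ?thesis by (simp add: dist_commute)
    qed
    have inW: "(t, x) \<in> W" if "dist t t0 < d" "dist x a < d" for t x
      using near[OF that] d2(2) by blast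
    have nneg: "dist (f t x / f t0 a) 1 < 1" if "t \<in> T" "dist t t0 < d" "dist x a < d" for t x
    proof (cases "(t, x) = (t0, a)")
      case False
      then show ?thesis using near[OF that(2,3)] inW[OF that(2,3)] that(1) d1(2)[of "(t, x)"] by simp
    qed (use nz in simp)
    have npos: "f t x / f t0 a \<notin> \<real>\<^sub>\<le>\<^sub>0" if "t \<in> T" "dist t t0 < d" "dist x a < d" for t x
    proof
      assume "f t x / f t0 a \<in> \<real>\<^sub>\<le>\<^sub>0"
      then have "Re (f t x / f t0 a) \<le> 0" by (auto elim!: nonpos_Reals_cases)
      then have "1 \<le> \<bar>Re (f t x / f t0 a - 1)\<bar>" by simp
      also have "\<dots> \<le> cmod (f t x / f t0 a - 1)" by (rule abs_Re_le_cmod)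
      finally show False using nneg[OF that] by (simp add: dist_norm)
    qed
    \<comment> \<open>Division by \<open>f t0 a\<close> moves the values near \<open>(t0, a)\<close>
      into the unit disc about 1, where \<open>Ln\<close> is continuous; on the ball around
      \<open>a\<close> every branch \<open>G t\<close> therefore has the increments of
      \<open>Ln\<close>.\<close>
    have diff: "G t x - G t y = Ln (f t x / f t0 a) - Ln (f t y / f t0 a)"
      if t: "t \<in> T" "dist t t0 < d" and xy: "dist x a < d" "dist y a < d" for t x y
    proof -
      have sub: "(t, l) \<in> W" if "l \<in> ball a d" for l
        using inW[OF t(2), of l] that by (simp add: dist_commute)
      have cf: "continuous_on (ball a d) (f t)"
      proof -
        have "Pair t ` ball a d \<subseteq> W \<inter> T \<times> UNIV"
          using sub t(1) by blast
        then have "continuous_on (ball a d) (\<lambda>l. case (t, l) of (t, l) \<Rightarrow> f t l)"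
          by (intro continuous_on_compose2[OF contf]) (auto intro!: continuous_intros)
        then show ?thesis by simp
      qed
      have "G t x - Ln (f t x / f t0 a) = G t y - Ln (f t y / f t0 a)"
      proof -
        have "(G t x - Ln (f t0 a)) - Ln (f t x / f t0 a) = (G t y - Ln (f t0 a)) - Ln (f t y / f t0 a)"
        proof (rule continuous_log_unique_on_connected[where S = "ball a d"])
          show "continuous_on (ball a d) (\<lambda>x. G t x - Ln (f t0 a))"
            using sub by (intro continuous_intros continuous_on_subset[OF contG[OF t(1)]]) blast
          show "continuous_on (ball a d) (\<lambda>x. Ln (f t x / f t0 a))"
            using npos[OF t] nz by (intro continuous_on_Ln' continuous_on_divide cf continuous_on_const) (simp_all add: dist_commute)
          fix z assume "z \<in> ball a d"
          then have z: "dist z a < d" by (simp add: dist_commute)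
          have "f t z / f t0 a \<noteq> 0" using npos[OF t z] by auto
          then show "exp (G t z - Ln (f t0 a)) = exp (Ln (f t z / f t0 a))"
            using expG[OF t(1) inW[OF t(2) z]] nz by (simp add: exp_diff)
        qed (use xy in \<open>auto simp: dist_commute\<close>)
        then show ?thesis by simp
      qed
      then show ?thesis by (simp add: algebra_simps)
    qed
    have lim: "((\<lambda>u. Ln (f (\<tau> u) (\<nu> u) / f t0 a)) \<longlongrightarrow> Ln (f t0 x / f t0 a)) F"
      if x: "dist x a < d" and lx: "(\<nu> \<longlongrightarrow> x) F" for \<nu> x
    proof -
      have x0: "(t0, x) \<in> W" using inW[of t0 x] d x by simp
      have "((\<lambda>u. (\<tau> u, \<nu> u)) \<longlongrightarrow> (t0, x)) F" by (intro tendsto_intros tl lx)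
      moreover have "\<forall>\<^sub>F u in F. (\<tau> u, \<nu> u) \<in> W \<inter> T \<times> UNIV"
        using topological_tendstoD[OF calculation W x0] ev by eventually_elim auto
      ultimately have "((\<lambda>u. case (\<tau> u, \<nu> u) of (t, l) \<Rightarrow> f t l) \<longlongrightarrow> (case (t0, x) of (t, l) \<Rightarrow> f t l)) F"
        by (intro continuous_on_tendsto_compose[OF contf]) (use x0 T in auto)
      then show ?thesis
        using npos[OF T, of x] d x nz by (intro tendsto_Ln tendsto_divide) auto
    qed
    show "\<exists>T. openin (top_of_set ?S) T \<and> a \<in> T \<and> (\<forall>x\<in>T. R a x)"
    proof (intro exI[of _ "?S \<inter> ball a d"] conjI ballI)
      show "openin (top_of_set ?S) (?S \<inter> ball a d)" by (simp add: openin_open_Int)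
      show "a \<in> ?S \<inter> ball a d" using a d by simp
      fix x assume "x \<in> ?S \<inter> ball a d"
      then have x: "dist x a < d" by (simp add: dist_commute)
      show "R a x"
        unfolding R_def
      proof (intro allI impI)
        fix \<nu> \<mu> assume lm: "(\<nu> \<longlongrightarrow> a) F \<and> (\<mu> \<longlongrightarrow> x) F"
        have ev1: "\<forall>\<^sub>F u in F. dist (\<nu> u) a < d" using lm d by (auto dest: tendstoD)
        have "\<forall>\<^sub>F u in F. dist (\<mu> u) x < d - dist x a" using lm x by (auto intro: tendstoD)
        then have ev2: "\<forall>\<^sub>F u in F. dist (\<mu> u) a < d"
        proof eventually_elim
          case (elim u)
          then show ?case using dist_triangle[of "\<mu> u" a x] by linarith
        qed
        have ev3: "\<forall>\<^sub>F u in F. dist (\<tau> u) t0 < d" using tl(1) d by (auto dest: tendstoD)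
        have "((\<lambda>u. Ln (f (\<tau> u) (\<nu> u) / f t0 a) - Ln (f (\<tau> u) (\<mu> u) / f t0 a)) \<longlongrightarrow>
            Ln (f t0 a / f t0 a) - Ln (f t0 x / f t0 a)) F"
          using lm d x by (intro tendsto_diff lim) auto
        also have "Ln (f t0 a / f t0 a) - Ln (f t0 x / f t0 a) = G t0 a - G t0 x"
          using diff[OF T _ _ x, of a] d by simp
        finally show "((\<lambda>u. G (\<tau> u) (\<nu> u) - G (\<tau> u) (\<mu> u)) \<longlongrightarrow> G t0 a - G t0 x) F"
          by (rule Lim_transform_eventually)
             (use ev ev1 ev2 ev3 in \<open>eventually_elim, simp add: diff\<close>)
      qed
    qed
  qed
  then show ?thesis using tl(2,3) unfolding R_def by blast
qed

lemma exists_continuous_log_on_slice: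
  fixes S :: "complex set"
  assumes "open S" "simply_connected S" "continuous_on S f" "\<And>z. z \<in> S \<Longrightarrow> f z \<noteq> 0"
  shows "\<exists>g. continuous_on S g \<and> (\<forall>z\<in>S. exp (g z) = (f z :: complex))"
proof -
  obtain g where "continuous_on S g" "\<And>z. z \<in> S \<Longrightarrow> f z = exp (g z)"
    using continuous_logarithm_on_simply_connected[OF assms(3,2) open_imp_locally_path_connected[OF assms(1)] assms(4)]
    by metis
  then show ?thesis by metis
qed

text \<open>Softness: local branches of the logarithm on the slices are glued by a partition of unity
  subordinate to balls on which one point stays in all slices. The glued function differs from a
  logarithm of \<open>l\<close> by a function of \<open>t\<close> alone, and the disc has logarithms.\<close>

lemma continuous_log_over_disc:
  fixes W :: "(complex \<times> complex) set"
  assumes W: "open W" and sc: "\<And>t. cmod t \<le> 1 \<Longrightarrow> simply_connected {l. (t, l) \<in> W}"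
    and ne: "\<And>t. cmod t \<le> 1 \<Longrightarrow> \<exists>l. (t, l) \<in> W" and nz: "\<And>t. (t, 0) \<notin> W"
  obtains \<psi> where "continuous_on (W \<inter> cball 0 1 \<times> UNIV) \<psi>"
    "\<And>t l. cmod t \<le> 1 \<Longrightarrow> (t, l) \<in> W \<Longrightarrow> exp (\<psi> (t, l)) = l"
proof -
  let ?S = "\<lambda>t. {l. (t, l) \<in> W}"
  have opS: "open (?S t)" for t
  proof -
    have "?S t = Pair t -` W" by auto
    then show ?thesis using W by (auto intro!: open_vimage continuous_intros)
  qed
  have conn: "connected (?S t)" if "cmod t \<le> 1" for t
    using sc[OF that] simply_connected_imp_connected by blast
  have "\<exists>g. continuous_on (?S t) g \<and> (\<forall>l\<in>?S t. exp (g l) = l)" if "cmod t \<le> 1" for t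
    by (rule exists_continuous_log_on_slice[OF opS sc[OF that]]) (use nz in auto)
  then obtain G where contG: "\<And>t. cmod t \<le> 1 \<Longrightarrow> continuous_on (?S t) (G t)"
    and expG: "\<And>t l. cmod t \<le> 1 \<Longrightarrow> (t, l) \<in> W \<Longrightarrow> exp (G t l) = l"
    by (metis mem_Collect_eq)
  obtain s where s: "\<And>t. cmod t \<le> 1 \<Longrightarrow> (t, s t) \<in> W" using ne by metis
  \<comment> \<open>With the doubled radius, \<open>s t\<close> stays in all slices over a
    neighbourhood of the closed ball of radius \<open>r t\<close>, outside of which the weight will
    vanish.\<close>
  have "\<exists>r>0. \<forall>t'. dist t t' < 2 * r \<longrightarrow> (t', s t) \<in> W" if "cmod t \<le> 1" for t
  proof -
    have "open ((\<lambda>t'. (t', s t)) -` W)" using W by (intro open_vimage continuous_intros) auto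
    moreover have "t \<in> (\<lambda>t'. (t', s t)) -` W" using s[OF that] by simp
    ultimately obtain e where "e > 0" "ball t e \<subseteq> (\<lambda>t'. (t', s t)) -` W"
      by (rule openE)
    then show ?thesis by (intro exI[of _ "e / 2"]) auto
  qed
  then obtain r where r: "\<And>t. cmod t \<le> 1 \<Longrightarrow> r t > 0" "\<And>t t'. cmod t \<le> 1 \<Longrightarrow> dist t t' < 2 * r t \<Longrightarrow> (t', s t) \<in> W"
    by metis
  have "cball (0::complex) 1 \<subseteq> (\<Union>t\<in>cball 0 1. ball t (r t))" using r(1) by force
  then obtain C where C: "C \<subseteq> cball 0 1" "finite C" "cball (0::complex) 1 \<subseteq> (\<Union>t\<in>C. ball t (r t))"
    using compactE_image[OF compact_cball, of "cball 0 1" "\<lambda>t. ball t (r t)" 0 1] by (metis open_ball)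
  define w where "w = (\<lambda>c t. max 0 (r c - dist c t))"
  define N where "N = (\<lambda>t. \<Sum>c\<in>C. w c t)"
  have wpos: "w c t \<ge> 0" for c t by (simp add: w_def)
  have Npos: "N t > 0" if "cmod t \<le> 1" for t
  proof -
    obtain c where c: "c \<in> C" "dist c t < r c" using C(3) \<open>cmod t \<le> 1\<close> by force
    then have "0 < w c t" by (simp add: w_def)
    also have "\<dots> \<le> N t" unfolding N_def using C(2) c(1) wpos by (intro member_le_sum) auto
    finally show ?thesis .
  qed
  \<comment> \<open>A weighted mean of increments from the base points \<open>s c\<close>: the
    arbitrary additive constant of each branch \<open>G t\<close> drops out.\<close>
  define \<Psi> where "\<Psi> = (\<lambda>(t, l). \<Sum>c\<in>C. of_real (w c t / N t) * (G t l - G t (s c)))"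
  have cont\<Psi>: "continuous_on (W \<inter> cball 0 1 \<times> UNIV) \<Psi>"
    unfolding continuous_on_def
  proof
    fix p assume p: "p \<in> W \<inter> cball 0 1 \<times> UNIV"
    obtain t0 l0 where tl: "p = (t0, l0)" by (cases p)
    have t0: "cmod t0 \<le> 1" "(t0, l0) \<in> W" using p tl by auto
    let ?F = "at p within (W \<inter> cball 0 1 \<times> UNIV)"
    have fs: "(fst \<longlongrightarrow> t0) ?F" "(snd \<longlongrightarrow> l0) ?F"
      using tendsto_fst[OF tendsto_ident_at, of p "W \<inter> cball 0 1 \<times> UNIV"] tendsto_snd[OF tendsto_ident_at, of p "W \<inter> cball 0 1 \<times> UNIV"]
      by (auto simp: tl)
    have ev: "\<forall>\<^sub>F q in ?F. fst q \<in> cball 0 1" by (simp add: eventually_at_filter mem_Times_iff)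
    have limw: "((\<lambda>q. w c (fst q)) \<longlongrightarrow> w c t0) ?F" for c
      unfolding w_def by (intro tendsto_intros fs)
    have limN: "((\<lambda>q. N (fst q)) \<longlongrightarrow> N t0) ?F"
      unfolding N_def by (intro tendsto_intros limw)
    have "((\<lambda>q. of_real (w c (fst q) / N (fst q)) * (G (fst q) (snd q) - G (fst q) (s c)))
        \<longlongrightarrow> of_real (w c t0 / N t0) * (G t0 l0 - G t0 (s c))) ?F" if c: "c \<in> C" for c
    proof (cases "dist c t0 < 2 * r c")
      case True
      have "((\<lambda>q. G (fst q) (snd q) - G (fst q) (s c)) \<longlongrightarrow> G t0 l0 - G t0 (s c)) ?F"
      proof (rule log_increment_tendsto[where f = "\<lambda>t l. l" and T = "cball 0 1" and G = G and \<tau> = fst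
            and \<nu> = snd and \<mu> = "\<lambda>_. s c", OF W])
        show "(t0, s c) \<in> W" using r(2)[of c t0] True c C(1) by auto
      qed (use t0 conn contG expG fs ev in \<open>auto intro!: continuous_intros simp: case_prod_beta\<close>)
      then show ?thesis
        using Npos[OF t0(1)] by (intro tendsto_mult tendsto_of_real tendsto_divide limw limN) auto
    next
      case False
      moreover have rc: "r c > 0" using r(1) c C(1) by auto
      ultimately have gt: "r c < dist c t0" by linarith
      have "((\<lambda>q. dist c (fst q)) \<longlongrightarrow> dist c t0) ?F" by (intro tendsto_intros fs)
      then have "\<forall>\<^sub>F q in ?F. r c < dist c (fst q)" using gt by (rule order_tendstoD)
      then have "\<forall>\<^sub>F q in ?F. of_real (w c t0 / N t0) * (G t0 l0 - G t0 (s c))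
          = of_real (w c (fst q) / N (fst q)) * (G (fst q) (snd q) - G (fst q) (s c))"
        by eventually_elim (use gt in \<open>simp add: w_def\<close>)
      then show ?thesis by (rule Lim_transform_eventually[OF tendsto_const])
    qed
    then have "((\<lambda>q. \<Psi> (fst q, snd q)) \<longlongrightarrow> \<Psi> (t0, l0)) ?F"
      unfolding \<Psi>_def case_prod_conv by (rule tendsto_sum)
    then show "(\<Psi> \<longlongrightarrow> \<Psi> p) ?F" by (simp add: tl)
  qed
  define e where "e = (\<lambda>t. G t (s t) - \<Psi> (t, s t))"
  have \<Psi>eq: "\<Psi> (t, l) = G t l - e t" if t: "cmod t \<le> 1" for t l
  proof -
    have "\<Psi> (t, l) - \<Psi> (t, s t) = (\<Sum>c\<in>C. of_real (w c t / N t) * (G t l - G t (s t)))"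
      unfolding \<Psi>_def case_prod_conv sum_subtractf[symmetric]
      by (intro sum.cong refl) (simp only: right_diff_distrib[symmetric], simp)
    also have "\<dots> = of_real (N t / N t) * (G t l - G t (s t))"
      unfolding sum_distrib_right[symmetric] of_real_sum[symmetric] sum_divide_distrib[symmetric] N_def ..
    also have "\<dots> = G t l - G t (s t)" using Npos[OF t] by simp
    finally show ?thesis by (simp add: e_def algebra_simps)
  qed
  \<comment> \<open>\<open>e\<close> itself may jump, but
    \<open>exp (e t) = l * exp (- \<Psi> (t, l))\<close> for any \<open>l\<close> in the slice, and
    one such \<open>l\<close> can be kept fixed near \<open>t0\<close>.\<close>
  have "continuous_on (cball 0 1) (\<lambda>t. exp (e t))"
    unfolding continuous_on_def
  proof
    fix t0 :: complex assume "t0 \<in> cball 0 1"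
    then have t0: "cmod t0 \<le> 1" by simp
    have "open ((\<lambda>t. (t, s t0)) -` W)" using W by (intro open_vimage continuous_intros) auto
    then have ev: "\<forall>\<^sub>F t in at t0 within cball 0 1. (t, s t0) \<in> W \<inter> cball 0 1 \<times> UNIV"
      using s[OF t0] eventually_nhds_in_open[of "(\<lambda>t. (t, s t0)) -` W" t0]
      by (auto simp: eventually_at_filter elim: eventually_mono)
    have "((\<lambda>t. \<Psi> (t, s t0)) \<longlongrightarrow> \<Psi> (t0, s t0)) (at t0 within cball 0 1)"
      by (rule continuous_on_tendsto_compose[OF cont\<Psi> _ _ ev])
         (use t0 s[OF t0] in \<open>auto intro!: tendsto_intros\<close>)
    then have "((\<lambda>t. s t0 * exp (- \<Psi> (t, s t0))) \<longlongrightarrow> s t0 * exp (- \<Psi> (t0, s t0))) (at t0 within cball 0 1)"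
      by (intro tendsto_intros)
    moreover have val: "s t0 * exp (- \<Psi> (t, s t0)) = exp (e t)" if "(t, s t0) \<in> W \<inter> cball 0 1 \<times> UNIV" for t
    proof -
      have "cmod t \<le> 1" "(t, s t0) \<in> W" using that by auto
      then show ?thesis
        using \<Psi>eq[of t "s t0"] expG[of t "s t0"] exp_not_eq_zero[of "G t (s t0)"]
        by (simp add: exp_diff exp_minus)
    qed
    ultimately show "((\<lambda>t. exp (e t)) \<longlongrightarrow> exp (e t0)) (at t0 within cball 0 1)"
      using val[of t0] s[OF t0] t0 ev
      by (auto elim!: Lim_transform_eventually eventually_mono)
  qed
  then obtain k where k: "continuous_on (cball 0 1) k" "\<And>t. cmod t \<le> 1 \<Longrightarrow> exp (e t) = exp (k t)"
    using continuous_logarithm_on_simply_connected[of "cball 0 1" "\<lambda>t. exp (e t)"]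
      convex_imp_simply_connected[of "cball (0::complex) 1"] convex_imp_locally_path_connected[of "cball (0::complex) 1"]
    by (metis convex_cball exp_not_eq_zero mem_cball_0)
  show thesis
  proof (rule that[of "\<lambda>p. \<Psi> p + k (fst p)"])
    show "continuous_on (W \<inter> cball 0 1 \<times> UNIV) (\<lambda>p. \<Psi> p + k (fst p))"
      by (intro continuous_intros cont\<Psi> continuous_on_compose2[OF k(1)]) auto
    fix t l assume t: "cmod t \<le> 1" "(t, l) \<in> W"
    show "exp (\<Psi> (t, l) + k (fst (t, l))) = l"
      using expG[OF t] k(2)[OF t(1)] by (simp add: \<Psi>eq[OF t(1)] exp_add exp_diff)
  qed
qed

subsection \<open>Supporting hyperplanes and linear images of C-convex domains\<close>

text \<open>Bilinear rather than Hermitian, hence holomorphic in \<open>w\<close> and symmetric: a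
  functional and its coefficient vector can exchange roles.\<close>

definition lf :: "complex ^ 'n \<Rightarrow> complex ^ 'n::finite \<Rightarrow> complex" where
  "lf a w = (\<Sum>i\<in>UNIV. a $ i * w $ i)"

lemma lf_simps [simp]:
  "lf a (v + w) = lf a v + lf a w" "lf a (v - w) = lf a v - lf a w" "lf a (c *s w) = c * lf a w" "lf a 0 = 0"
  by (simp_all add: lf_def algebra_simps sum.distrib sum_subtractf sum_distrib_left)

lemma lf_simps_left: "lf (c *s a) w = c * lf a w" "lf (a + b) w = lf a w + lf b w" "lf 0 w = 0"
  "lf (\<Sum>i\<in>I. f i) w = (\<Sum>i\<in>I. lf (f i) w)"
  by (simp_all add: lf_def algebra_simps sum.distrib sum_subtractf sum_distrib_left sum_distrib_right sum.swap[of _ _ I])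

lemma matrix_vector_mult_nth_lf: "(A *v w) $ i = lf (A $ i) w"
  by (simp add: matrix_vector_mult_def lf_def)

lemma continuous_on_lf [continuous_intros]:
  "continuous_on S f \<Longrightarrow> continuous_on S (\<lambda>x. lf a (f x))"
  unfolding lf_def by (intro continuous_intros)

lemma continuous_on_smult_vec [continuous_intros]:
  fixes f :: "'b::topological_space \<Rightarrow> complex ^ 'n"
  shows "continuous_on S c \<Longrightarrow> continuous_on S f \<Longrightarrow> continuous_on S (\<lambda>x. c x *s f x)"
  unfolding vector_scalar_mult_def by (intro continuous_intros)

text \<open>A linear map kills a basis of \<open>M\<close> and sends \<open>u\<close> to the vector
  of ones; any row of its matrix is such a functional.\<close>

lemma exists_functional_vanishing_on_subspace:
  fixes M :: "(complex ^ 'n) set"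
  assumes M: "vec.subspace M" and u: "u \<notin> M"
  obtains a where "\<And>m. m \<in> M \<Longrightarrow> lf a m = 0" "lf a u = 1"
proof -
  obtain B where B: "B \<subseteq> M" "vec.independent B" "M \<subseteq> vec.span B"
    using vec.maximal_independent_subset by blast
  have sM: "vec.span B = M" using B M by (metis vec.span_minimal subset_antisym)
  then have uB: "u \<notin> vec.span B" using u by simp
  then have ind: "vec.independent (insert u B)" using B(2) by (simp add: vec.independent_insert vec.span_base)
  obtain g :: "complex ^ 'n \<Rightarrow> complex ^ 'n" where g: "Vector_Spaces.linear (*s) (*s) g"
    "\<And>x. x \<in> insert u B \<Longrightarrow> g x = (if x = u then (\<chi> i. 1) else 0)"
    using vec.linear_independent_extend[OF ind, of "\<lambda>x. if x = u then (\<chi> i. 1) else 0"] by blast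
  define k where "k = (undefined :: 'n)"
  have gk: "g w $ k = lf (matrix g $ k) w" for w
    using matrix_works[OF g(1), of w] matrix_vector_mult_nth_lf[of "matrix g" w k] by simp
  show thesis
  proof
    show "lf (matrix g $ k) u = 1" using g(2)[of u] gk[of u] by simp
    fix m assume "m \<in> M"
    then have "m \<in> vec.span B" using sM by simp
    then show "lf (matrix g $ k) m = 0"
    proof (induction rule: vec.span_induct_alt)
      case (step c x y)
      have "x \<noteq> u" using step(1) u B(1) by auto
      then have "lf (matrix g $ k) x = 0" using g(2)[of x] step(1) gk[of x] by simp
      then show ?case using step by simp
    qed simp
  qed
qed

lemma simply_connected_affine_slice:
  assumes D: "C_convex_domain D"
  shows "simply_connected {l. a + l *s X \<in> D}" "open {l. a + l *s X \<in> D}"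
proof -
  have opD: "open D" using D by (simp add: C_convex_domain_def domain_Cn_def)
  have "open ((\<lambda>l. a + l *s X) -` D)"
    by (intro open_vimage opD continuous_intros)
  then show "open {l. a + l *s X \<in> D}" by (simp add: vimage_def)
  show "simply_connected {l. a + l *s X \<in> D}"
  proof (cases "X = 0")
    case True
    then have "{l. a + l *s X \<in> D} = {} \<or> {l. a + l *s X \<in> D} = UNIV" by auto
    then show ?thesis by (auto simp: convex_imp_simply_connected)
  next
    case False
    then obtain i where i: "X $ i \<noteq> 0" by (auto simp: vec_eq_iff)
    define L where "L = range (\<lambda>l. a + l *s X)"
    have L: "complex_line L" using False by (auto simp: complex_line_def L_def)
    have sc: "simply_connected (D \<inter> L)"
    proof (cases "D \<inter> L = {}")
      case False
      then show ?thesis using D L by (auto simp: C_convex_domain_def)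
    qed simp
    have "D \<inter> L homeomorphic {l. a + l *s X \<in> D}"
      unfolding homeomorphic_def homeomorphism_def
    proof (intro exI conjI ballI)
      show "continuous_on (D \<inter> L) (\<lambda>w. (w $ i - a $ i) / X $ i)" using i by (intro continuous_intros) auto
      show "continuous_on {l. a + l *s X \<in> D} (\<lambda>l. a + l *s X)" by (intro continuous_intros)
      show "(\<lambda>w. (w $ i - a $ i) / X $ i) ` (D \<inter> L) = {l. a + l *s X \<in> D}"
        using i by (auto simp: L_def image_iff intro!: bexI[of _ "a + l *s X" for l])
      show "(\<lambda>l. a + l *s X) ` {l. a + l *s X \<in> D} = D \<inter> L" by (auto simp: L_def)
    qed (use i in \<open>auto simp: L_def\<close>)
    then show ?thesis using sc homeomorphic_simply_connected by blast
  qed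
qed

text \<open>The winding number is the increment of a logarithm along the path, and a logarithm
  defined on the path image returns to its initial value.\<close>

lemma winding_number_zero_if_log:
  assumes p: "path p" "pathfinish p = pathstart p" and g: "continuous_on (path_image p) g"
    and exp: "\<And>z. z \<in> path_image p \<Longrightarrow> exp (g z) = z - \<zeta>"
  shows "winding_number p \<zeta> = 0"
proof -
  have "\<zeta> \<notin> path_image p" using exp[of \<zeta>] by auto
  then obtain q where q: "path q" "pathfinish q - pathstart q = 2 * of_real pi * \<i> * winding_number p \<zeta>"
    "\<And>t. t \<in> {0..1} \<Longrightarrow> p t = \<zeta> + exp (q t)"
    using winding_number_as_continuous_log[OF p(1)] by metis
  have "q 0 - g (p 0) = q 1 - g (p 1)"
  proof (rule continuous_log_unique_on_connected[of "{0..1::real}" q "\<lambda>t. g (p t)"])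
    show "continuous_on {0..1} q" using q(1) by (simp add: path_def)
    show "continuous_on {0..1} (\<lambda>t. g (p t))"
      using p(1) by (intro continuous_on_compose2[OF g]) (auto simp: path_def path_image_def)
    fix t :: real assume t: "t \<in> {0..1}"
    then have "p t \<in> path_image p" by (auto simp: path_image_def)
    then show "exp (q t) = exp (g (p t))" using exp q(3)[OF t] by simp
  qed auto
  then show ?thesis using q(2) p(2) by (simp add: pathfinish_def pathstart_def)
qed

text \<open>A continuous logarithm of an affine functional without zeros exists on the section: it is built
  along the slices through one point. It is constant on the fibres of the functional, which are
  again sections of \<open>D\<close>, hence descends to the image.\<close>

lemma projection_simply_connected:
  fixes D :: "(complex ^ 'n::finite) set"
  assumes D: "C_convex_domain D" and M: "vec.subspace M" and w: "w \<notin> M"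
  shows "open {l. \<exists>m\<in>M. p + m + l *s w \<in> D}" (is "open ?\<Omega>")
    and "simply_connected {l. \<exists>m\<in>M. p + m + l *s w \<in> D}"
proof -
  have opD: "open D" using D by (simp add: C_convex_domain_def domain_Cn_def)
  have "?\<Omega> = (\<Union>m\<in>M. {l. (p + m) + l *s w \<in> D})" by auto
  moreover have "open (\<Union>m\<in>M. {l. (p + m) + l *s w \<in> D})"
    using simply_connected_affine_slice(2)[OF D] by blast
  ultimately show op: "open ?\<Omega>" by simp
  obtain a where a: "\<And>m. m \<in> M \<Longrightarrow> lf a m = 0" "lf a w = 1"
    using exists_functional_vanishing_on_subspace[OF M w] by blast
  \<comment> \<open>\<open>F\<close> is the span of \<open>M\<close> and \<open>w\<close>,
    \<open>E\<close> the section of \<open>D\<close> by \<open>p + F\<close>, and \<open>c\<close>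
    the \<open>w\<close>-coordinate along \<open>M\<close>; so \<open>?\<Omega>\<close> is the image
    of \<open>E\<close> under \<open>c\<close>.\<close>
  define F where "F = {v. v - lf a v *s w \<in> M}"
  define E where "E = {x \<in> D. x - p \<in> F}"
  define c where "c = (\<lambda>x. lf a (x - p))"
  have F_add: "u + v \<in> F" if "u \<in> F" "v \<in> F" for u v
    using vec.subspace_add[OF M, of "u - lf a u *s w" "v - lf a v *s w"] that
    by (simp add: F_def algebra_simps vec.scale_left_distrib)
  have F_scale: "k *s v \<in> F" if "v \<in> F" for k v
    using vec.subspace_scale[OF M, of "v - lf a v *s w" k] that
    by (simp add: F_def vec.scale_right_diff_distrib)
  have F_diff: "u - v \<in> F" if "u \<in> F" "v \<in> F" for u v
    using F_add[OF that(1) F_scale[OF that(2), of "-1"]] by simp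
  have wF: "w \<in> F" using a(2) M by (simp add: F_def vec.subspace_0)
  have MF: "m \<in> F" if "m \<in> M" for m using a(1) that by (simp add: F_def)
  have cE: "c x \<in> ?\<Omega>" if "x \<in> E" for x
  proof -
    have "p + (x - p - lf a (x - p) *s w) + c x *s w = x" by (simp add: c_def)
    moreover have "x - p - lf a (x - p) *s w \<in> M" "x \<in> D" using that by (auto simp: E_def F_def)
    ultimately have "\<exists>m\<in>M. p + m + c x *s w \<in> D" by (metis (no_types, lifting))
    then show ?thesis by simp
  qed
  have \<Omega>E: "\<exists>x\<in>E. c x = l" if l: "l \<in> ?\<Omega>" for l
  proof -
    obtain m where m: "m \<in> M" "p + m + l *s w \<in> D" using l by auto
    then have "p + m + l *s w \<in> E" using F_add[OF MF F_scale[OF wF]] by (simp add: E_def add.assoc)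
    moreover have "c (p + m + l *s w) = l" using a m by (simp add: c_def add.assoc)
    ultimately show ?thesis by blast
  qed
  have slice: "x + l *s (y - x) \<in> E" if "x \<in> E" "y \<in> E" "x + l *s (y - x) \<in> D" for x y l
  proof -
    have "(y - p) - (x - p) \<in> F" using that by (intro F_diff[of "y - p" "x - p"]) (simp_all add: E_def)
    then have "y - x \<in> F" by simp
    moreover have "x - p \<in> F" using that by (simp add: E_def)
    ultimately have "(x - p) + l *s (y - x) \<in> F" by (intro F_add F_scale)
    moreover have "x + l *s (y - x) - p = (x - p) + l *s (y - x)" by simp
    ultimately show ?thesis using that(3) by (simp only: E_def mem_Collect_eq)
  qed
  show "simply_connected ?\<Omega>"
  proof (cases "?\<Omega> = {}")
    case True
    then show ?thesis by simp
  next
    case False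
    then obtain x0 where x0: "x0 \<in> E" using \<Omega>E by blast
    have conn: "connected ?\<Omega>"
      unfolding connected_iff_connected_component
    proof (intro ballI)
      fix s t assume "s \<in> ?\<Omega>" "t \<in> ?\<Omega>"
      then obtain x y where xy: "x \<in> E" "c x = s" "y \<in> E" "c y = t" using \<Omega>E by meson
      let ?S = "{l. x + l *s (y - x) \<in> D}"
      have "connected ((\<lambda>l. c (x + l *s (y - x))) ` ?S)"
        unfolding c_def using simply_connected_imp_connected[OF simply_connected_affine_slice(1)[OF D]]
        by (intro connected_continuous_image continuous_intros)
      moreover have "(\<lambda>l. c (x + l *s (y - x))) ` ?S \<subseteq> ?\<Omega>"
        using slice[OF xy(1,3)] cE by blast
      moreover have "s \<in> (\<lambda>l. c (x + l *s (y - x))) ` ?S"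
        by (rule image_eqI[of _ _ 0]) (use xy in \<open>auto simp: E_def\<close>)
      moreover have "t \<in> (\<lambda>l. c (x + l *s (y - x))) ` ?S"
        by (rule image_eqI[of _ _ 1]) (use xy in \<open>auto simp: E_def\<close>)
      ultimately show "connected_component ?\<Omega> s t" by (auto simp: connected_component_def)
    qed
    have log: "\<exists>g. continuous_on ?\<Omega> g \<and> (\<forall>l\<in>?\<Omega>. exp (g l) = l - q)" if q: "q \<notin> ?\<Omega>" for q
    proof -
      define W where "W = {(X, l). x0 + l *s X \<in> D}"
      define f where "f = (\<lambda>X l. c x0 + l * lf a X - q)"
      have opW: "open W"
      proof -
        have "W = (\<lambda>z. x0 + snd z *s fst z) -` D" by (auto simp: W_def)
        then show ?thesis by (simp, intro open_vimage opD continuous_intros)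
      qed
      have fnz: "f X l \<noteq> 0" if "X \<in> F" "x0 + l *s X \<in> D" for X l
      proof -
        have "x0 - p \<in> F" using x0 by (simp add: E_def)
        then have "x0 - p + l *s X \<in> F" using that by (intro F_add F_scale)
        moreover have "x0 + l *s X - p = x0 - p + l *s X" by simp
        ultimately have "x0 + l *s X \<in> E" using that by (simp only: E_def mem_Collect_eq)
        then have "c (x0 + l *s X) \<in> ?\<Omega>" by (rule cE)
        then have "c (x0 + l *s X) \<noteq> q" using q by blast
        moreover have "c (x0 + l *s X) = c x0 + l * lf a X" by (simp add: c_def)
        ultimately show ?thesis by (simp add: f_def)
      qed
      have "\<exists>g. continuous_on {l. x0 + l *s X \<in> D} g \<and> (\<forall>l\<in>{l. x0 + l *s X \<in> D}. exp (g l) = f X l)"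
        if "X \<in> F" for X
        using fnz[OF that]
        by (intro exists_continuous_log_on_slice simply_connected_affine_slice[OF D])
           (auto simp: f_def intro!: continuous_intros)
      then obtain G where G: "\<And>X. X \<in> F \<Longrightarrow> continuous_on {l. x0 + l *s X \<in> D} (G X)"
        "\<And>X l. X \<in> F \<Longrightarrow> x0 + l *s X \<in> D \<Longrightarrow> exp (G X l) = f X l"
        by (metis mem_Collect_eq)
      \<comment> \<open>The increment from \<open>x0\<close> to \<open>x\<close> along the complex
        line through both: each branch \<open>G X\<close> is an arbitrary choice, its increments are
        not.\<close>
      define g where "g = (\<lambda>x. G (x - x0) 1 - G (x - x0) 0 + Ln (c x0 - q))"
      have XF: "x - x0 \<in> F" if "x \<in> E" for x
        using F_diff[of "x - p" "x0 - p"] that x0 by (simp add: E_def)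
      have cq: "c x - q \<noteq> 0" if "x \<in> E" for x
      proof -
        have "c x \<noteq> q" using cE[OF that] q by blast
        then show ?thesis by simp
      qed
      note x0q = cq[OF x0]
      have expg: "exp (g x) = c x - q" if x: "x \<in> E" for x
      proof -
        have "exp (G (x - x0) 1) = c x - q" "exp (G (x - x0) 0) = c x0 - q"
          using G(2)[OF XF[OF x], of 1] G(2)[OF XF[OF x], of 0] x x0 by (auto simp: E_def f_def c_def)
        then show ?thesis using x0q by (simp add: g_def exp_add exp_diff)
      qed
      have contg: "continuous_on E g"
        unfolding continuous_on_def
      proof
        fix x assume x: "x \<in> E"
        have "((\<lambda>y. G (y - x0) 1 - G (y - x0) 0) \<longlongrightarrow> G (x - x0) 1 - G (x - x0) 0) (at x within E)"
        proof (rule log_increment_tendsto[where W = W and T = F and f = f and G = G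
              and \<tau> = "\<lambda>y. y - x0" and \<nu> = "\<lambda>_. 1" and \<mu> = "\<lambda>_. 0"])
          show "open W" by (rule opW)
          show "x - x0 \<in> F" by (rule XF[OF x])
          show "continuous_on (W \<inter> F \<times> UNIV) (\<lambda>(X, l). f X l)"
            unfolding f_def case_prod_beta by (intro continuous_intros)
          show "connected {l. (x - x0, l) \<in> W}"
            using simply_connected_imp_connected[OF simply_connected_affine_slice(1)[OF D, of x0 "x - x0"]]
            by (simp add: W_def)
          show "((\<lambda>y. y - x0) \<longlongrightarrow> x - x0) (at x within E)" by (intro tendsto_intros)
          show "\<forall>\<^sub>F y in at x within E. y - x0 \<in> F" using XF by (auto simp: eventually_at_filter)
        qed (use G x x0 in \<open>auto simp: W_def E_def\<close>)
        then show "(g \<longlongrightarrow> g x) (at x within E)" unfolding g_def by (rule tendsto_add[OF _ tendsto_const])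
      qed
      \<comment> \<open>The functional \<open>c\<close> is constant on the line through
        \<open>x\<close> and \<open>y\<close>, so on this connected slice \<open>g\<close> is a
        logarithm of a constant.\<close>
      have fibre: "g x = g y" if xy: "x \<in> E" "y \<in> E" "c x = c y" for x y
      proof -
        let ?S = "{l. x + l *s (y - x) \<in> D}"
        have cc: "c (x + l *s (y - x)) = c x" for l
          using xy(3) by (simp add: c_def)
        have "g (x + 0 *s (y - x)) - Ln (c x - q) = g (x + 1 *s (y - x)) - Ln (c x - q)"
        proof (rule continuous_log_unique_on_connected[of ?S "\<lambda>l. g (x + l *s (y - x))" "\<lambda>l. Ln (c x - q)"])
          show "connected ?S" using simply_connected_imp_connected[OF simply_connected_affine_slice(1)[OF D]] .
          show "continuous_on ?S (\<lambda>l. g (x + l *s (y - x)))"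
            using slice[OF xy(1,2)] by (intro continuous_on_compose2[OF contg] continuous_intros) auto
          fix l assume "l \<in> ?S"
          then have "x + l *s (y - x) \<in> E" using slice[OF xy(1,2)] by simp
          then have "exp (g (x + l *s (y - x))) = c x - q" by (simp only: expg cc)
          then show "exp (g (x + l *s (y - x))) = exp (Ln (c x - q))"
            using exp_Ln[OF cq[OF xy(1)]] by (simp only:)
        qed (use xy(1,2) in \<open>simp_all add: E_def\<close>)
        moreover have "x + 0 *s (y - x) = x" "x + 1 *s (y - x) = y" by simp_all
        ultimately have "g x - Ln (c x - q) = g y - Ln (c x - q)" by (simp only:)
        then show ?thesis by (metis diff_add_cancel)
      qed
      define s where "s = (\<lambda>l. SOME x. x \<in> E \<and> c x = l)"
      have s: "s l \<in> E \<and> c (s l) = l" if "l \<in> ?\<Omega>" for l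
      proof -
        have "\<exists>x. x \<in> E \<and> c x = l" using \<Omega>E[OF that] by (simp only: Bex_def)
        then show ?thesis unfolding s_def by (rule someI_ex[where P = "\<lambda>x. x \<in> E \<and> c x = l"])
      qed
      show ?thesis
      proof (intro exI[of _ "\<lambda>l. g (s l)"] conjI ballI)
        show "exp (g (s l)) = l - q" if "l \<in> ?\<Omega>" for l using s[OF that] expg by simp
        show "continuous_on ?\<Omega> (\<lambda>l. g (s l))"
          unfolding continuous_on_def
        proof
          fix l0 assume l0: "l0 \<in> ?\<Omega>"
          \<comment> \<open>\<open>s\<close> is chosen without regard to continuity. Moving from
            \<open>s l0\<close> in the direction \<open>w\<close> gives a continuous local section,
            and \<open>fibre\<close> makes \<open>g\<close> agree on the two.\<close>
          let ?y = "\<lambda>l. s l0 + (l - l0) *s w"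
          have yE: "?y l \<in> E" if "?y l \<in> D" for l
          proof -
            have "s l0 - p \<in> F" using s[OF l0] by (simp add: E_def)
            then have "(s l0 - p) + (l - l0) *s w \<in> F" using wF by (intro F_add F_scale)
            moreover have "?y l - p = (s l0 - p) + (l - l0) *s w" by simp
            ultimately show ?thesis using that by (simp only: E_def mem_Collect_eq)
          qed
          have cy: "c (?y l) = l" for l using s[OF l0] a(2) by (simp add: c_def algebra_simps)
          have "open (?y -` D)" by (intro open_vimage opD continuous_intros)
          moreover have "l0 \<in> ?y -` D" using s[OF l0] by (simp add: E_def)
          ultimately have ev: "\<forall>\<^sub>F l in at l0 within ?\<Omega>. ?y l \<in> E"
            using eventually_nhds_in_open[of "?y -` D" l0] yE
            by (auto simp: eventually_at_filter elim!: eventually_mono)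
          have "((\<lambda>l. g (?y l)) \<longlongrightarrow> g (?y l0)) (at l0 within ?\<Omega>)"
          proof (rule continuous_on_tendsto_compose[OF contg _ _ ev])
            show "?y l0 \<in> E" using s[OF l0] by simp
            have "continuous_on UNIV ?y" by (intro continuous_intros)
            then have "(?y \<longlongrightarrow> ?y l0) (at l0 within UNIV)" unfolding continuous_on_def by blast
            then show "(?y \<longlongrightarrow> ?y l0) (at l0 within ?\<Omega>)" by (rule tendsto_within_subset) simp
          qed
          moreover have "\<forall>\<^sub>F l in at l0 within ?\<Omega>. g (?y l) = g (s l)"
          proof -
            have "\<forall>\<^sub>F l in at l0 within ?\<Omega>. l \<in> ?\<Omega>" by (simp add: eventually_at_filter)
            with ev show ?thesis
            proof eventually_elim
              case (elim l)
              then show ?case using fibre[of "?y l" "s l"] s[of l] cy[of l] by simp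
            qed
          qed
          ultimately show "((\<lambda>l. g (s l)) \<longlongrightarrow> g (s l0)) (at l0 within ?\<Omega>)"
            by (simp add: Lim_transform_eventually)
        qed
      qed
    qed
    show ?thesis
      unfolding simply_connected_eq_winding_number_zero[OF op]
    proof (intro conjI allI impI conn)
      fix \<gamma> q assume \<gamma>: "path \<gamma> \<and> path_image \<gamma> \<subseteq> ?\<Omega> \<and> pathfinish \<gamma> = pathstart \<gamma> \<and> q \<notin> ?\<Omega>"
      then obtain g where g: "continuous_on ?\<Omega> g" "\<forall>l\<in>?\<Omega>. exp (g l) = l - q" using log[of q] by blast
      show "winding_number \<gamma> q = 0"
      proof (rule winding_number_zero_if_log[of _ g])
        show "continuous_on (path_image \<gamma>) g" using \<gamma> continuous_on_subset[OF g(1)] by blast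
        show "exp (g z) = z - q" if "z \<in> path_image \<gamma>" for z using that \<gamma> g(2) by blast
      qed (use \<gamma> in blast)+
    qed
  qed
qed

text \<open>Otherwise the tautological bundle over the projective line would have a nowhere vanishing section:
  the first coordinate has a logarithm over one hemisphere, the second one over the other, and
  their difference is a logarithm of \<open>t\<close> on the unit circle.\<close>

lemma some_line_through_0_misses:
  fixes E :: "(complex \<times> complex) set"
  assumes E: "open E" "(0, 0) \<notin> E"
    and sc: "\<And>\<alpha> \<beta>. (\<alpha>, \<beta>) \<noteq> (0, 0) \<Longrightarrow> simply_connected {l. (l * \<alpha>, l * \<beta>) \<in> E}"
    and ne: "\<And>\<alpha> \<beta>. (\<alpha>, \<beta>) \<noteq> (0, 0) \<Longrightarrow> \<exists>l. (l * \<alpha>, l * \<beta>) \<in> E"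
  shows False
proof -
  \<comment> \<open>Charts for the directions \<open>(1, t)\<close> and \<open>(t, 1)\<close>. Over
    the closed unit discs they cover all directions and overlap where \<open>|t| = 1\<close>. In
    both, \<open>l\<close> is a coordinate of the point, nonzero because \<open>(0, 0)\<close> is
    not in \<open>E\<close>.\<close>
  define W where "W = {(t, l). (l, l * t) \<in> E}"
  define W' where "W' = {(t, l). (l * t, l) \<in> E}"
  have opW: "open W"
  proof -
    have "W = (\<lambda>z. (snd z, snd z * fst z)) -` E" by (auto simp: W_def)
    then show ?thesis by (simp, intro open_vimage E(1) continuous_intros)
  qed
  have opW': "open W'"
  proof -
    have "W' = (\<lambda>z. (snd z * fst z, snd z)) -` E" by (auto simp: W'_def)
    then show ?thesis by (simp, intro open_vimage E(1) continuous_intros)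
  qed
  have scW: "simply_connected {l. (t, l) \<in> W}" for t using sc[of 1 t] by (simp add: W_def)
  obtain \<psi> where \<psi>: "continuous_on (W \<inter> cball 0 1 \<times> UNIV) \<psi>"
    "\<And>t l. cmod t \<le> 1 \<Longrightarrow> (t, l) \<in> W \<Longrightarrow> exp (\<psi> (t, l)) = l"
  proof (rule continuous_log_over_disc[OF opW])
    show "simply_connected {l. (t, l) \<in> W}" for t by (rule scW)
    show "\<exists>l. (t, l) \<in> W" for t using ne[of 1 t] by (simp add: W_def)
    show "(t, 0) \<notin> W" for t using E(2) by (simp add: W_def)
  qed blast
  obtain \<psi>' where \<psi>': "continuous_on (W' \<inter> cball 0 1 \<times> UNIV) \<psi>'"
    "\<And>t l. cmod t \<le> 1 \<Longrightarrow> (t, l) \<in> W' \<Longrightarrow> exp (\<psi>' (t, l)) = l"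
  proof (rule continuous_log_over_disc[OF opW'])
    show "simply_connected {l. (t, l) \<in> W'}" for t using sc[of t 1] by (simp add: W'_def)
    show "\<exists>l. (t, l) \<in> W'" for t using ne[of t 1] by (simp add: W'_def)
    show "(t, 0) \<notin> W'" for t using E(2) by (simp add: W'_def)
  qed blast
  \<comment> \<open>\<open>(l, l * t)\<close> has parameters \<open>(1 / t, l * t)\<close> in the
    other chart, so this is a logarithm of \<open>l * t / l\<close>.\<close>
  define h where "h = (\<lambda>(t, l). \<psi>' (1 / t, l * t) - \<psi> (t, l))"
  let ?K = "W \<inter> sphere 0 1 \<times> UNIV"
  have W': "(1 / t, l * t) \<in> W'" if "(t, l) \<in> W" "cmod t = 1" for t l
    using that by (auto simp: W_def W'_def)
  have conth: "continuous_on ?K h"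
    unfolding h_def case_prod_beta
  proof (intro continuous_on_diff)
    show "continuous_on ?K (\<lambda>z. \<psi> (fst z, snd z))"
      by (simp, rule continuous_on_subset[OF \<psi>(1)]) auto
    show "continuous_on ?K (\<lambda>z. \<psi>' (1 / fst z, snd z * fst z))"
      using W' by (intro continuous_on_compose2[OF \<psi>'(1)] continuous_intros) (auto simp: norm_divide)
  qed
  have exph: "exp (h (t, l)) = t" if "(t, l) \<in> W" "cmod t = 1" for t l
  proof -
    have "exp (\<psi>' (1 / t, l * t)) = l * t" using W'[OF that] that by (intro \<psi>'(2)) (auto simp: norm_divide)
    moreover have "exp (\<psi> (t, l)) = l" using that by (intro \<psi>(2)) auto
    ultimately show ?thesis using exp_not_eq_zero[of "\<psi> (t, l)"] by (simp add: h_def exp_diff)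
  qed
  have fibre: "h (t, l) = h (t, l')" if t: "cmod t = 1" and l: "(t, l) \<in> W" "(t, l') \<in> W" for t l l'
  proof -
    have "h (t, l) - Ln t = h (t, l') - Ln t"
    proof (rule continuous_log_unique_on_connected[of "{l. (t, l) \<in> W}" "\<lambda>l. h (t, l)" "\<lambda>_. Ln t"])
      show "connected {l. (t, l) \<in> W}" by (rule simply_connected_imp_connected[OF scW])
      show "continuous_on {l. (t, l) \<in> W} (\<lambda>l. h (t, l))"
        using t by (intro continuous_on_compose2[OF conth] continuous_intros) auto
      fix l assume "l \<in> {l. (t, l) \<in> W}"
      moreover have "t \<noteq> 0" using t by auto
      ultimately show "exp (h (t, l)) = exp (Ln t)" using exph[of t l] t by simp
    qed (use l in auto)
    then show ?thesis by simp
  qed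
  obtain s where s: "\<And>t. (t, s t) \<in> W" using ne[of 1] by (simp add: W_def) metis
  have contH: "continuous_on (sphere 0 1) (\<lambda>t. h (t, s t))"
    unfolding continuous_on_def
  proof
    fix t0 :: complex assume t0: "t0 \<in> sphere 0 1"
    have "open ((\<lambda>t. (t, s t0)) -` W)" by (intro open_vimage opW continuous_intros)
    then have ev: "\<forall>\<^sub>F t in at t0 within sphere 0 1. (t, s t0) \<in> ?K"
      using s[of t0] eventually_nhds_in_open[of "(\<lambda>t. (t, s t0)) -` W" t0]
      by (auto simp: eventually_at_filter elim: eventually_mono)
    have "((\<lambda>t. h (t, s t0)) \<longlongrightarrow> h (t0, s t0)) (at t0 within sphere 0 1)"
      by (rule continuous_on_tendsto_compose[OF conth _ _ ev])
         (use t0 s in \<open>auto intro!: tendsto_intros\<close>)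
    moreover have "\<forall>\<^sub>F t in at t0 within sphere 0 1. h (t, s t0) = h (t, s t)"
      using ev by eventually_elim (use fibre s in auto)
    ultimately show "((\<lambda>t. h (t, s t)) \<longlongrightarrow> h (t0, s t0)) (at t0 within sphere 0 1)"
      by (rule Lim_transform_eventually)
  qed
  have "winding_number (circlepath 0 1) 0 = 0"
    by (rule winding_number_zero_if_log[where g = "\<lambda>t. h (t, s t)"])
       (use contH exph s in auto)
  then show False using winding_number_circlepath_centre[of 1 0] by simp
qed

text \<open>A subspace \<open>M\<close> of largest dimension with \<open>p + M\<close> disjoint from
  \<open>D\<close> must have codimension one. Otherwise there are \<open>u\<close>, \<open>v\<close>
  independent modulo \<open>M\<close>; projecting the section of \<open>D\<close> by
  \<open>p + span(M, u, v)\<close> along \<open>M\<close> gives an open set \<open>E\<close> in two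
  dimensions that omits the origin but, by maximality, meets every complex line through it, in
  simply connected sets. This is impossible by \<open>some_line_through_0_misses\<close>.\<close>

lemma exists_hyperplane_missing:
  fixes D :: "(complex ^ 'n::finite) set"
  assumes D: "C_convex_domain D" and p: "p \<notin> D"
  obtains a where "\<And>w. w \<in> D \<Longrightarrow> lf a (w - p) \<noteq> 0"
proof -
  have opD: "open D" and neD: "D \<noteq> {}" using D by (auto simp: C_convex_domain_def domain_Cn_def)
  define P where "P = (\<lambda>M. vec.subspace M \<and> (\<forall>m\<in>M. p + m \<notin> D))"
  have "P {0}" using p by (simp add: P_def)
  moreover have "vec.dim M \<le> CARD('n)" for M :: "(complex ^ 'n) set"
    using vec.dim_subset_UNIV[of M] by (simp add: vec.dimension_def card_cart_basis)
  ultimately obtain M where M: "P M" "\<And>M'. P M' \<Longrightarrow> vec.dim M' \<le> vec.dim M"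
    using ex_has_greatest_nat[of P "{0}" vec.dim "CARD('n) + 1"] by (metis less_Suc_eq_le Suc_eq_plus1)
  have subM: "vec.subspace M" and missM: "\<And>m. m \<in> M \<Longrightarrow> p + m \<notin> D" using M(1) by (auto simp: P_def)
  have spanM: "vec.span M = M" using subM by (simp add: vec.span_eq_iff)
  have hit: "\<exists>m\<in>M. \<exists>l. p + m + l *s w \<in> D" if w: "w \<notin> M" for w
  proof (rule ccontr)
    assume no: "\<not> ?thesis"
    have "P (vec.span (insert w M))"
      unfolding P_def
    proof (intro conjI ballI vec.subspace_span)
      fix x assume "x \<in> vec.span (insert w M)"
      then obtain k where "x - k *s w \<in> M" using spanM by (auto simp: vec.span_breakdown_eq)
      then have "p + (x - k *s w) + k *s w \<notin> D" using no by blast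
      then show "p + x \<notin> D" by simp
    qed
    then have "vec.dim (vec.span (insert w M)) \<le> vec.dim M" by (rule M(2))
    then show False using w spanM by (simp add: vec.dim_insert)
  qed
  obtain w0 where w0: "w0 \<in> D" using neD by blast
  define u where "u = w0 - p"
  have u: "u \<notin> M" using missM[of u] w0 by (auto simp: u_def)
  have all: "v \<in> vec.span (insert u M)" for v
  proof (rule ccontr)
    assume v: "v \<notin> vec.span (insert u M)"
    define E where "E = {(x, y). \<exists>m\<in>M. p + m + (x *s u + y *s v) \<in> D}"
    have nM: "\<alpha> *s u + \<beta> *s v \<notin> M" if "(\<alpha>, \<beta>) \<noteq> (0, 0)" for \<alpha> \<beta>
    proof
      assume in1: "\<alpha> *s u + \<beta> *s v \<in> M"
      have "\<beta> = 0"
      proof (rule ccontr)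
        assume "\<beta> \<noteq> 0"
        have "\<beta> *s v - (- \<alpha>) *s u = \<alpha> *s u + \<beta> *s v" by simp
        with in1 have "\<beta> *s v - (- \<alpha>) *s u \<in> vec.span M" unfolding spanM by (simp only:)
        then have "\<beta> *s v \<in> vec.span (insert u M)" by (auto simp only: vec.span_breakdown_eq)
        then have "inverse \<beta> *s (\<beta> *s v) \<in> vec.span (insert u M)" by (rule vec.span_scale)
        then show False using v \<open>\<beta> \<noteq> 0\<close> by simp
      qed
      then have "\<alpha> \<noteq> 0" "\<alpha> *s u \<in> M" using in1 that by auto
      then have "inverse \<alpha> *s (\<alpha> *s u) \<in> M" using vec.subspace_scale[OF subM] by blast
      then show False using u \<open>\<alpha> \<noteq> 0\<close> by simp
    qed
    have eq: "(l * \<alpha>, l * \<beta>) \<in> E \<longleftrightarrow> (\<exists>m\<in>M. p + m + l *s (\<alpha> *s u + \<beta> *s v) \<in> D)" for l \<alpha> \<beta>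
      by (simp add: E_def vec.scale_right_distrib)
    show False
    proof (rule some_line_through_0_misses[of E])
      have "E = (\<Union>m\<in>M. (\<lambda>z. p + m + (fst z *s u + snd z *s v)) -` D)" by (auto simp: E_def)
      then show "open E" by (simp, intro open_UN ballI open_vimage opD continuous_intros)
      show "(0, 0) \<notin> E" using missM by (simp add: E_def)
      fix \<alpha> \<beta> :: complex assume "(\<alpha>, \<beta>) \<noteq> (0, 0)"
      then have n: "\<alpha> *s u + \<beta> *s v \<notin> M" by (rule nM)
      show "simply_connected {l. (l * \<alpha>, l * \<beta>) \<in> E}"
        unfolding eq by (rule projection_simply_connected(2)[OF D subM n])
      show "\<exists>l. (l * \<alpha>, l * \<beta>) \<in> E" unfolding eq using hit[OF n] by blast
    qed
  qed
  obtain a where a: "\<And>m. m \<in> M \<Longrightarrow> lf a m = 0" "lf a u = 1"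
    using exists_functional_vanishing_on_subspace[OF subM u] by blast
  show thesis
  proof
    fix w assume w: "w \<in> D"
    obtain k where k: "(w - p) - k *s u \<in> M" using all[of "w - p"] spanM by (auto simp: vec.span_breakdown_eq)
    show "lf a (w - p) \<noteq> 0"
    proof
      assume "lf a (w - p) = 0"
      moreover have "lf a (w - p) = k" using a(1)[OF k] a(2) by simp
      ultimately have "w - p \<in> M" using k by simp
      then show False using missM[of "w - p"] w by simp
    qed
  qed
qed

text \<open>This is the projection along the kernel of \<open>a\<close>, in the direction of a
  vector on which \<open>a\<close> equals 1.\<close>

lemma functional_image_simply_connected:
  fixes D :: "(complex ^ 'n::finite) set"
  assumes D: "C_convex_domain D" and a: "a \<noteq> 0"
  shows "open ((\<lambda>w. lf a (w - z)) ` D)" "simply_connected ((\<lambda>w. lf a (w - z)) ` D)"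
proof -
  obtain i where i: "a $ i \<noteq> 0" using a by (auto simp: vec_eq_iff)
  define u :: "complex ^ 'n" where "u = axis i (1 / a $ i)"
  have u: "lf a u = 1"
    using i by (simp add: lf_def u_def axis_def if_distrib[of "(*) _"] cong: if_cong)
  let ?M = "{v. lf a v = 0}"
  have M: "vec.subspace ?M" by (auto simp: vec.subspace_def)
  have "(\<lambda>w. lf a (w - z)) ` D = {l. \<exists>m\<in>?M. z + m + l *s u \<in> D}"
  proof (intro equalityI subsetI)
    fix l assume "l \<in> (\<lambda>w. lf a (w - z)) ` D"
    then obtain w where w: "w \<in> D" "l = lf a (w - z)" by auto
    then have "w - z - l *s u \<in> ?M" "z + (w - z - l *s u) + l *s u \<in> D" using u by auto
    then show "l \<in> {l. \<exists>m\<in>?M. z + m + l *s u \<in> D}" by blast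
  next
    fix l assume "l \<in> {l. \<exists>m\<in>?M. z + m + l *s u \<in> D}"
    then obtain m where m: "lf a m = 0" "z + m + l *s u \<in> D" by auto
    then show "l \<in> (\<lambda>w. lf a (w - z)) ` D"
      using u by (intro image_eqI[of _ _ "z + m + l *s u"]) (auto simp: add.assoc)
  qed
  moreover have "u \<notin> ?M" using u by simp
  ultimately show "open ((\<lambda>w. lf a (w - z)) ` D)" "simply_connected ((\<lambda>w. lf a (w - z)) ` D)"
    using projection_simply_connected[OF D M, of u z] by auto
qed

section \<open>The dual set and functionals of maximal determinant\<close>

lemma lf_commute: "lf a b = lf b a"
  by (simp add: lf_def mult.commute)

text \<open>Rebases the hyperplane at \<open>z\<close>: since \<open>z\<close> lies in
  \<open>D\<close>, the functional does not vanish on \<open>q - z\<close> and can be scaled to 1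
  there.\<close>

lemma exists_normalized_hyperplane:
  assumes D: "C_convex_domain D" and z: "z \<in> D" and q: "q \<notin> D"
  obtains b where "\<And>w. w \<in> D \<Longrightarrow> lf b (w - z) \<noteq> 1" "lf b (q - z) = 1"
proof -
  obtain b0 where b0: "\<And>w. w \<in> D \<Longrightarrow> lf b0 (w - q) \<noteq> 0"
    using exists_hyperplane_missing[OF D q] by blast
  define k where "k = lf b0 (q - z)"
  have k: "k \<noteq> 0" using b0[OF z] by (simp add: k_def)
  show thesis
  proof
    show "lf ((1 / k) *s b0) (q - z) = 1" using k by (simp only: lf_simps_left k_def[symmetric]) simp
    fix w assume w: "w \<in> D"
    have "lf b0 (w - z) = lf b0 (w - q) + k" by (simp add: k_def)
    then show "lf ((1 / k) *s b0) (w - z) \<noteq> 1"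
      using b0[OF w] k by (simp only: lf_simps_left) (simp add: field_simps)
  qed
qed

lemma norm_vec_le_sum: "norm (x :: 'a::real_normed_vector ^ 'n) \<le> (\<Sum>i\<in>UNIV. norm (x $ i))"
  unfolding norm_vec_def by (rule L2_set_le_sum) auto

text \<open>The rows are functionals from the compact dual set \<open>Q\<close> maximizing the modulus of the determinant. By Cramer's
  rule every functional in \<open>Q\<close> is then a combination of the rows with coefficients of modulus at
  most one.\<close>

lemma exists_supporting_matrix:
  fixes D :: "(complex ^ 'n::finite) set"
  assumes D: "C_convex_domain D" and nl: "\<not> contains_complex_line D" and z: "z \<in> D"
  obtains A :: "complex ^ 'n ^ 'n" where "invertible A" "\<And>i w. w \<in> D \<Longrightarrow> lf (A $ i) (w - z) \<noteq> 1"
    "\<And>w. (\<Sum>i\<in>UNIV. cmod (lf (A $ i) (w - z))) < 1 \<Longrightarrow> w \<in> D"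
proof -
  have opD: "open D" using D by (auto simp: C_convex_domain_def domain_Cn_def)
  define Q where "Q = {b. \<forall>w\<in>D. lf b (w - z) \<noteq> 1}"
  have hyp: "\<exists>b\<in>Q. lf b (q - z) = 1" if q: "q \<notin> D" for q
  proof -
    obtain b where b: "\<And>w. w \<in> D \<Longrightarrow> lf b (w - z) \<noteq> 1" "lf b (q - z) = 1"
      using exists_normalized_hyperplane[OF D z q] by blast
    have "b \<in> Q" unfolding Q_def using b(1) by blast
    with b(2) show ?thesis by blast
  qed
  \<comment> \<open>A functional outside \<open>Q\<close> equals 1 at some \<open>w - z\<close> with
    \<open>w\<close> in \<open>D\<close>. For nearby functionals this vector only needs a slight
    rescaling, under which the point stays in the open set \<open>D\<close>.\<close>
  have Qop: "open (- Q)"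
  proof -
    have eq: "- Q = (\<Union>v. {b. lf b v \<noteq> 0} \<inter> (\<lambda>b. z + (1 / lf b v) *s v) -` D)"
    proof (intro equalityI subsetI)
      fix b assume "b \<in> - Q"
      then obtain w where w: "w \<in> D" "lf b (w - z) = 1" by (auto simp: Q_def)
      then have "b \<in> {b. lf b (w - z) \<noteq> 0} \<inter> (\<lambda>b. z + (1 / lf b (w - z)) *s (w - z)) -` D"
        by (simp only: Int_iff mem_Collect_eq vimage_eq) simp
      then show "b \<in> (\<Union>v. {b. lf b v \<noteq> 0} \<inter> (\<lambda>b. z + (1 / lf b v) *s v) -` D)" by blast
    next
      fix b assume "b \<in> (\<Union>v. {b. lf b v \<noteq> 0} \<inter> (\<lambda>b. z + (1 / lf b v) *s v) -` D)"
      then obtain v where v: "lf b v \<noteq> 0" "z + (1 / lf b v) *s v \<in> D" by auto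
      then have "lf b (z + (1 / lf b v) *s v - z) = 1" by simp
      then show "b \<in> - Q" using v(2) unfolding Q_def by blast
    qed
    have cb: "continuous_on S (\<lambda>b. lf b v)" for S and v :: "complex ^ 'n"
      unfolding lf_commute[of _ v] by (intro continuous_intros)
    have "open ({b. lf b v \<noteq> 0} \<inter> (\<lambda>b. z + (1 / lf b v) *s v) -` D)" for v
    proof (rule continuous_open_preimage[OF _ _ opD])
      show "open {b. lf b v \<noteq> 0}" by (intro open_Collect_neq cb continuous_on_const)
      show "continuous_on {b. lf b v \<noteq> 0} (\<lambda>b. z + (1 / lf b v) *s v)"
        by (intro continuous_intros cb) auto
    qed
    then show ?thesis unfolding eq by blast
  qed
  obtain r where r: "r > 0" "ball z r \<subseteq> D" by (rule openE[OF opD z])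
  \<comment> \<open>A larger coefficient would let \<open>b\<close> take the value 1 at a multiple
    of a coordinate vector shorter than \<open>r\<close>, hence at a point of
    \<open>D\<close>.\<close>
  have Qb: "cmod (b $ i) \<le> 1 / r" if b: "b \<in> Q" for b :: "complex ^ 'n" and i
  proof (rule ccontr)
    assume "\<not> ?thesis"
    then have gt: "1 / r < cmod (b $ i)" by simp
    then have nz: "b $ i \<noteq> 0" using r(1) by auto
    define v where "v = (axis i (1 / b $ i) :: complex ^ 'n)"
    have "lf b v = 1"
      using nz by (simp add: lf_def v_def axis_def if_distrib[of "(*) _"] cong: if_cong)
    moreover have "norm v = 1 / cmod (b $ i)"
      by (simp add: v_def norm_vec_def L2_set_def axis_def norm_divide if_distrib[of cmod] if_distrib[of "\<lambda>x. x\<^sup>2"] cong: if_cong)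
    moreover have "1 / cmod (b $ i) < r" using gt r(1) nz by (simp add: divide_less_eq mult.commute)
    ultimately have "norm v < r" "lf b v = 1" by simp_all
    moreover from this(1)
    have "z + v \<in> D" using r(2) by (auto simp: dist_norm)
    moreover have "lf b (z + v - z) = lf b v" by simp
    ultimately have "\<exists>w\<in>D. lf b (w - z) = 1" by (metis (no_types))
    then show False using b by (simp add: Q_def)
  qed
  define \<M> where "\<M> = {A :: complex ^ 'n ^ 'n. \<forall>i. A $ i \<in> Q}"
  have "compact \<M>"
    unfolding compact_eq_bounded_closed
  proof
    show "bounded \<M>"
    proof (rule boundedI)
      fix A assume A: "A \<in> \<M>"
      have "norm A \<le> (\<Sum>i\<in>UNIV. norm (A $ i))" by (rule norm_vec_le_sum)
      also have "\<dots> \<le> (\<Sum>i\<in>UNIV. \<Sum>j\<in>UNIV. norm (A $ i $ j))" by (intro sum_mono norm_vec_le_sum)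
      also have "\<dots> \<le> (\<Sum>i\<in>(UNIV::'n set). \<Sum>j\<in>(UNIV::'n set). 1 / r)"
        using A by (intro sum_mono Qb) (simp add: \<M>_def)
      finally show "norm A \<le> (\<Sum>i\<in>(UNIV::'n set). \<Sum>j\<in>(UNIV::'n set). 1 / r)" .
    qed
    have "\<M> = (\<Inter>i. (\<lambda>A. A $ i) -` Q)" by (auto simp: \<M>_def)
    also have "closed \<dots>"
      using Qop by (intro closed_INT ballI closed_vimage continuous_intros) (simp add: closed_def)
    finally show "closed \<M>" .
  qed
  moreover have "0 \<in> \<M>" by (simp add: \<M>_def Q_def lf_simps_left)
  moreover have "continuous_on \<M> (\<lambda>A. cmod (det A))"
    unfolding det_def by (intro continuous_intros)
  ultimately obtain A where A: "A \<in> \<M>" "\<And>B. B \<in> \<M> \<Longrightarrow> cmod (det B) \<le> cmod (det A)"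
    using continuous_attains_sup[of \<M> "\<lambda>A. cmod (det A)"] by blast
  \<comment> \<open>A direction annihilated by all of \<open>Q\<close> would span a complex line
    through \<open>z\<close> inside \<open>D\<close>, because every point outside \<open>D\<close>
    is cut off by an element of \<open>Q\<close>.\<close>
  have spanQ: "vec.span Q = UNIV"
  proof (rule ccontr)
    assume "vec.span Q \<noteq> UNIV"
    then obtain u where "u \<notin> vec.span Q" by blast
    then obtain a where a: "\<And>m. m \<in> vec.span Q \<Longrightarrow> lf a m = 0" "lf a u = 1"
      using exists_functional_vanishing_on_subspace[OF vec.subspace_span] by blast
    have "a \<noteq> 0" using a(2) by (auto simp: lf_simps_left)
    moreover have "range (\<lambda>l. z + l *s a) \<subseteq> D"
    proof safe
      fix l
      show "z + l *s a \<in> D"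
      proof (rule ccontr)
        assume "z + l *s a \<notin> D"
        then obtain b where b: "b \<in> Q" "lf b (z + l *s a - z) = 1" using hyp by blast
        moreover have "lf b a = 0" using a(1)[OF vec.span_base[OF b(1)]] by (simp add: lf_commute)
        ultimately show False by simp
      qed
    qed
    ultimately show False using nl unfolding contains_complex_line_def complex_line_def by blast
  qed
  \<comment> \<open>A basis chosen from \<open>Q\<close> is a competitor with nonzero
    determinant.\<close>
  have "det A \<noteq> 0"
  proof -
    obtain B where B: "B \<subseteq> Q" "vec.independent B" "Q \<subseteq> vec.span B"
      using vec.maximal_independent_subset by blast
    have spB: "vec.span B = UNIV"
      using vec.span_mono[OF B(3)] spanQ by (simp add: vec.span_span top_unique)
    have "card B = CARD('n)"
      using vec.dim_eq_card_independent[OF B(2)] vec.dim_span[of B] vec.dim_UNIV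
      by (simp add: spB vec.dimension_def card_cart_basis)
    moreover have "finite B" by (rule vec.finiteI_independent[OF B(2)])
    ultimately have "\<exists>h. bij_betw h (UNIV :: 'n set) B"
      by (intro finite_same_card_bij) simp_all
    then obtain h where h: "bij_betw h (UNIV :: 'n set) B" ..
    define C where "C = (\<chi> i. h i)"
    have "row i C = h i" for i by (simp add: row_def C_def)
    then have "rows C = range h" by (auto simp: rows_def)
    then have "rows C = B" using h by (simp add: bij_betw_def)
    then obtain C' where "C' ** C = mat 1"
      using matrix_left_invertible_span_rows_gen[of C] spB by auto
    then have "invertible C" by (metis invertible_def matrix_left_right_inverse)
    then have "det C \<noteq> 0" by (simp add: invertible_det_nz)
    moreover have "C \<in> \<M>" using h B(1) by (auto simp: \<M>_def C_def bij_betw_def)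
    ultimately show ?thesis using A(2)[of C] by auto
  qed
  then have inv: "invertible A" by (simp add: invertible_det_nz)
  show thesis
  proof
    show "invertible A" by (rule inv)
    show "lf (A $ i) (w - z) \<noteq> 1" if "w \<in> D" for i w using A(1) that by (simp add: \<M>_def Q_def)
    fix w assume lt: "(\<Sum>i\<in>UNIV. cmod (lf (A $ i) (w - z))) < 1"
    show "w \<in> D"
    proof (rule ccontr)
      assume "w \<notin> D"
      then obtain b where b: "b \<in> Q" "lf b (w - z) = 1" using hyp by blast
      have "invertible (transpose A)" using inv by (simp add: invertible_det_nz)
      then obtain T where T: "transpose A ** T = mat 1" unfolding invertible_def by blast
      define x where "x = T *v b"
      have "transpose A *v x = b" by (simp add: x_def matrix_vector_mul_assoc T)
      then have bx: "b = (\<Sum>i\<in>UNIV. x $ i *s A $ i)"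
        by (simp add: matrix_mult_sum column_transpose row_def)
      have rowA: "row i A = A $ i" for i by (simp add: row_def)
      have x1: "cmod (x $ k) \<le> 1" for k
      proof -
        define A' where "A' = (\<chi> i. if i = k then b else row i A)"
        have "det A' = x $ k * det A"
          using cramer_lemma_transpose[of k x A] unfolding A'_def bx rowA .
        moreover have "A' \<in> \<M>" using A(1) b(1) by (simp add: \<M>_def A'_def row_def)
        ultimately have "cmod (x $ k) * cmod (det A) \<le> cmod (det A)" using A(2)[of A'] by (simp add: norm_mult)
        then show ?thesis using \<open>det A \<noteq> 0\<close> by simp
      qed
      have "1 = cmod (\<Sum>i\<in>UNIV. x $ i * lf (A $ i) (w - z))"
        using b(2) unfolding bx lf_simps_left by simp
      also have "\<dots> \<le> (\<Sum>i\<in>UNIV. cmod (x $ i) * cmod (lf (A $ i) (w - z)))"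
        unfolding norm_mult[symmetric] by (rule norm_sum)
      also have "\<dots> \<le> (\<Sum>i\<in>UNIV. 1 * cmod (lf (A $ i) (w - z)))"
        by (intro sum_mono mult_right_mono x1) auto
      finally show False using lt by simp
    qed
  qed
qed

subsection \<open>Square-integrable holomorphic functions\<close>

lemma prod_Basis_vec:
  fixes g :: "'a::euclidean_space ^ 'n \<Rightarrow> real"
  shows "(\<Prod>b\<in>Basis. g b) = (\<Prod>i\<in>UNIV. \<Prod>u\<in>Basis. g (axis i u))"
proof -
  have inj: "inj_on (\<lambda>(i, u). axis i u) ((UNIV :: 'n set) \<times> (Basis :: 'a set))"
    by (auto simp: inj_on_def axis_eq_axis nonzero_Basis)
  have B: "(Basis :: ('a ^ 'n) set) = (\<lambda>(i, u). axis i u) ` (UNIV \<times> Basis)"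
    by (auto simp: Basis_vec_def)
  show ?thesis
    unfolding B by (subst prod.reindex[OF inj]) (simp add: prod.cartesian_product case_prod_beta o_def)
qed

lemma measurable_vec_lambda:
  "(\<lambda>f. \<chi> i. f i) \<in> measurable (\<Pi>\<^sub>M i\<in>(UNIV :: 'n::finite set). (lborel :: complex measure)) borel"
proof (subst borel_measurable_euclidean_space, intro ballI)
  fix b :: "complex ^ 'n" assume "b \<in> Basis"
  then obtain i u where b: "b = axis i u" by (auto simp: Basis_vec_def)
  have "(\<lambda>f. (\<chi> i. f i) \<bullet> b) = (\<lambda>f :: 'n \<Rightarrow> complex. f i \<bullet> u)" by (simp add: b inner_axis)
  then show "(\<lambda>f. (\<chi> i. f i) \<bullet> b) \<in> borel_measurable (\<Pi>\<^sub>M i\<in>(UNIV :: 'n set). (lborel :: complex measure))"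
    by simp
qed

text \<open>Both measures agree on boxes, which are products of planar boxes; integrals of products
  of one-coordinate functions then factor.\<close>

lemma lborel_vec_eq_PiM:
  "(lborel :: (complex ^ 'n::finite) measure) = distr (\<Pi>\<^sub>M i\<in>UNIV. lborel) borel (\<lambda>f. \<chi> i. f i)"
proof (rule lborel_eqI)
  interpret product_sigma_finite "\<lambda>_::'n. lborel :: complex measure"
    by (simp add: product_sigma_finite_def sigma_finite_lborel)
  fix l u :: "complex ^ 'n" assume le: "\<And>b. b \<in> Basis \<Longrightarrow> l \<bullet> b \<le> u \<bullet> b"
  have le': "l $ i \<bullet> b \<le> u $ i \<bullet> b" if "b \<in> Basis" for i b
    using le[of "axis i b"] that by (simp add: inner_axis axis_in_Basis_iff)
  have pre: "(\<lambda>f. \<chi> i. f i) -` box l u \<inter> space (\<Pi>\<^sub>M i\<in>(UNIV :: 'n set). (lborel :: complex measure))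
      = (\<Pi>\<^sub>E i\<in>UNIV. box (l $ i) (u $ i))"
    by (auto simp: space_PiM mem_box Basis_vec_def inner_axis PiE_iff)
  have "emeasure (distr (\<Pi>\<^sub>M i\<in>(UNIV :: 'n set). (lborel :: complex measure)) borel (\<lambda>f. \<chi> i. f i)) (box l u)
      = emeasure (\<Pi>\<^sub>M i\<in>(UNIV :: 'n set). (lborel :: complex measure)) (\<Pi>\<^sub>E i\<in>UNIV. box (l $ i) (u $ i))"
    by (subst emeasure_distr[OF measurable_vec_lambda]) (simp_all add: pre)
  also have "\<dots> = (\<Prod>i\<in>UNIV. emeasure lborel (box (l $ i) (u $ i)))"
    by (intro emeasure_PiM) auto
  also have "\<dots> = (\<Prod>i\<in>UNIV. ennreal (\<Prod>b\<in>Basis. (u $ i - l $ i) \<bullet> b))"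
    using le' by (intro prod.cong refl emeasure_lborel_box)
  also have "\<dots> = ennreal (\<Prod>i\<in>UNIV. \<Prod>b\<in>Basis. (u $ i - l $ i) \<bullet> b)"
    using le' by (intro prod_ennreal prod_nonneg) (simp add: inner_diff_left)
  also have "(\<Prod>i\<in>UNIV. \<Prod>b\<in>Basis. (u $ i - l $ i) \<bullet> b) = (\<Prod>b\<in>Basis. (u - l) \<bullet> b)"
    by (simp add: prod_Basis_vec inner_axis)
  finally show "emeasure (distr (\<Pi>\<^sub>M i\<in>(UNIV :: 'n set). (lborel :: complex measure)) borel (\<lambda>f. \<chi> i. f i)) (box l u)
      = ennreal (\<Prod>b\<in>Basis. (u - l) \<bullet> b)" .
qed simp

lemma nn_integral_prod_vec:
  fixes h :: "'n::finite \<Rightarrow> complex \<Rightarrow> ennreal"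
  assumes h [measurable]: "\<And>i. h i \<in> borel_measurable borel"
  shows "(\<integral>\<^sup>+x. (\<Prod>i\<in>UNIV. h i (x $ i)) \<partial>lborel) = (\<Prod>i\<in>UNIV. \<integral>\<^sup>+z. h i z \<partial>lborel)"
proof -
  interpret product_sigma_finite "\<lambda>_::'n. lborel :: complex measure"
    by (simp add: product_sigma_finite_def sigma_finite_lborel)
  have [measurable]: "(\<lambda>x :: complex ^ 'n. x $ i) \<in> borel_measurable borel" for i
    by (intro borel_measurable_continuous_onI continuous_intros)
  have "(\<integral>\<^sup>+x. (\<Prod>i\<in>UNIV. h i (x $ i)) \<partial>lborel)
      = (\<integral>\<^sup>+f. (\<Prod>i\<in>UNIV. h i ((\<chi> j. f j) $ i)) \<partial>(\<Pi>\<^sub>M i\<in>UNIV. lborel))"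
    by (subst lborel_vec_eq_PiM, subst nn_integral_distr[OF measurable_vec_lambda]) (auto intro!: borel_measurable_prod_ennreal)
  also have "\<dots> = (\<Prod>i\<in>UNIV. \<integral>\<^sup>+z. h i z \<partial>lborel)"
    by simp (intro product_nn_integral_prod, auto)
  finally show ?thesis .
qed

section \<open>Calculus of holomorphic functions of several variables\<close>

lemma holomorphic_Cn_has_derivative:
  assumes "holomorphic_Cn_on f D" "open D" "z \<in> D"
  shows "(f has_derivative frechet_derivative f (at z)) (at z)"
    and "frechet_derivative f (at z) (\<zeta> *s X) = \<zeta> * frechet_derivative f (at z) X"
proof -
  obtain f' where f': "(f has_derivative f') (at z within D) \<and> (\<forall>\<zeta> X. f' (\<zeta> *s X) = \<zeta> * f' X)"
    by (rule exE[OF bspec[OF assms(1)[unfolded holomorphic_Cn_on_def] assms(3)]])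
  have 1: "(f has_derivative f') (at z)"
    using conjunct1[OF f'] unfolding at_within_open[OF assms(3,2)] .
  have eq: "frechet_derivative f (at z) = f'" by (rule frechet_derivative_at[OF 1, symmetric])
  show "(f has_derivative frechet_derivative f (at z)) (at z)" unfolding eq by (rule 1)
  show "frechet_derivative f (at z) (\<zeta> *s X) = \<zeta> * frechet_derivative f (at z) X"
    unfolding eq using conjunct2[OF f'] by simp
qed

lemma holomorphic_Cn_on_imp_continuous_on: "holomorphic_Cn_on f D \<Longrightarrow> continuous_on D f"
  unfolding continuous_on_eq_continuous_within
proof
  fix z assume f: "holomorphic_Cn_on f D" and z: "z \<in> D"
  obtain f' where "(f has_derivative f') (at z within D) \<and> (\<forall>\<zeta> X. f' (\<zeta> *s X) = \<zeta> * f' X)"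
    by (rule exE[OF bspec[OF f[unfolded holomorphic_Cn_on_def] z]])
  then show "continuous (at z within D) f" by (elim conjE) (rule has_derivative_continuous)
qed

lemma holomorphic_Cn_onI:
  assumes "\<And>z. z \<in> D \<Longrightarrow> \<exists>f'. (f has_derivative f') (at z) \<and> (\<forall>\<zeta> X. f' (\<zeta> *s X) = \<zeta> * f' X)"
  shows "holomorphic_Cn_on f D"
  unfolding holomorphic_Cn_on_def
proof
  fix z assume "z \<in> D"
  from assms[OF this] obtain f' where "(f has_derivative f') (at z) \<and> (\<forall>\<zeta> X. f' (\<zeta> *s X) = \<zeta> * f' X)"
    by (rule exE)
  then show "\<exists>f'. (f has_derivative f') (at z within D) \<and> (\<forall>\<zeta> X. f' (\<zeta> *s X) = \<zeta> * f' X)"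
  proof (elim conjE)
    assume "(f has_derivative f') (at z)" "\<forall>\<zeta> X. f' (\<zeta> *s X) = \<zeta> * f' X"
    then show ?thesis by (intro exI[of _ f'] conjI) (rule has_derivative_at_withinI)
  qed
qed

lemma has_derivative_smult_vec:
  fixes X :: "complex ^ 'n"
  shows "((\<lambda>\<zeta>. c + \<zeta> *s X) has_derivative (\<lambda>h. h *s X)) (at \<zeta>0)"
proof -
  have "bounded_linear (\<lambda>h. h *s X)"
    unfolding linear_conv_bounded_linear[symmetric]
    by (rule linearI) (auto simp: vec_eq_iff algebra_simps)
  then show ?thesis
    using has_derivative_add[OF has_derivative_const bounded_linear_imp_has_derivative, of "\<lambda>h. h *s X" c] by simp
qed

text \<open>Restriction to complex lines, through which the one-variable theorems enter.\<close>

lemma holomorphic_Cn_slice: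
  fixes f :: "complex ^ 'n::finite \<Rightarrow> complex"
  assumes f: "holomorphic_Cn_on f D" and D: "open D"
  shows "(\<lambda>\<zeta>. f (c + \<zeta> *s X)) holomorphic_on {\<zeta>. c + \<zeta> *s X \<in> D}"
    and "c \<in> D \<Longrightarrow> deriv (\<lambda>\<zeta>. f (c + \<zeta> *s X)) 0 = frechet_derivative f (at c) X"
proof -
  have fd: "((\<lambda>\<zeta>. f (c + \<zeta> *s X)) has_field_derivative frechet_derivative f (at (c + \<zeta>0 *s X)) X) (at \<zeta>0)"
    if "c + \<zeta>0 *s X \<in> D" for \<zeta>0
  proof -
    have "((\<lambda>\<zeta>. f (c + \<zeta> *s X)) has_derivative (\<lambda>h. frechet_derivative f (at (c + \<zeta>0 *s X)) (h *s X))) (at \<zeta>0)"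
      by (rule has_derivative_compose[OF has_derivative_smult_vec holomorphic_Cn_has_derivative(1)[OF f D that]])
    also have "(\<lambda>h. frechet_derivative f (at (c + \<zeta>0 *s X)) (h *s X)) = (*) (frechet_derivative f (at (c + \<zeta>0 *s X)) X)"
      using holomorphic_Cn_has_derivative(2)[OF f D that] by (simp add: fun_eq_iff mult.commute)
    finally show ?thesis unfolding has_field_derivative_def .
  qed
  then show "(\<lambda>\<zeta>. f (c + \<zeta> *s X)) holomorphic_on {\<zeta>. c + \<zeta> *s X \<in> D}"
    unfolding holomorphic_on_def field_differentiable_def using has_field_derivative_at_within by blast
  show "deriv (\<lambda>\<zeta>. f (c + \<zeta> *s X)) 0 = frechet_derivative f (at c) X" if "c \<in> D"
    using fd[of 0] that by (intro DERIV_imp_deriv) simp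
qed

lemma open_slice: "open D \<Longrightarrow> open {\<zeta>. c + \<zeta> *s X \<in> (D :: (complex ^ 'n) set)}"
proof -
  assume "open D"
  then have "open ((\<lambda>\<zeta>. c + \<zeta> *s X) -` D)" by (intro open_vimage continuous_intros)
  then show ?thesis by (simp add: vimage_def)
qed

lemma holomorphic_Cn_on_compose_lf:
  assumes h: "h holomorphic_on S" "open S" and im: "\<And>w. w \<in> D \<Longrightarrow> lf a (w - z) \<in> S"
  shows "holomorphic_Cn_on (\<lambda>w. h (lf a (w - z))) D"
    and "w \<in> D \<Longrightarrow> frechet_derivative (\<lambda>w. h (lf a (w - z))) (at w) X = deriv h (lf a (w - z)) * lf a X"
proof -
  have bl: "bounded_linear (lf a)"
    unfolding linear_conv_bounded_linear[symmetric]
    by (rule linearI) (simp, simp add: lf_def scaleR_sum_right)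
  have d: "((\<lambda>w. h (lf a (w - z))) has_derivative (\<lambda>X. deriv h (lf a (w - z)) * lf a X)) (at w)" if "w \<in> D" for w
  proof -
    have "((\<lambda>w. w - z) has_derivative (\<lambda>x. x)) (at w)" by (auto intro!: derivative_eq_intros)
    from bounded_linear.has_derivative[OF bl this]
    have "((\<lambda>w. lf a (w - z)) has_derivative lf a) (at w)" .
    moreover have "(h has_derivative (*) (deriv h (lf a (w - z)))) (at (lf a (w - z)))"
      using holomorphic_derivI[OF h im[OF that]] by (simp add: has_field_derivative_def)
    ultimately show ?thesis by (rule has_derivative_compose)
  qed
  show "holomorphic_Cn_on (\<lambda>w. h (lf a (w - z))) D"
  proof (rule holomorphic_Cn_onI)
    fix w assume "w \<in> D"
    then show "\<exists>f'. ((\<lambda>w. h (lf a (w - z))) has_derivative f') (at w) \<and> (\<forall>\<zeta> X. f' (\<zeta> *s X) = \<zeta> * f' X)"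
      by (intro exI[of _ "\<lambda>X. deriv h (lf a (w - z)) * lf a X"] conjI d) auto
  qed
  show "frechet_derivative (\<lambda>w. h (lf a (w - z))) (at w) X = deriv h (lf a (w - z)) * lf a X" if "w \<in> D"
    using fun_cong[OF frechet_derivative_at[OF d[OF that]], of X] by (rule sym)
qed

lemma holomorphic_Cn_on_mult:
  assumes f: "holomorphic_Cn_on f D" and g: "holomorphic_Cn_on g D" and D: "open D"
  shows "holomorphic_Cn_on (\<lambda>w. f w * g w) D"
    and "w \<in> D \<Longrightarrow> frechet_derivative (\<lambda>w. f w * g w) (at w) X
      = f w * frechet_derivative g (at w) X + frechet_derivative f (at w) X * g w"
proof -
  have d: "((\<lambda>w. f w * g w) has_derivative (\<lambda>X. f w * frechet_derivative g (at w) X + frechet_derivative f (at w) X * g w)) (at w)"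
    if "w \<in> D" for w
    by (intro has_derivative_mult holomorphic_Cn_has_derivative(1)[OF _ D that] f g)
  show "holomorphic_Cn_on (\<lambda>w. f w * g w) D"
  proof (rule holomorphic_Cn_onI)
    fix w assume w: "w \<in> D"
    show "\<exists>f'. ((\<lambda>w. f w * g w) has_derivative f') (at w) \<and> (\<forall>\<zeta> X. f' (\<zeta> *s X) = \<zeta> * f' X)"
      using holomorphic_Cn_has_derivative(2)[OF f D w] holomorphic_Cn_has_derivative(2)[OF g D w]
      by (intro exI[of _ "\<lambda>X. f w * frechet_derivative g (at w) X + frechet_derivative f (at w) X * g w"] conjI d[OF w])
         (simp add: algebra_simps)
  qed
  show "frechet_derivative (\<lambda>w. f w * g w) (at w) X
      = f w * frechet_derivative g (at w) X + frechet_derivative f (at w) X * g w" if "w \<in> D"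
    using fun_cong[OF frechet_derivative_at[OF d[OF that]], of X] by (rule sym)
qed

lemma holomorphic_Cn_on_const: "holomorphic_Cn_on (\<lambda>_. c) D"
  by (rule holomorphic_Cn_onI) (intro exI[of _ "\<lambda>_. 0"], simp)

lemma holomorphic_Cn_on_prod:
  assumes "finite I" "\<And>i. i \<in> I \<Longrightarrow> holomorphic_Cn_on (f i) D" "open D"
  shows "holomorphic_Cn_on (\<lambda>w. \<Prod>i\<in>I. f i w) D"
  using assms(1,2)
proof (induction I rule: finite_induct)
  case (insert i I)
  then show ?case using holomorphic_Cn_on_mult(1)[OF _ _ assms(3), of "f i" "\<lambda>w. \<Prod>i\<in>I. f i w"] by simp
qed (simp add: holomorphic_Cn_on_const)

section \<open>Square integrals and the sub-mean value inequality\<close>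

lemma borel_measurable_norm_sq_indicator:
  fixes f :: "complex ^ 'n::finite \<Rightarrow> complex"
  assumes "continuous_on D f" "open D"
  shows "(\<lambda>w. ennreal ((cmod (f w))\<^sup>2) * indicator D w) \<in> borel_measurable borel"
proof -
  have "(\<lambda>w. indicator D w *\<^sub>R (cmod (f w))\<^sup>2) \<in> borel_measurable borel"
    using assms by (intro borel_measurable_continuous_on_indicator continuous_intros) auto
  then have "(\<lambda>w. ennreal (indicator D w *\<^sub>R (cmod (f w))\<^sup>2)) \<in> borel_measurable borel" by measurable
  also have "(\<lambda>w. ennreal (indicator D w *\<^sub>R (cmod (f w))\<^sup>2)) = (\<lambda>w. ennreal ((cmod (f w))\<^sup>2) * indicator D w)"
    by (auto simp: fun_eq_iff split: split_indicator)
  finally show ?thesis .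
qed

abbreviation sq_integral :: "(complex ^ 'n::finite) set \<Rightarrow> (complex ^ 'n \<Rightarrow> complex) \<Rightarrow> ennreal" where
  "sq_integral D f \<equiv> (\<integral>\<^sup>+w. ennreal ((cmod (f w))\<^sup>2) * indicator D w \<partial>lborel)"

text \<open>For \<open>v\<close> in the balanced set \<open>B\<close> the circle of points
  \<open>c + circ t *s v\<close> bounds a disc in \<open>D\<close>, so \<open>circle_mean_sq\<close>
  applies; multiplication by \<open>circ t\<close> is an isometry preserving \<open>B\<close>, and
  averaging gives the volume inequality.\<close>

lemma holomorphic_Cn_submean:
  fixes f :: "complex ^ 'n::finite \<Rightarrow> complex"
  assumes f: "holomorphic_Cn_on f D" and D: "open D" and B: "open B"
    and bal: "\<And>v \<zeta>. v \<in> B \<Longrightarrow> cmod \<zeta> \<le> 1 \<Longrightarrow> \<zeta> *s v \<in> B" and sub: "\<And>v. v \<in> B \<Longrightarrow> c + v \<in> D"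
  shows "ennreal ((cmod (f c))\<^sup>2) * emeasure lborel B \<le> sq_integral D f"
proof -
  let ?u = "\<lambda>v. ennreal ((cmod (f (c + v)))\<^sup>2) * indicator D (c + v)"
  have um0: "(\<lambda>w. ennreal ((cmod (f w))\<^sup>2) * indicator D w) \<in> borel_measurable borel"
    by (rule borel_measurable_norm_sq_indicator[OF holomorphic_Cn_on_imp_continuous_on[OF f] D])
  have um: "?u \<in> borel_measurable borel"
    by (rule measurable_compose[OF _ um0]) simp
  have "ennreal ((cmod (f c))\<^sup>2) * emeasure lborel B = (\<integral>\<^sup>+v. ennreal ((cmod (f c))\<^sup>2) * indicator B v \<partial>lborel)"
    using B by (subst nn_integral_cmult_indicator) auto
  also have "\<dots> \<le> (\<integral>\<^sup>+v. ?u v * indicator B v \<partial>lborel)"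
  proof (rule nn_integral_rotation_average[where rot = "\<lambda>t v. circ t *s v"])
    fix t :: real
    let ?e = "circ t"
    show "linear (\<lambda>v :: complex ^ 'n. ?e *s v)"
      by (rule linearI) (auto simp: vec_eq_iff algebra_simps)
    have e2: "inverse ?e *s (?e *s v) = v" "?e *s (inverse ?e *s v) = v" for v :: "complex ^ 'n"
      by simp_all
    show "bij (\<lambda>v :: complex ^ 'n. ?e *s v)"
      by (rule bij_betw_byWitness[of _ "\<lambda>v. inverse ?e *s v"]) (use e2 in auto)
    show "norm (?e *s v) = norm v" for v :: "complex ^ 'n"
      by (simp add: norm_vec_def norm_mult)
    show "?e *s v \<in> B \<longleftrightarrow> v \<in> B" for v
    proof
      assume "?e *s v \<in> B"
      then have "inverse ?e *s (?e *s v) \<in> B" by (rule bal) (simp add: norm_inverse)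
      then show "v \<in> B" using e2 by simp
    qed (rule bal, auto)
  next
    show "(\<lambda>(t, v). circ t *s v) \<in> borel_measurable (borel :: (real \<times> (complex ^ 'n)) measure)"
      unfolding case_prod_beta by (intro borel_measurable_continuous_onI continuous_intros)
  next
    fix v assume v: "v \<in> B"
    have "ennreal ((cmod (f (c + 0 *s v)))\<^sup>2) \<le>
       (\<integral>\<^sup>+t. ennreal ((cmod (f (c + circ t *s v)))\<^sup>2) * indicator {0..1} t \<partial>lborel)"
    proof (rule circle_mean_sq[of "\<lambda>\<zeta>. f (c + \<zeta> *s v)"])
      show "(\<lambda>\<zeta>. f (c + \<zeta> *s v)) holomorphic_on {\<zeta>. c + \<zeta> *s v \<in> D}" by (rule holomorphic_Cn_slice(1)[OF f D])
      show "open {\<zeta>. c + \<zeta> *s v \<in> D}" by (rule open_slice[OF D])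
      show "cball 0 1 \<subseteq> {\<zeta>. c + \<zeta> *s v \<in> D}" using bal[OF v] sub by auto
    qed
    also have "\<dots> = (\<integral>\<^sup>+t. ?u (circ t *s v) * indicator {0..1} t \<partial>lborel)"
      using bal[OF v] sub by (intro nn_integral_cong) (auto split: split_indicator)
    finally show "ennreal ((cmod (f c))\<^sup>2) \<le> (\<integral>\<^sup>+t. ?u (circ t *s v) * indicator {0..1} t \<partial>lborel)"
      by simp
  qed (use B um in auto)
  also have "\<dots> \<le> (\<integral>\<^sup>+v. ?u v \<partial>lborel)"
    by (intro nn_integral_mono) (auto split: split_indicator)
  also have "\<dots> = sq_integral D f"
    by (rule nn_integral_translate[OF sets_lborel lborel_distr_plus um0])
  finally show ?thesis .
qed

lemma L2h_norm_nonneg: "L2h_norm D f \<ge> 0"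
  unfolding L2h_norm_def set_lebesgue_integral_def by (intro real_sqrt_ge_zero integral_nonneg_AE) auto

text \<open>Links the norm, a Bochner integral, with nonnegative integrals, in which comparison and
  change of variables carry no integrability conditions.\<close>

lemma nn_integral_L2h:
  assumes "f \<in> L2h D"
  shows "sq_integral D f = ennreal ((L2h_norm D f)\<^sup>2)"
proof -
  have int: "integrable lborel (\<lambda>w. indicator D w *\<^sub>R (cmod (f w))\<^sup>2)"
    using assms by (simp add: L2h_def set_integrable_def)
  have "sq_integral D f = (\<integral>\<^sup>+w. ennreal (indicator D w *\<^sub>R (cmod (f w))\<^sup>2) \<partial>lborel)"
    by (intro nn_integral_cong) (auto split: split_indicator)
  also have "\<dots> = ennreal (integral\<^sup>L lborel (\<lambda>w. indicator D w *\<^sub>R (cmod (f w))\<^sup>2))"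
    by (rule nn_integral_eq_integral[OF int]) auto
  also have "integral\<^sup>L lborel (\<lambda>w. indicator D w *\<^sub>R (cmod (f w))\<^sup>2) = (L2h_norm D f)\<^sup>2"
    unfolding L2h_norm_def set_lebesgue_integral_def
    by (subst real_sqrt_pow2) (auto intro!: integral_nonneg_AE)
  finally show ?thesis .
qed

lemma L2hI:
  assumes f: "holomorphic_Cn_on f D" "open D"
    and le: "sq_integral D f \<le> ennreal C" and C: "C \<ge> 0"
  shows "f \<in> L2h D" "(L2h_norm D f)\<^sup>2 \<le> C"
proof -
  have m: "(\<lambda>w. indicator D w *\<^sub>R (cmod (f w))\<^sup>2) \<in> borel_measurable borel"
    using f by (intro borel_measurable_continuous_on_indicator continuous_intros holomorphic_Cn_on_imp_continuous_on) auto
  have "(\<integral>\<^sup>+w. ennreal (norm (indicator D w *\<^sub>R (cmod (f w))\<^sup>2)) \<partial>lborel) = sq_integral D f"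
    by (intro nn_integral_cong) (auto split: split_indicator)
  also have "\<dots> < \<infinity>" using le_less_trans[OF le ennreal_less_top] by simp
  finally have "integrable lborel (\<lambda>w. indicator D w *\<^sub>R (cmod (f w))\<^sup>2)"
    using m by (intro integrableI_bounded) auto
  then show 1: "f \<in> L2h D" using f by (simp add: L2h_def set_integrable_def)
  show "(L2h_norm D f)\<^sup>2 \<le> C" using le C unfolding nn_integral_L2h[OF 1] by simp
qed

lemma L2h_scale:
  assumes f: "f \<in> L2h D" and D: "open D"
  shows "(\<lambda>w. c * f w) \<in> L2h D" "L2h_norm D (\<lambda>w. c * f w) = cmod c * L2h_norm D f"
    "z \<in> D \<Longrightarrow> frechet_derivative (\<lambda>w. c * f w) (at z) X = c * frechet_derivative f (at z) X"
proof -
  have holf: "holomorphic_Cn_on f D" using f by (simp add: L2h_def)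
  have eq: "(\<integral>\<^sup>+w. ennreal ((cmod (c * f w))\<^sup>2) * indicator D w \<partial>lborel) = ennreal ((cmod c * L2h_norm D f)\<^sup>2)"
  proof -
    have "(\<integral>\<^sup>+w. ennreal ((cmod (c * f w))\<^sup>2) * indicator D w \<partial>lborel)
        = (\<integral>\<^sup>+w. ennreal ((cmod c)\<^sup>2) * (ennreal ((cmod (f w))\<^sup>2) * indicator D w) \<partial>lborel)"
      by (intro nn_integral_cong) (simp add: norm_mult power_mult_distrib ennreal_mult mult.assoc)
    also have "\<dots> = ennreal ((cmod c)\<^sup>2) * ennreal ((L2h_norm D f)\<^sup>2)"
      using borel_measurable_norm_sq_indicator[OF holomorphic_Cn_on_imp_continuous_on[OF holf] D]
      by (subst nn_integral_cmult) (simp_all add: nn_integral_L2h[OF f])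
    finally show ?thesis by (simp add: power_mult_distrib ennreal_mult)
  qed
  have hol: "holomorphic_Cn_on (\<lambda>w. c * f w) D"
    by (rule holomorphic_Cn_on_mult(1)[OF holomorphic_Cn_on_const holf D])
  show 1: "(\<lambda>w. c * f w) \<in> L2h D"
    by (rule L2hI(1)[OF hol D, of "(cmod c * L2h_norm D f)\<^sup>2"]) (simp_all add: eq)
  have "(L2h_norm D (\<lambda>w. c * f w))\<^sup>2 = (cmod c * L2h_norm D f)\<^sup>2"
    using nn_integral_L2h[OF 1] unfolding eq by simp
  then show "L2h_norm D (\<lambda>w. c * f w) = cmod c * L2h_norm D f"
    by (simp add: L2h_norm_nonneg power2_eq_iff_nonneg)
  assume z: "z \<in> D"
  have "((\<lambda>w. c * f w) has_derivative (\<lambda>X. c * frechet_derivative f (at z) X)) (at z)"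
    by (intro has_derivative_mult_right holomorphic_Cn_has_derivative(1)[OF holf D z])
  from fun_cong[OF frechet_derivative_at[OF this], of X]
  show "frechet_derivative (\<lambda>w. c * f w) (at z) X = c * frechet_derivative f (at z) X" by (rule sym)
qed

subsection \<open>The invariant metrics at a point\<close>

text \<open>The radius is one half so that a translate by a vector of l1 norm at most
  \<open>1 / 2\<close> stays within the l1 unit ball.\<close>

definition half_l1_ball :: "(complex ^ 'n::finite) set" where
  "half_l1_ball = {\<zeta>. (\<Sum>i\<in>UNIV. cmod (\<zeta> $ i)) < 1 / 2}"

lemma open_half_l1_ball: "open half_l1_ball"
  unfolding half_l1_ball_def by (intro open_Collect_less continuous_intros)

lemma borel_half_l1_ball [simp]: "half_l1_ball \<in> sets borel"
  by (rule borel_open[OF open_half_l1_ball])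

lemma emeasure_half_l1_ball:
  "emeasure lborel (half_l1_ball :: (complex ^ 'n::finite) set) = ennreal (measure lborel (half_l1_ball :: (complex ^ 'n) set))"
  "0 < measure lborel (half_l1_ball :: (complex ^ 'n) set)"
proof -
  let ?B = "half_l1_ball :: (complex ^ 'n) set"
  have "bounded ?B"
  proof (rule boundedI)
    fix x :: "complex ^ 'n" assume "x \<in> ?B"
    then show "norm x \<le> 1 / 2" using norm_vec_le_sum[of x] by (simp add: half_l1_ball_def)
  qed
  then have fin: "emeasure lborel ?B < \<infinity>" by (rule emeasure_bounded_finite)
  then show eq: "emeasure lborel ?B = ennreal (measure lborel ?B)"
    by (intro emeasure_eq_ennreal_measure) auto
  define r where "r = 1 / (2 * real CARD('n))"
  have r: "r > 0" by (simp add: r_def)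
  have "ball 0 r \<subseteq> ?B"
  proof
    fix x :: "complex ^ 'n" assume "x \<in> ball 0 r"
    then have x: "norm x < r" by simp
    have "(\<Sum>i\<in>UNIV. cmod (x $ i)) \<le> (\<Sum>i\<in>(UNIV::'n set). norm x)"
      by (intro sum_mono Finite_Cartesian_Product.norm_nth_le)
    also have "\<dots> = real CARD('n) * norm x" by simp
    also have "\<dots> < real CARD('n) * r" using x by simp
    also have "\<dots> = 1 / 2" by (simp add: r_def)
    finally show "x \<in> ?B" by (simp add: half_l1_ball_def)
  qed
  then have "emeasure lborel (ball (0 :: complex ^ 'n) r) \<le> emeasure lborel ?B"
    by (intro emeasure_mono) simp_all
  moreover have "emeasure lborel (ball (0 :: complex ^ 'n) r) > 0"
    using r by (simp add: emeasure_ball)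
  ultimately have "0 < emeasure lborel ?B" by (rule less_le_trans[rotated])
  then show "0 < measure lborel ?B" unfolding eq by simp
qed

lemma linear_matrix_vector_complex: "linear ((*v) (A :: complex ^ 'n ^ 'm))"
  by (rule linearI) (simp_all add: vec_eq_iff matrix_vector_mult_def algebra_simps sum.distrib scaleR_sum_right)

lemma frechet_derivative_linear:
  assumes "holomorphic_Cn_on f D" "open D" "z \<in> D"
  shows "linear (frechet_derivative f (at z))"
  using holomorphic_Cn_has_derivative(1)[OF assms] by (rule has_derivative_linear)

text \<open>What the maximal determinant leaves behind: coordinates \<open>A *v (w - z)\<close> in
  which \<open>D\<close> contains the l1 unit ball while no coordinate takes the value 1.
  \<open>\<kappa>\<close> is their Jacobian factor; \<open>\<beta>\<close> depends on the dimension
  alone.\<close>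

locale C_convex_frame =
  fixes D :: "(complex ^ 'n::finite) set" and z :: "complex ^ 'n" and A :: "complex ^ 'n ^ 'n" and \<kappa> \<beta> :: real
  assumes D: "C_convex_domain D" and z: "z \<in> D" and inv: "invertible A"
    and miss: "\<And>i w. w \<in> D \<Longrightarrow> lf (A $ i) (w - z) \<noteq> 1"
    and sub: "\<And>w. (\<Sum>i\<in>UNIV. cmod (lf (A $ i) (w - z))) < 1 \<Longrightarrow> w \<in> D"
    and \<beta>_eq: "\<beta> = measure lborel (half_l1_ball :: (complex ^ 'n) set)"
    and \<kappa>: "\<kappa> > 0"
    and scale: "\<And>h. h \<in> borel_measurable borel \<Longrightarrow> (\<integral>\<^sup>+x. h (A *v x) \<partial>lborel) = ennreal \<kappa> * (\<integral>\<^sup>+x. h x \<partial>lborel)"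

lemma exists_C_convex_frame:
  fixes D :: "(complex ^ 'n::finite) set"
  assumes D: "C_convex_domain D" and nl: "\<not> contains_complex_line D" and z: "z \<in> D"
  shows "\<exists>A \<kappa>. C_convex_frame D z A \<kappa> (measure lborel (half_l1_ball :: (complex ^ 'n) set))"
proof -
  obtain A :: "complex ^ 'n ^ 'n" where A: "invertible A" "\<And>i w. w \<in> D \<Longrightarrow> lf (A $ i) (w - z) \<noteq> 1"
    "\<And>w. (\<Sum>i\<in>UNIV. cmod (lf (A $ i) (w - z))) < 1 \<Longrightarrow> w \<in> D"
    using exists_supporting_matrix[OF D nl z] by blast
  obtain B where B: "A ** B = mat 1" "B ** A = mat 1" using A(1) unfolding invertible_def by blast
  have "bij ((*v) A)"
    by (rule bij_betw_byWitness[of _ "(*v) B"]) (simp_all add: matrix_vector_mul_assoc B)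
  then obtain \<kappa> :: real where "\<kappa> > 0"
    "\<And>h. h \<in> borel_measurable borel \<Longrightarrow> (\<integral>\<^sup>+x. h (A *v x) \<partial>lborel) = ennreal \<kappa> * (\<integral>\<^sup>+x. h x \<partial>lborel)"
    using nn_integral_linear_lborel[OF linear_matrix_vector_complex] by blast
  then have "C_convex_frame D z A \<kappa> (measure lborel (half_l1_ball :: (complex ^ 'n) set))"
    unfolding C_convex_frame_def using D z A by blast
  then show ?thesis by blast
qed

context C_convex_frame
begin

lemma opD: "open D"
  using D by (simp add: C_convex_domain_def domain_Cn_def)

abbreviation \<omega> :: real where "\<omega> \<equiv> measure lborel (ball (0::complex) 1)"

lemma \<beta>: "\<beta> > 0" unfolding \<beta>_eq by (rule emeasure_half_l1_ball(2))

lemma \<omega>: "\<omega> > 0" "emeasure lborel (ball (0::complex) 1) = ennreal \<omega>"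
proof -
  show eq: "emeasure lborel (ball (0::complex) 1) = ennreal \<omega>"
    using emeasure_lborel_ball_finite[of "0::complex" 1] by (intro emeasure_eq_ennreal_measure) auto
  have "0 < emeasure lborel (ball (0::complex) 1)" by (simp add: emeasure_ball)
  then show "\<omega> > 0" unfolding eq by simp
qed

abbreviation dz :: "(complex ^ 'n \<Rightarrow> complex) \<Rightarrow> complex ^ 'n \<Rightarrow> complex" where
  "dz f X \<equiv> frechet_derivative f (at z) X"

abbreviation M_values :: "complex ^ 'n \<Rightarrow> real set" where
  "M_values X \<equiv> {cmod (dz f X) |f. f \<in> L2h D \<and> L2h_norm D f = 1 \<and> f z = 0}"

lemma inverse_matrix: obtains B where "A ** B = mat 1" "B ** A = mat 1"
  using inv unfolding invertible_def by blast

text \<open>In the coordinates of \<open>A\<close> the half l1 ball around \<open>z + v\<close> lies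
  in the l1 unit ball, so the sub-mean inequality applies on a set of volume
  \<open>\<kappa> * \<beta>\<close>. The room left for \<open>v\<close> is what Cauchy's inequality
  will use.\<close>

lemma pointwise_bound:
  assumes f: "f \<in> L2h D" and v: "(\<Sum>i\<in>UNIV. cmod (lf (A $ i) v)) \<le> 1 / 2"
  shows "(cmod (f (z + v)))\<^sup>2 * (\<kappa> * \<beta>) \<le> (L2h_norm D f)\<^sup>2"
proof -
  let ?B = "(*v) A -` half_l1_ball"
  have Beq: "?B = {v. (\<Sum>i\<in>UNIV. cmod (lf (A $ i) v)) < 1 / 2}"
    by (auto simp: half_l1_ball_def matrix_vector_mult_nth_lf)
  have opB: "open ?B" unfolding Beq by (intro open_Collect_less continuous_intros)
  have "emeasure lborel ?B = (\<integral>\<^sup>+v. indicator ?B v \<partial>lborel)" using borel_open[OF opB] by simp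
  also have "\<dots> = (\<integral>\<^sup>+v. indicator half_l1_ball (A *v v) \<partial>lborel)"
    by (intro nn_integral_cong) (simp add: indicator_def)
  also have "\<dots> = ennreal \<kappa> * ennreal \<beta>"
    by (subst scale) (simp_all add: emeasure_half_l1_ball(1) \<beta>_eq borel_measurable_indicator)
  finally have vol: "emeasure lborel ?B = ennreal (\<kappa> * \<beta>)"
    using \<kappa> \<beta> by (simp add: ennreal_mult)
  have "ennreal ((cmod (f (z + v)))\<^sup>2) * emeasure lborel ?B \<le> sq_integral D f"
  proof (rule holomorphic_Cn_submean[OF _ opD opB])
    show "holomorphic_Cn_on f D" using f by (simp add: L2h_def)
    show "\<zeta> *s w \<in> ?B" if "w \<in> ?B" "cmod \<zeta> \<le> 1" for w \<zeta>
    proof -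
      have "(\<Sum>i\<in>UNIV. cmod (lf (A $ i) (\<zeta> *s w))) \<le> (\<Sum>i\<in>UNIV. cmod (lf (A $ i) w))"
        using that(2) by (intro sum_mono) (simp add: norm_mult mult_left_le_one_le)
      then show ?thesis using that(1) unfolding Beq by simp
    qed
    show "z + v + w \<in> D" if "w \<in> ?B" for w
    proof (rule sub)
      have "(\<Sum>i\<in>UNIV. cmod (lf (A $ i) (z + v + w - z))) \<le> (\<Sum>i\<in>UNIV. cmod (lf (A $ i) v) + cmod (lf (A $ i) w))"
        by (intro sum_mono) (simp add: norm_triangle_ineq)
      also have "\<dots> < 1" using v that unfolding Beq by (simp add: sum.distrib)
      finally show "(\<Sum>i\<in>UNIV. cmod (lf (A $ i) (z + v + w - z))) < 1" .
    qed
  qed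
  then have "ennreal ((cmod (f (z + v)))\<^sup>2 * (\<kappa> * \<beta>)) \<le> ennreal ((L2h_norm D f)\<^sup>2)"
    using \<kappa> \<beta> unfolding vol nn_integral_L2h[OF f] by (simp add: ennreal_mult)
  then show ?thesis by (simp add: ennreal_le_iff)
qed

text \<open>Expand \<open>X\<close> in the basis \<open>v\<close> dual to the rows of
  \<open>A\<close>. The coordinates of \<open>\<zeta> *s v j\<close> have l1 norm
  \<open>|\<zeta>|\<close>, so the unit disc in this direction stays in \<open>D\<close>, and
  Cauchy's inequality at radius \<open>1 / 2\<close> costs the factor 2.\<close>

lemma derivative_bound:
  assumes f: "f \<in> L2h D"
  shows "cmod (dz f X) \<le> (\<Sum>j\<in>UNIV. cmod (lf (A $ j) X)) * (2 / sqrt (\<kappa> * \<beta>)) * L2h_norm D f"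
proof -
  have holf: "holomorphic_Cn_on f D" using f by (simp add: L2h_def)
  obtain B where B: "A ** B = mat 1" "B ** A = mat 1" by (rule inverse_matrix)
  define v where "v = (\<lambda>j. B *v axis j 1)"
  have lv: "lf (A $ i) (v j) = (if i = j then 1 else 0)" for i j
    unfolding matrix_vector_mult_nth_lf[symmetric] v_def
    by (simp add: matrix_vector_mul_assoc B axis_def)
  have X: "X = (\<Sum>j\<in>UNIV. lf (A $ j) X *s v j)"
  proof -
    have "X = B *v (A *v X)" by (simp add: matrix_vector_mul_assoc B)
    also have "A *v X = (\<Sum>j\<in>UNIV. (A *v X) $ j *s axis j 1)" by (rule basis_expansion[symmetric])
    also have "B *v \<dots> = (\<Sum>j\<in>UNIV. B *v ((A *v X) $ j *s axis j 1))"
      using linear_sum[OF linear_matrix_vector_complex] by blast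
    also have "\<dots> = (\<Sum>j\<in>UNIV. lf (A $ j) X *s v j)"
      by (intro sum.cong refl) (simp add: v_def matrix_vector_mult_nth_lf vec.scale)
    finally show ?thesis .
  qed
  let ?N = "L2h_norm D f" and ?s = "sqrt (\<kappa> * \<beta>)"
  have s: "?s > 0" using \<kappa> \<beta> by simp
  have fv: "cmod (dz f (v j)) \<le> (2 / ?s) * ?N" for j
  proof -
    let ?h = "\<lambda>\<zeta>. f (z + \<zeta> *s v j)"
    have sumv: "(\<Sum>i\<in>UNIV. cmod (lf (A $ i) (\<zeta> *s v j))) = cmod \<zeta>" for \<zeta>
      by (simp add: lv norm_mult if_distrib[of "(*) _"] if_distrib[of cmod] cong: if_cong)
    have inD: "z + \<zeta> *s v j \<in> D" if "cmod \<zeta> < 1" for \<zeta>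
      by (rule sub) (use sumv that in simp)
    have hol: "?h holomorphic_on ball 0 1"
      by (rule holomorphic_on_subset[OF holomorphic_Cn_slice(1)[OF holf opD]]) (use inD in auto)
    have "cmod ((deriv ^^ 1) ?h 0) \<le> fact 1 * (?N / ?s) / (1 / 2) ^ 1"
    proof (rule Cauchy_inequality)
      show "?h holomorphic_on ball 0 (1 / 2)" by (rule holomorphic_on_subset[OF hol]) auto
      show "continuous_on (cball 0 (1 / 2)) ?h"
        by (rule continuous_on_subset[OF holomorphic_on_imp_continuous_on[OF hol]]) auto
      fix \<zeta> :: complex assume "cmod (0 - \<zeta>) = 1 / 2"
      then have "(cmod (?h \<zeta>))\<^sup>2 * (\<kappa> * \<beta>) \<le> ?N\<^sup>2"
        by (intro pointwise_bound f) (simp add: sumv[simplified])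
      then have "(cmod (?h \<zeta>) * ?s)\<^sup>2 \<le> ?N\<^sup>2"
        using \<kappa> \<beta> by (simp add: power_mult_distrib)
      then have "cmod (?h \<zeta>) * ?s \<le> ?N" by (rule power2_le_imp_le) (rule L2h_norm_nonneg)
      then show "cmod (?h \<zeta>) \<le> ?N / ?s" using s by (simp add: pos_le_divide_eq)
    qed simp
    then show ?thesis using holomorphic_Cn_slice(2)[OF holf opD z] by (simp add: mult.commute)
  qed
  have "dz f X = (\<Sum>j\<in>UNIV. lf (A $ j) X * dz f (v j))"
    by (subst X) (simp add: linear_sum[OF frechet_derivative_linear[OF holf opD z]]
        holomorphic_Cn_has_derivative(2)[OF holf opD z])
  also have "cmod \<dots> \<le> (\<Sum>j\<in>UNIV. cmod (lf (A $ j) X) * ((2 / ?s) * ?N))"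
    by (rule order_trans[OF norm_sum]) (intro sum_mono, simp only: norm_mult, intro mult_left_mono fv norm_ge_zero)
  also have "\<dots> = (\<Sum>j\<in>UNIV. cmod (lf (A $ j) X)) * (2 / ?s) * ?N"
    by (simp only: sum_distrib_right mult.assoc)
  finally show ?thesis .
qed

section \<open>Square-integrable functions from Riemann maps of projections\<close>

lemma zero_in_image: "0 \<in> (\<lambda>w. lf a (w - z)) ` D"
  by (rule image_eqI[of _ _ z]) (simp_all add: z)

lemma row_nonzero: "A $ i \<noteq> 0"
proof
  assume "A $ i = 0"
  obtain B where "A ** B = mat 1" by (rule inverse_matrix)
  then have "(A *v (B *v axis i 1)) $ i = 1" by (simp add: matrix_vector_mul_assoc axis_def)
  then show False unfolding matrix_vector_mult_nth_lf by (simp add: \<open>A $ i = 0\<close> lf_simps_left)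
qed

lemma exists_disc_function:
  assumes b: "b \<noteq> 0" "\<And>w. w \<in> D \<Longrightarrow> lf b (w - z) \<noteq> 1"
  obtains \<phi> where "\<phi> holomorphic_on (\<lambda>w. lf b (w - z)) ` D" "inj_on \<phi> ((\<lambda>w. lf b (w - z)) ` D)"
    "\<phi> ` (\<lambda>w. lf b (w - z)) ` D = ball 0 1" "\<phi> 0 = 0" "1 / 4 \<le> cmod (deriv \<phi> 0)"
proof (rule exists_biholomorphism_to_disc_deriv_ge[OF functional_image_simply_connected[OF D b(1), of z] zero_in_image])
  show "1 \<notin> (\<lambda>w. lf b (w - z)) ` D" using b(2) by fastforce
qed blast

text \<open>In the coordinates of \<open>A\<close>, \<open>|F|^2\<close> is the real Jacobian of the
  product of the Riemann maps. \<open>D\<close> lies in the product of the domains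
  \<open>?\<Omega> i\<close>, over which the integral factors into areas of unit discs;
  \<open>\<kappa>\<close> comes from the change of coordinates.\<close>

lemma exists_L2h_large:
  obtains F where "F \<in> L2h D" "(L2h_norm D F)\<^sup>2 \<le> \<kappa> * \<omega> ^ CARD('n)" "(1 / 4) ^ CARD('n) \<le> cmod (F z)"
proof -
  let ?\<Omega> = "\<lambda>i. (\<lambda>w. lf (A $ i) (w - z)) ` D"
  have op: "open (?\<Omega> i)" for i by (rule functional_image_simply_connected(1)[OF D row_nonzero])
  define P where "P = (\<lambda>i \<phi>. \<phi> holomorphic_on ?\<Omega> i \<and> inj_on \<phi> (?\<Omega> i) \<and> \<phi> ` ?\<Omega> i = ball 0 1 \<and> 1 / 4 \<le> cmod (deriv \<phi> 0))"
  have "\<exists>\<phi>. P i \<phi>" for i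
  proof -
    obtain \<phi> where "\<phi> holomorphic_on ?\<Omega> i" "inj_on \<phi> (?\<Omega> i)" "\<phi> ` ?\<Omega> i = ball 0 1" "1 / 4 \<le> cmod (deriv \<phi> 0)"
      by (rule exists_disc_function[OF row_nonzero miss, of i])
    then show ?thesis unfolding P_def by (intro exI[of _ \<phi>] conjI)
  qed
  then obtain \<phi> where "\<And>i. P i (\<phi> i)" by metis
  then have \<phi>: "\<phi> i holomorphic_on ?\<Omega> i" "inj_on (\<phi> i) (?\<Omega> i)"
    "\<phi> i ` ?\<Omega> i = ball 0 1" "1 / 4 \<le> cmod (deriv (\<phi> i) 0)" for i
    unfolding P_def by blast+
  define F where "F = (\<lambda>w. \<Prod>i\<in>UNIV. deriv (\<phi> i) (lf (A $ i) (w - z)))"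
  have holF: "holomorphic_Cn_on F D"
    unfolding F_def
  proof (intro holomorphic_Cn_on_prod opD finite)
    fix i
    show "holomorphic_Cn_on (\<lambda>w. deriv (\<phi> i) (lf (A $ i) (w - z))) D"
      by (rule holomorphic_Cn_on_compose_lf(1)[OF holomorphic_deriv[OF \<phi>(1) op] op]) auto
  qed
  define g where "g = (\<lambda>i \<zeta>. ennreal ((cmod (deriv (\<phi> i) \<zeta>))\<^sup>2) * indicator (?\<Omega> i) \<zeta>)"
  have gm [measurable]: "g i \<in> borel_measurable borel" for i
    unfolding g_def by (rule borel_measurable_deriv_sq_indicator[OF \<phi>(1) op borel_open[OF op] subset_refl])
  have gint: "(\<integral>\<^sup>+\<zeta>. g i \<zeta> \<partial>lborel) = ennreal \<omega>" for i
  proof -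
    have "emeasure lborel (\<phi> i ` ?\<Omega> i) = (\<integral>\<^sup>+\<zeta>. g i \<zeta> \<partial>lborel)"
      unfolding g_def
      by (rule emeasure_injective_holomorphic_image[OF \<phi>(1) op \<phi>(2)])
         (simp_all only: \<phi>(3) borel_open[OF op] bounded_ball subset_refl)
    then show ?thesis unfolding \<phi>(3) \<omega>(2) by simp
  qed
  have [measurable]: "(\<lambda>x :: complex ^ 'n. x $ i) \<in> borel_measurable borel" for i
    by (intro borel_measurable_continuous_onI continuous_intros)
  have [measurable]: "(\<lambda>x :: complex ^ 'n. A *v x) \<in> borel_measurable borel"
    by (intro borel_measurable_continuous_onI linear_continuous_on)
       (simp add: linear_conv_bounded_linear[symmetric] linear_matrix_vector_complex)
  have "sq_integral D F \<le> (\<integral>\<^sup>+w. (\<Prod>i\<in>UNIV. g i ((A *v (- z + w)) $ i)) \<partial>lborel)"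
  proof (intro nn_integral_mono)
    fix w
    show "ennreal ((cmod (F w))\<^sup>2) * indicator D w \<le> (\<Prod>i\<in>UNIV. g i ((A *v (- z + w)) $ i))"
    proof (cases "w \<in> D")
      case True
      have "(\<Prod>i\<in>UNIV. g i ((A *v (- z + w)) $ i)) = (\<Prod>i\<in>UNIV. ennreal ((cmod (deriv (\<phi> i) (lf (A $ i) (w - z))))\<^sup>2))"
        using True by (intro prod.cong refl) (simp add: g_def matrix_vector_mult_nth_lf)
      also have "\<dots> = ennreal ((cmod (F w))\<^sup>2)"
        by (simp add: prod_ennreal F_def prod_norm[symmetric] prod_power_distrib)
      finally show ?thesis using True by simp
    qed simp
  qed
  also have "\<dots> = (\<integral>\<^sup>+w. (\<Prod>i\<in>UNIV. g i ((A *v w) $ i)) \<partial>lborel)"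
    by (rule nn_integral_translate[OF sets_lborel lborel_distr_plus]) measurable
  also have "\<dots> = ennreal \<kappa> * (\<integral>\<^sup>+x. (\<Prod>i\<in>UNIV. g i (x $ i)) \<partial>lborel)"
    by (rule scale) measurable
  also have "\<dots> = ennreal \<kappa> * ennreal \<omega> ^ CARD('n)"
    by (subst nn_integral_prod_vec) (simp_all add: gint)
  also have "\<dots> = ennreal (\<kappa> * \<omega> ^ CARD('n))"
    using \<kappa> \<omega> by (simp add: ennreal_mult ennreal_power)
  finally have le: "sq_integral D F \<le> ennreal (\<kappa> * \<omega> ^ CARD('n))" .
  have C: "\<kappa> * \<omega> ^ CARD('n) \<ge> 0" using \<kappa> \<omega> by simp
  show thesis
  proof (rule that[OF L2hI[OF holF opD le C]])
    have "(1 / 4) ^ CARD('n) = (\<Prod>i\<in>(UNIV::'n set). 1 / 4 :: real)" by simp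
    also have "\<dots> \<le> (\<Prod>i\<in>UNIV. cmod (deriv (\<phi> i) 0))" by (intro prod_mono) (use \<phi>(4) in auto)
    also have "\<dots> = cmod (F z)" by (simp add: F_def prod_norm)
    finally show "(1 / 4) ^ CARD('n) \<le> cmod (F z)" .
  qed
qed

section \<open>Radii of discs in \<open>D\<close> and functions into the unit disc\<close>

definition radii :: "complex ^ 'n \<Rightarrow> real set" where
  "radii X = {r. r > 0 \<and> (\<forall>\<zeta>. cmod \<zeta> < r \<longrightarrow> z + \<zeta> *s X \<in> D)}"

definition disc_functions :: "(complex ^ 'n \<Rightarrow> complex) set" where
  "disc_functions = {f. holomorphic_Cn_on f D \<and> f ` D \<subseteq> ball 0 1 \<and> f z = 0}"

text \<open>Otherwise the disc of radius \<open>r\<close> in direction \<open>X\<close> would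
  contain a point at which the functional equals 1.\<close>

lemma row_le_inverse_radius:
  assumes r: "r \<in> radii X"
  shows "cmod (lf (A $ i) X) \<le> 1 / r"
proof (rule ccontr)
  assume "\<not> ?thesis"
  then have gt: "1 / r < cmod (lf (A $ i) X)" by simp
  have r0: "r > 0" using r by (simp add: radii_def)
  then have nz: "lf (A $ i) X \<noteq> 0" using gt by auto
  define \<zeta> where "\<zeta> = 1 / lf (A $ i) X"
  have "cmod \<zeta> = 1 / cmod (lf (A $ i) X)" by (simp add: \<zeta>_def norm_divide)
  also have "\<dots> < r" using gt r0 nz by (simp add: divide_less_eq mult.commute)
  finally have "z + \<zeta> *s X \<in> D" using r by (simp add: radii_def)
  from miss[OF this, of i] show False using nz by (simp add: \<zeta>_def)
qed

lemma radii_nonempty: "radii X \<noteq> {}"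
proof -
  have "open {\<zeta>. z + \<zeta> *s X \<in> D}" "0 \<in> {\<zeta>. z + \<zeta> *s X \<in> D}" using open_slice[OF opD] z by auto
  then obtain r where r: "r > 0" "ball 0 r \<subseteq> {\<zeta>. z + \<zeta> *s X \<in> D}" by (rule openE)
  then have "r \<in> radii X" by (auto simp: radii_def)
  then show ?thesis by blast
qed

text \<open>Invertibility of \<open>A\<close> provides a row that does not vanish on
  \<open>X\<close>, and this row bounds all radii.\<close>

lemma bdd_above_radii:
  assumes "X \<noteq> 0"
  shows "bdd_above (radii X)"
proof -
  obtain B where B: "B ** A = mat 1" by (rule inverse_matrix)
  have "A *v X \<noteq> 0"
  proof
    assume "A *v X = 0"
    then have "B *v (A *v X) = 0" by (simp add: matrix_vector_mult_0_right)
    then show False using assms by (simp add: matrix_vector_mul_assoc B)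
  qed
  then obtain i where i: "lf (A $ i) X \<noteq> 0" by (auto simp: vec_eq_iff matrix_vector_mult_nth_lf)
  show ?thesis
  proof (rule bdd_aboveI)
    fix r assume r: "r \<in> radii X"
    then have "r > 0" by (simp add: radii_def)
    then show "r \<le> 1 / cmod (lf (A $ i) X)"
      using row_le_inverse_radius[OF r, of i] i by (simp add: field_simps)
  qed
qed

text \<open>Cauchy's inequality at radius \<open>r / 2\<close>. The constant is crude, since the
  bound serves to make the Caratheodory supremum finite.\<close>

lemma disc_functions_bound:
  assumes g: "g \<in> disc_functions" and r: "r \<in> radii X"
  shows "cmod (dz g X) \<le> 2 / r"
proof -
  have holg: "holomorphic_Cn_on g D" and im: "\<And>w. w \<in> D \<Longrightarrow> cmod (g w) < 1"
    using g by (auto simp: disc_functions_def)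
  have r0: "r > 0" and inD: "\<And>\<zeta>. cmod \<zeta> < r \<Longrightarrow> z + \<zeta> *s X \<in> D" using r by (auto simp: radii_def)
  let ?h = "\<lambda>\<zeta>. g (z + \<zeta> *s X)"
  have hol: "?h holomorphic_on ball 0 r"
    by (rule holomorphic_on_subset[OF holomorphic_Cn_slice(1)[OF holg opD]]) (use inD in auto)
  have "cmod ((deriv ^^ 1) ?h 0) \<le> fact 1 * 1 / (r / 2) ^ 1"
  proof (rule Cauchy_inequality)
    show "?h holomorphic_on ball 0 (r / 2)" by (rule holomorphic_on_subset[OF hol]) (use r0 in auto)
    show "continuous_on (cball 0 (r / 2)) ?h"
      by (rule continuous_on_subset[OF holomorphic_on_imp_continuous_on[OF hol]]) (use r0 in auto)
    fix \<zeta> :: complex assume "cmod (0 - \<zeta>) = r / 2"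
    then have "z + \<zeta> *s X \<in> D" using r0 by (intro inD) simp
    then show "cmod (?h \<zeta>) \<le> 1" using im less_imp_le by blast
  qed (use r0 in simp)
  then show ?thesis using holomorphic_Cn_slice(2)[OF holg opD z] by simp
qed

lemma bdd_above_disc_functions: "bdd_above ((\<lambda>g. cmod (dz g X)) ` disc_functions)"
proof -
  obtain r where "r \<in> radii X" using radii_nonempty by blast
  then show ?thesis using disc_functions_bound by (intro bdd_aboveI2)
qed

text \<open>A hyperplane through the missing point and disjoint from \<open>D\<close> gives
  \<open>b\<close> with \<open>lf b X = 1 / \<zeta>\<close>; the Riemann map of the projection by
  \<open>b\<close> contributes the factor \<open>1 / 4\<close>.\<close>

lemma exists_disc_function_deriv_ge:
  assumes q: "z + \<zeta> *s X \<notin> D"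
  obtains g where "g \<in> disc_functions" "1 / (4 * cmod \<zeta>) \<le> cmod (dz g X)"
proof -
  obtain b where b: "\<And>w. w \<in> D \<Longrightarrow> lf b (w - z) \<noteq> 1" "lf b (z + \<zeta> *s X - z) = 1"
    using exists_normalized_hyperplane[OF D z q] by blast
  have b1: "\<zeta> * lf b X = 1" using b(2) by simp
  have "b \<noteq> 0"
  proof
    assume "b = 0"
    then show False using b1 by (simp add: lf_simps_left)
  qed
  obtain \<phi> where \<phi>: "\<phi> holomorphic_on (\<lambda>w. lf b (w - z)) ` D" "inj_on \<phi> ((\<lambda>w. lf b (w - z)) ` D)"
    "\<phi> ` (\<lambda>w. lf b (w - z)) ` D = ball 0 1" "\<phi> 0 = 0" "1 / 4 \<le> cmod (deriv \<phi> 0)"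
    by (rule exists_disc_function[OF \<open>b \<noteq> 0\<close> b(1)])
  have op: "open ((\<lambda>w. lf b (w - z)) ` D)" by (rule functional_image_simply_connected(1)[OF D \<open>b \<noteq> 0\<close>])
  define g where "g = (\<lambda>w. \<phi> (lf b (w - z)))"
  have holg: "holomorphic_Cn_on g D"
    unfolding g_def by (rule holomorphic_Cn_on_compose_lf(1)[OF \<phi>(1) op]) auto
  have dg: "dz g X = deriv \<phi> 0 * lf b X"
    using holomorphic_Cn_on_compose_lf(2)[OF \<phi>(1) op _ z, of b z X] by (simp add: g_def \<open>b \<noteq> 0\<close>)
  show thesis
  proof
    show "g \<in> disc_functions"
    proof -
      have "\<phi> (lf b (w - z)) \<in> ball 0 1" if "w \<in> D" for w
        unfolding \<phi>(3)[symmetric] using that by (intro imageI)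
      then have "g ` D \<subseteq> ball 0 1" unfolding g_def by blast
      moreover have "g z = 0" by (simp add: g_def \<phi>(4))
      ultimately show ?thesis using holg by (simp only: disc_functions_def mem_Collect_eq)
    qed
    have "cmod \<zeta> * cmod (lf b X) = 1" using b1 by (metis norm_mult norm_one)
    moreover from this have "cmod \<zeta> \<noteq> 0" by auto
    ultimately have "cmod (lf b X) = 1 / cmod \<zeta>" by (simp add: eq_divide_eq mult.commute)
    then have "cmod (dz g X) = cmod (deriv \<phi> 0) * (1 / cmod \<zeta>)"
      by (simp add: dg norm_mult)
    also have "\<dots> \<ge> 1 / 4 * (1 / cmod \<zeta>)" by (intro mult_right_mono \<phi>(5)) simp
    finally show "1 / (4 * cmod \<zeta>) \<le> cmod (dz g X)" by simp
  qed
qed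

section \<open>Bergman kernel, Bergman metric and their comparison with disc functions\<close>

abbreviation K :: real where "K \<equiv> bergman_kernel_diag D z"

lemma kernel_ge:
  assumes f: "f \<in> L2h D" "L2h_norm D f \<le> 1"
  shows "(cmod (f z))\<^sup>2 \<le> K"
  unfolding bergman_kernel_diag_def
proof (rule cSup_upper)
  show "(cmod (f z))\<^sup>2 \<in> {(cmod (f z))\<^sup>2 |f. f \<in> L2h D \<and> L2h_norm D f \<le> 1}" using f by blast
  show "bdd_above {(cmod (f z))\<^sup>2 |f. f \<in> L2h D \<and> L2h_norm D f \<le> 1}"
  proof (rule bdd_aboveI, clarify)
    fix f assume f: "f \<in> L2h D" "L2h_norm D f \<le> 1"
    have "(cmod (f (z + 0)))\<^sup>2 * (\<kappa> * \<beta>) \<le> (L2h_norm D f)\<^sup>2" by (rule pointwise_bound[OF f(1)]) simp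
    also have "\<dots> \<le> 1" by (rule power_le_one[OF L2h_norm_nonneg f(2)])
    finally show "(cmod (f z))\<^sup>2 \<le> 1 / (\<kappa> * \<beta>)" using \<kappa> \<beta> by (simp add: pos_le_divide_eq)
  qed
qed

lemma kernel_lower_bound: "(1 / 4) ^ CARD('n) / sqrt (\<kappa> * \<omega> ^ CARD('n)) \<le> sqrt K" "0 < K"
proof -
  obtain F where F: "F \<in> L2h D" "(L2h_norm D F)\<^sup>2 \<le> \<kappa> * \<omega> ^ CARD('n)" "(1 / 4) ^ CARD('n) \<le> cmod (F z)"
    by (rule exists_L2h_large)
  have Fz: "0 < cmod (F z)" using F(3) by (rule less_le_trans[rotated]) simp
  let ?N = "L2h_norm D F" and ?s = "sqrt (\<kappa> * \<omega> ^ CARD('n))"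
  have N: "?N > 0"
  proof -
    have "(cmod (F (z + 0)))\<^sup>2 * (\<kappa> * \<beta>) \<le> ?N\<^sup>2" by (rule pointwise_bound[OF F(1)]) simp
    moreover have "0 < (cmod (F (z + 0)))\<^sup>2 * (\<kappa> * \<beta>)" using Fz \<kappa> \<beta> by simp
    ultimately have "0 < ?N\<^sup>2" by linarith
    then show ?thesis using L2h_norm_nonneg[of D F] by (cases "?N = 0") auto
  qed
  have Ns: "?N \<le> ?s" using F(2) by (rule real_le_rsqrt)
  have "(cmod (of_real (1 / ?N) * F z))\<^sup>2 \<le> K"
    using L2h_scale[OF F(1) opD, of "of_real (1 / ?N)"] N by (intro kernel_ge) (simp_all add: norm_divide)
  then have K: "(cmod (F z) / ?N)\<^sup>2 \<le> K" using N by (simp add: norm_mult norm_divide)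
  moreover have "0 < (cmod (F z) / ?N)\<^sup>2" using Fz N by simp
  ultimately show "0 < K" by linarith
  have "(1 / 4) ^ CARD('n) / ?s \<le> cmod (F z) / ?N" using F(3) N Ns by (intro frac_le) auto
  also have "\<dots> \<le> sqrt K" using K by (rule real_le_rsqrt)
  finally show "(1 / 4) ^ CARD('n) / ?s \<le> sqrt K" .
qed

text \<open>Homogeneous form of the supremum. Functions of norm 0 cannot be normalised; for them
  \<open>derivative_bound\<close> makes the derivative vanish.\<close>

lemma bergman_M_ge:
  assumes f: "f \<in> L2h D" "f z = 0"
  shows "cmod (dz f X) \<le> bergman_M D z X * L2h_norm D f"
proof (cases "L2h_norm D f = 0")
  case True
  then show ?thesis using derivative_bound[OF f(1), of X] by simp
next
  case False
  let ?N = "L2h_norm D f"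
  have N: "?N > 0" using False L2h_norm_nonneg[of D f] by simp
  let ?g = "\<lambda>w. of_real (1 / ?N) * f w"
  note g = L2h_scale[OF f(1) opD, where c = "of_real (1 / ?N)"]
  have "cmod (frechet_derivative ?g (at z) X) \<le> bergman_M D z X"
    unfolding bergman_M_def
  proof (rule cSup_upper)
    show "cmod (frechet_derivative ?g (at z) X) \<in> M_values X"
      using g(1,2) N f(2) by (intro CollectI exI[of _ ?g]) (simp add: norm_divide)
    show "bdd_above (M_values X)"
    proof (rule bdd_aboveI, clarify)
      fix h assume "h \<in> L2h D" "L2h_norm D h = 1"
      then show "cmod (dz h X) \<le> (\<Sum>j\<in>UNIV. cmod (lf (A $ j) X)) * (2 / sqrt (\<kappa> * \<beta>))"
        using derivative_bound[of h X] by simp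
    qed
  qed
  moreover have "cmod (frechet_derivative ?g (at z) X) = cmod (dz f X) / ?N"
    unfolding g(3)[OF z] using N by (simp add: norm_mult norm_divide)
  ultimately show ?thesis using N by (simp add: divide_le_eq)
qed

text \<open>The device linking the Caratheodory and Bergman metrics: the factor \<open>g\<close>,
  bounded by 1 and zero at \<open>z\<close>, does not increase the norm and turns the value
  \<open>f z\<close> into a derivative.\<close>

lemma L2h_mult_disc_function:
  assumes f: "f \<in> L2h D" and g: "g \<in> disc_functions"
  shows "(\<lambda>w. f w * g w) \<in> L2h D" "L2h_norm D (\<lambda>w. f w * g w) \<le> L2h_norm D f"
    "dz (\<lambda>w. f w * g w) X = f z * dz g X" "f z * g z = 0"
proof -
  have holf: "holomorphic_Cn_on f D" using f by (simp add: L2h_def)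
  have holg: "holomorphic_Cn_on g D" and im: "\<And>w. w \<in> D \<Longrightarrow> cmod (g w) \<le> 1" and gz: "g z = 0"
    using g by (auto simp: disc_functions_def image_subset_iff intro: less_imp_le)
  note hol = holomorphic_Cn_on_mult[OF holf holg opD]
  have "(\<integral>\<^sup>+w. ennreal ((cmod (f w * g w))\<^sup>2) * indicator D w \<partial>lborel) \<le> sq_integral D f"
  proof (intro nn_integral_mono)
    fix w
    have "(cmod (f w * g w))\<^sup>2 \<le> (cmod (f w))\<^sup>2" if "w \<in> D"
      using im[OF that] by (simp add: norm_mult mult_left_le power_mono)
    then show "ennreal ((cmod (f w * g w))\<^sup>2) * indicator D w \<le> ennreal ((cmod (f w))\<^sup>2) * indicator D w"
      by (auto split: split_indicator intro: ennreal_leI)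
  qed
  then have le: "(\<integral>\<^sup>+w. ennreal ((cmod (f w * g w))\<^sup>2) * indicator D w \<partial>lborel) \<le> ennreal ((L2h_norm D f)\<^sup>2)"
    unfolding nn_integral_L2h[OF f] .
  note * = L2hI[OF hol(1) opD le zero_le_power2]
  show "(\<lambda>w. f w * g w) \<in> L2h D" by (rule *(1))
  show "L2h_norm D (\<lambda>w. f w * g w) \<le> L2h_norm D f"
    using *(2) L2h_norm_nonneg by (rule power2_le_imp_le)
  show "dz (\<lambda>w. f w * g w) X = f z * dz g X"
    using hol(2)[OF z] gz by simp
  show "f z * g z = 0" using gz by simp
qed

text \<open>Ensures that the supremum \<open>bergman_M\<close> is not over the empty set. The
  competitor is a multiple of \<open>F * g\<close>, with \<open>g\<close> of nonzero derivative at
  \<open>z\<close>: row \<open>i\<close> equals 1 on \<open>B *v axis i 1\<close>, so this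
  displacement of \<open>z\<close> leaves \<open>D\<close> and yields \<open>g\<close>.\<close>

lemma admissible_nonempty: "\<exists>f. f \<in> L2h D \<and> L2h_norm D f = 1 \<and> f z = 0"
proof -
  obtain F where F: "F \<in> L2h D" "(1 / 4) ^ CARD('n) \<le> cmod (F z)" by (rule exists_L2h_large)
  have Fz: "F z \<noteq> 0" using less_le_trans[OF _ F(2), of 0] by auto
  define i :: 'n where "i = undefined"
  obtain B where B: "A ** B = mat 1" by (rule inverse_matrix)
  have "lf (A $ i) (B *v axis i 1) = 1"
    unfolding matrix_vector_mult_nth_lf[symmetric] by (simp add: matrix_vector_mul_assoc B axis_def)
  then have "z + 1 *s (B *v axis i 1) \<notin> D" using miss[of "z + 1 *s (B *v axis i 1)" i] by auto
  then obtain g where g: "g \<in> disc_functions"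
    "1 / (4 * cmod 1) \<le> cmod (dz g (B *v axis i 1))"
    by (rule exists_disc_function_deriv_ge)
  let ?h = "\<lambda>w. F w * g w"
  note h = L2h_mult_disc_function[OF F(1) g(1)]
  have N: "L2h_norm D ?h > 0"
  proof (rule ccontr)
    assume "\<not> ?thesis"
    then have "L2h_norm D ?h = 0" using L2h_norm_nonneg[of D ?h] by simp
    then have "frechet_derivative ?h (at z) (B *v axis i 1) = 0" using derivative_bound[OF h(1), of "B *v axis i 1"] by simp
    then show False using h(3)[of "B *v axis i 1"] Fz g(2) by auto
  qed
  let ?k = "\<lambda>w. of_real (1 / L2h_norm D ?h) * ?h w"
  have "?k \<in> L2h D \<and> L2h_norm D ?k = 1 \<and> ?k z = 0"
    using L2h_scale(1,2)[OF h(1) opD, of "of_real (1 / L2h_norm D ?h)"] h(4) N by (simp add: norm_divide)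
  then show ?thesis by (rule exI[of _ ?k])
qed

lemma bergman_M_nonneg: "0 \<le> bergman_M D z X"
proof -
  obtain f where f: "f \<in> L2h D" "L2h_norm D f = 1" "f z = 0" using admissible_nonempty by blast
  then show ?thesis using order_trans[OF norm_ge_zero bergman_M_ge[OF f(1,3)]] by simp
qed

lemma bergman_metric_nonneg: "0 \<le> bergman_metric D z X"
  unfolding bergman_metric_def using bergman_M_nonneg kernel_lower_bound(2) by simp

text \<open>For \<open>f\<close> in the unit ball of \<open>L2h D\<close> the product
  \<open>f * g\<close> competes in \<open>bergman_M\<close>, which bounds \<open>|f z|\<close> by
  \<open>?M / ?a\<close>; the supremum over \<open>f\<close> bounds \<open>sqrt K\<close>.\<close>

lemma disc_function_le_bergman:
  assumes g: "g \<in> disc_functions"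
  shows "cmod (dz g X) \<le> bergman_metric D z X"
proof (cases "dz g X = 0")
  case True
  then show ?thesis using bergman_metric_nonneg by simp
next
  case False
  let ?a = "cmod (dz g X)" and ?M = "bergman_M D z X"
  have a: "?a > 0" using False by simp
  have "K \<le> (?M / ?a)\<^sup>2"
    unfolding bergman_kernel_diag_def
  proof (rule cSup_least)
    have "(\<lambda>_. 0) \<in> L2h D" "(L2h_norm D (\<lambda>_. 0))\<^sup>2 \<le> 0"
      using L2hI[OF holomorphic_Cn_on_const[of 0] opD, of 0] by simp_all
    then show "{(cmod (f z))\<^sup>2 |f. f \<in> L2h D \<and> L2h_norm D f \<le> 1} \<noteq> {}" by force
    fix x assume "x \<in> {(cmod (f z))\<^sup>2 |f. f \<in> L2h D \<and> L2h_norm D f \<le> 1}"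
    then obtain f where f: "f \<in> L2h D" "L2h_norm D f \<le> 1" "x = (cmod (f z))\<^sup>2" by blast
    note h = L2h_mult_disc_function[OF f(1) g]
    have "cmod (f z) * ?a \<le> ?M * L2h_norm D (\<lambda>w. f w * g w)"
      using bergman_M_ge[OF h(1,4), of X] by (simp add: h(3) norm_mult)
    also have "\<dots> \<le> ?M * 1" using h(2) f(2) by (intro mult_left_mono bergman_M_nonneg) simp
    finally have "cmod (f z) \<le> ?M / ?a" using a by (simp add: pos_le_divide_eq)
    then show "x \<le> (?M / ?a)\<^sup>2" unfolding f(3) by (intro power_mono) auto
  qed
  then have "sqrt K \<le> ?M / ?a" using bergman_M_nonneg a by (intro real_le_lsqrt) auto
  then show ?thesis
    using a kernel_lower_bound(2) by (simp add: bergman_metric_def pos_le_divide_eq mult.commute)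
qed

lemma caratheodory_eq: "caratheodory_metric D z X = Sup ((\<lambda>g. cmod (dz g X)) ` disc_functions)"
  unfolding caratheodory_metric_def disc_functions_def by (rule arg_cong[of _ _ Sup]) auto

lemma zero_disc_function: "(\<lambda>_. 0) \<in> disc_functions"
  by (auto simp: disc_functions_def holomorphic_Cn_on_const)

lemma caratheodory_le_bergman: "caratheodory_metric D z X \<le> bergman_metric D z X"
  unfolding caratheodory_eq using zero_disc_function
  by (intro cSUP_least disc_function_le_bergman) auto

lemma le_caratheodory:
  assumes "g \<in> disc_functions"
  shows "cmod (dz g X) \<le> caratheodory_metric D z X"
  unfolding caratheodory_eq by (rule cSUP_upper[OF assms bdd_above_disc_functions])

lemma caratheodory_nonneg: "0 \<le> caratheodory_metric D z X"
  using order_trans[OF norm_ge_zero le_caratheodory[OF zero_disc_function]] .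

text \<open>In \<open>?b\<close>, \<open>real ?n * (1 / r)\<close> comes from the rows, each at most
  \<open>1 / r\<close> on \<open>X\<close>, and \<open>2 / sqrt (\<kappa> * \<beta>)\<close> from
  \<open>derivative_bound\<close>. Dividing by the kernel bound cancels
  \<open>\<kappa>\<close>.\<close>

lemma bergman_mult_radius_le:
  assumes r: "r \<in> radii X"
  shows "bergman_metric D z X * r \<le> 2 * real CARD('n) * 4 ^ CARD('n) * sqrt (\<omega> ^ CARD('n) / \<beta>)"
proof -
  let ?n = "CARD('n)"
  have r0: "r > 0" using r by (simp add: radii_def)
  let ?b = "real ?n * (1 / r) * (2 / sqrt (\<kappa> * \<beta>))"
  have "bergman_M D z X \<le> ?b"
    unfolding bergman_M_def
  proof (rule cSup_least)
    show "M_values X \<noteq> {}"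
      using admissible_nonempty by blast
    fix x assume "x \<in> M_values X"
    then obtain f where f: "f \<in> L2h D" "L2h_norm D f = 1" "x = cmod (dz f X)" by blast
    have "x \<le> (\<Sum>j\<in>UNIV. cmod (lf (A $ j) X)) * (2 / sqrt (\<kappa> * \<beta>))"
      using derivative_bound[OF f(1), of X] by (simp add: f(2,3))
    also have "\<dots> \<le> (\<Sum>j\<in>(UNIV::'n set). 1 / r) * (2 / sqrt (\<kappa> * \<beta>))"
      using \<kappa> \<beta> by (intro mult_right_mono sum_mono row_le_inverse_radius[OF r]) auto
    finally show "x \<le> ?b" by simp
  qed
  then have "bergman_metric D z X \<le> ?b / ((1 / 4) ^ ?n / sqrt (\<kappa> * \<omega> ^ ?n))"
    unfolding bergman_metric_def using kernel_lower_bound \<kappa> \<omega> \<beta> r0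
    by (intro frac_le) auto
  then have "bergman_metric D z X * r \<le> ?b / ((1 / 4) ^ ?n / sqrt (\<kappa> * \<omega> ^ ?n)) * r"
    using r0 by (intro mult_right_mono) auto
  also have "\<dots> = 2 * real ?n * 4 ^ ?n * (sqrt (\<kappa> * \<omega> ^ ?n) / sqrt (\<kappa> * \<beta>))"
    using r0 by (simp add: field_simps power_divide)
  also have "sqrt (\<kappa> * \<omega> ^ ?n) / sqrt (\<kappa> * \<beta>) = sqrt (\<omega> ^ ?n / \<beta>)"
    using \<kappa> by (simp add: real_sqrt_divide[symmetric])
  finally show ?thesis .
qed

lemma line_dist_eq: "line_dist D z X = Sup (radii X)"
  by (simp add: line_dist_def radii_def)

text \<open>For \<open>a > 0\<close> the estimate itself bounds the radii; for \<open>a = 0\<close>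
  any single radius shows \<open>0 \<le> c\<close>. Thus \<open>X = 0\<close>, where
  \<open>radii\<close> is unbounded, is covered as well.\<close>

lemma mult_line_dist_le:
  assumes a: "a \<ge> 0" and le: "\<And>r. r \<in> radii X \<Longrightarrow> a * r \<le> c"
  shows "a * line_dist D z X \<le> c"
proof (cases "a = 0")
  case True
  obtain r where "r \<in> radii X" using radii_nonempty by blast
  then show ?thesis using le[of r] True by simp
next
  case False
  then have a: "a > 0" using a by simp
  have "Sup (radii X) \<le> c / a"
    using le a by (intro cSup_least radii_nonempty) (simp add: pos_le_divide_eq mult.commute)
  then show ?thesis using a by (simp add: line_dist_eq pos_le_divide_eq mult.commute)
qed

lemma line_dist_pos:
  assumes "X \<noteq> 0"
  shows "0 < line_dist D z X"
proof -
  obtain r where r: "r \<in> radii X" using radii_nonempty by blast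
  then have "0 < r" by (simp add: radii_def)
  also have "r \<le> line_dist D z X" unfolding line_dist_eq by (rule cSup_upper[OF r bdd_above_radii[OF assms]])
  finally show ?thesis .
qed

text \<open>For each \<open>r\<close> beyond the distance some \<open>z + \<zeta> *s X\<close> with
  \<open>|\<zeta>| < r\<close> is missing, which gives the inequality with \<open>r\<close>. Letting
  \<open>r\<close> decrease to the distance avoids asking whether a nearest missing point is
  attained.\<close>

lemma caratheodory_lower_bound:
  assumes X: "X \<noteq> 0"
  shows "1 \<le> 4 * caratheodory_metric D z X * line_dist D z X"
proof -
  let ?d = "line_dist D z X" and ?g = "caratheodory_metric D z X"
  have "1 \<le> 4 * ?g * r" if r: "r > ?d" for r
  proof -
    have r0: "r > 0" using line_dist_pos[OF X] r by simp
    have "r \<notin> radii X" using cSup_upper[OF _ bdd_above_radii[OF X], of r] r by (auto simp: line_dist_eq)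
    then obtain \<zeta> where \<zeta>: "cmod \<zeta> < r" "z + \<zeta> *s X \<notin> D" using r0 by (auto simp: radii_def)
    then have nz: "\<zeta> \<noteq> 0" using z by auto
    obtain g where g: "g \<in> disc_functions" "1 / (4 * cmod \<zeta>) \<le> cmod (dz g X)"
      by (rule exists_disc_function_deriv_ge[OF \<zeta>(2)])
    have "1 / (4 * cmod \<zeta>) \<le> ?g" using g(2) le_caratheodory[OF g(1)] by (rule order_trans)
    then have "1 \<le> ?g * (4 * cmod \<zeta>)" using nz by (simp add: divide_le_eq)
    also have "\<dots> \<le> ?g * (4 * r)" using \<zeta>(1) caratheodory_nonneg by (intro mult_left_mono) auto
    finally show ?thesis by (simp add: mult_ac)
  qed
  then have ev: "\<forall>\<^sub>F r in at_right ?d. 1 \<le> 4 * ?g * r" by (rule eventually_mono[OF eventually_at_right_less])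
  have "((\<lambda>r. 4 * ?g * r) \<longlongrightarrow> 4 * ?g * ?d) (at_right ?d)" by (intro tendsto_intros)
  from tendsto_lowerbound[OF this ev] show ?thesis by simp
qed

section \<open>Affine discs as competitors for the Kobayashi metric\<close>

definition inverse_disc_radii :: "complex ^ 'n \<Rightarrow> real set" where
  "inverse_disc_radii X = {\<alpha>. \<alpha> \<ge> 0 \<and> (\<exists>\<phi> :: complex \<Rightarrow> complex ^ 'n.
    (\<forall>i. (\<lambda>\<zeta>. \<phi> \<zeta> $ i) holomorphic_on ball 0 1) \<and> \<phi> ` ball 0 1 \<subseteq> D \<and>
    \<phi> 0 = z \<and> \<alpha> *\<^sub>R (\<chi> i. deriv (\<lambda>\<zeta>. \<phi> \<zeta> $ i) 0) = X)}"

lemma kobayashi_eq: "kobayashi_metric D z X = Inf (inverse_disc_radii X)"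
  by (simp add: kobayashi_metric_def inverse_disc_radii_def)

lemma bdd_below_inverse_disc_radii: "bdd_below (inverse_disc_radii X)"
  unfolding inverse_disc_radii_def by (rule bdd_belowI[of _ 0]) simp

lemma kobayashi_zero: "kobayashi_metric D z 0 \<le> 0"
  unfolding kobayashi_eq
proof (rule cInf_lower[OF _ bdd_below_inverse_disc_radii])
  show "0 \<in> inverse_disc_radii 0"
    unfolding inverse_disc_radii_def using z by (intro CollectI conjI exI[of _ "\<lambda>_. z"]) auto
qed

lemma inverse_radius_in_inverse_disc_radii:
  assumes r: "r \<in> radii X"
  shows "1 / r \<in> inverse_disc_radii X"
  unfolding inverse_disc_radii_def
proof (intro CollectI conjI exI[of _ "\<lambda>\<zeta>. z + (\<zeta> * of_real r) *s X"])
  have r0: "r > 0" using r by (simp add: radii_def)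
  show "0 \<le> 1 / r" using r0 by simp
  show "\<forall>i. (\<lambda>\<zeta>. (z + (\<zeta> * of_real r) *s X) $ i) holomorphic_on ball 0 1"
    by (auto intro!: holomorphic_intros)
  show "(\<lambda>\<zeta>. z + (\<zeta> * of_real r) *s X) ` ball 0 1 \<subseteq> D"
  proof safe
    fix \<zeta> :: complex assume "\<zeta> \<in> ball 0 1"
    then have "cmod (\<zeta> * of_real r) < r" using r0 by (simp add: norm_mult)
    then show "z + (\<zeta> * of_real r) *s X \<in> D" using r by (simp add: radii_def)
  qed
  have "deriv (\<lambda>\<zeta>. (z + (\<zeta> * of_real r) *s X) $ i) 0 = of_real r * X $ i" for i
    by (rule DERIV_imp_deriv) (auto intro!: derivative_eq_intros)
  then show "(1 / r) *\<^sub>R (\<chi> i. deriv (\<lambda>\<zeta>. (z + (\<zeta> * of_real r) *s X) $ i) 0) = X"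
    using r0 by (simp add: vec_eq_iff scaleR_conv_of_real[where 'a = complex])
qed simp

lemma kobayashi_le: "r \<in> radii X \<Longrightarrow> kobayashi_metric D z X \<le> 1 / r"
  unfolding kobayashi_eq
  by (rule cInf_lower[OF inverse_radius_in_inverse_disc_radii bdd_below_inverse_disc_radii])

lemma kobayashi_nonneg: "0 \<le> kobayashi_metric D z X"
proof -
  obtain r where "r \<in> radii X" using radii_nonempty by blast
  then have "inverse_disc_radii X \<noteq> {}" using inverse_radius_in_inverse_disc_radii by blast
  then show ?thesis
    unfolding kobayashi_eq by (rule cInf_greatest) (simp add: inverse_disc_radii_def)
qed

text \<open>Writing \<open>k\<close>, \<open>?g\<close>, \<open>?B\<close> for the Kobayashi,
  Caratheodory and Bergman metrics, combine \<open>k * ?d \<le> 1 \<le> 4 * ?g * ?d\<close>,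
  \<open>?g \<le> ?B\<close> and \<open>?B * ?d \<le> c\<close>, and divide by
  \<open>?d > 0\<close>. At \<open>X = 0\<close> the radii are unbounded and
  \<open>line_dist\<close> is a default value, so that case evaluates the metrics directly.\<close>

lemma metric_estimates:
  assumes c: "c = 2 * real CARD('n) * 4 ^ CARD('n) * sqrt (\<omega> ^ CARD('n) / \<beta>)"
  shows "X \<noteq> 0 \<Longrightarrow> bergman_metric D z X * line_dist D z X \<le> c"
    and "1 / 4 * kobayashi_metric D z X \<le> bergman_metric D z X"
    and "bergman_metric D z X \<le> 4 * c * caratheodory_metric D z X"
proof -
  let ?B = "bergman_metric D z X" and ?d = "line_dist D z X" and ?g = "caratheodory_metric D z X"
  have c0: "c > 0" unfolding c using \<omega> \<beta> by simp
  have Bd: "?B * ?d \<le> c"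
    unfolding c by (intro mult_line_dist_le bergman_metric_nonneg bergman_mult_radius_le)
  then show "?B * ?d \<le> c" if "X \<noteq> 0" .
  have "1 / 4 * kobayashi_metric D z X \<le> ?B \<and> ?B \<le> 4 * c * ?g"
  proof (cases "X = 0")
    case True
    have "bergman_M D z 0 \<le> 0"
      unfolding bergman_M_def
    proof (rule cSup_least)
      show "M_values 0 \<noteq> {}"
        using admissible_nonempty by blast
      fix x assume "x \<in> M_values 0"
      then obtain f where f: "f \<in> L2h D" "x = cmod (dz f 0)" by blast
      have "dz f 0 = 0"
        using frechet_derivative_linear[OF _ opD z, of f] f(1) by (simp add: L2h_def linear_0)
      then show "x \<le> 0" by (simp add: f(2))
    qed
    then have "bergman_metric D z 0 \<le> 0"
      unfolding bergman_metric_def using kernel_lower_bound(2) by (simp add: divide_le_0_iff)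
    moreover have "0 \<le> 4 * c * caratheodory_metric D z 0"
      using caratheodory_nonneg[of 0] c0 by (intro mult_nonneg_nonneg) simp_all
    ultimately show ?thesis
      unfolding True using kobayashi_zero bergman_metric_nonneg[of 0] by linarith
  next
    case False
    have d: "?d > 0" by (rule line_dist_pos[OF False])
    have g: "1 \<le> 4 * ?g * ?d" by (rule caratheodory_lower_bound[OF False])
    have "kobayashi_metric D z X * ?d \<le> 1"
    proof (rule mult_line_dist_le[OF kobayashi_nonneg])
      fix r assume r: "r \<in> radii X"
      then have "r > 0" by (simp add: radii_def)
      then show "kobayashi_metric D z X * r \<le> 1" using kobayashi_le[OF r] by (simp add: field_simps)
    qed
    also have "1 \<le> 4 * ?B * ?d"
    proof -
      have "?g * (4 * ?d) \<le> ?B * (4 * ?d)" using d by (intro mult_right_mono caratheodory_le_bergman) simp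
      with g show ?thesis by (simp add: mult_ac)
    qed
    finally have "kobayashi_metric D z X \<le> 4 * ?B" using d by simp
    moreover have "?B * ?d \<le> (4 * c * ?g) * ?d"
    proof -
      have "c * 1 \<le> c * (4 * ?g * ?d)" using g c0 by (intro mult_left_mono) auto
      then show ?thesis using Bd by (simp add: mult_ac)
    qed
    then have "?B \<le> 4 * c * ?g" using d by (rule mult_right_le_imp_le)
    ultimately show ?thesis by simp
  qed
  then show "1 / 4 * kobayashi_metric D z X \<le> ?B" "?B \<le> 4 * c * ?g" by auto
qed

end

theorem theorem12:
  "\<exists>c::real. c > 0 \<and>
     (\<forall>D :: (complex ^ 'n::finite) set.
        C_convex_domain D \<and> \<not> contains_complex_line D \<longrightarrow>
          (\<forall>z\<in>D. \<forall>X. X \<noteq> 0 \<longrightarrow> bergman_metric D z X * line_dist D z X \<le> c) \<and>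
          (\<forall>z\<in>D. \<forall>X. 1 / 4 * kobayashi_metric D z X \<le> bergman_metric D z X \<and>
                       bergman_metric D z X \<le> 4 * c * caratheodory_metric D z X))"
proof -
  define c where "c = 2 * real CARD('n) * 4 ^ CARD('n) *
    sqrt (measure lborel (ball (0::complex) 1) ^ CARD('n) / measure lborel (half_l1_ball :: (complex ^ 'n) set))"
  have "0 < measure lborel (ball (0::complex) 1)"
    using content_ball_pos[of 1 "0::complex"] by simp
  then have "c > 0"
    unfolding c_def using emeasure_half_l1_ball(2)[where 'n = 'n] by simp
  moreover have "(X \<noteq> 0 \<longrightarrow> bergman_metric D z X * line_dist D z X \<le> c) \<and>
      1 / 4 * kobayashi_metric D z X \<le> bergman_metric D z X \<and>
      bergman_metric D z X \<le> 4 * c * caratheodory_metric D z X"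
    if D: "C_convex_domain D" "\<not> contains_complex_line D" "z \<in> D" for D :: "(complex ^ 'n) set" and z X
  proof -
    obtain A \<kappa> where "C_convex_frame D z A \<kappa> (measure lborel (half_l1_ball :: (complex ^ 'n) set))"
      using exists_C_convex_frame[OF D] by blast
    then show ?thesis using C_convex_frame.metric_estimates[OF _ c_def] by blast
  qed
  ultimately show ?thesis by blast
qed

end
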